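(* Let $d=2$, let $\partial M$ be uniformly of class $C^{1,1}$, let $x_\varepsilon\in M$, and write $\delta_\varepsilon=\operatorname{dist}(x_\varepsilon,\partial M)$. As $\varepsilon\to0$: (i) (boundary-scale centers) if $\delta_\varepsilon/\varepsilon=O(1)$ (including $\delta_\varepsilon=0$), then $$\lambda\big(B_M(x_\varepsilon,\varepsilon)\big)=\frac12\cdot\frac{\pi}{|M|\log(1/\varepsilon)}\,(1+o(1));$$ (ii) (intermediate centers) if $\varepsilon\ll\delta_\varepsilon\ll1$ and $\theta:=\lim\log(1/\delta_\varepsilon)/\log(1/\varepsilon)\in(0,1)$ (equivalently $\delta_\varepsilon=\varepsilon^{\theta+o(1)}$), then $$\lambda\big(B_M(x_\varepsilon,\varepsilon)\big)=B(\theta)\cdot\frac{\pi}{|M|\log(1/\varepsilon)}\,(1+o(1)),\qquad B(\theta)=\frac1{1+\theta};$$ (iii) (macroscopically interior centers) if $\delta_\varepsilon$ is bounded below by a positive constant, then $$\lambda\big(B_M(x_\varepsilon,\varepsilon)\big)=\frac{\pi}{|M|\log(1/\varepsilon)}\,(1+o(1)).$$ With $\theta=0$ assigned to case (iii) and $\theta=1$ to case (i), the three regimes are the single asymptotic $\lambda(B_M(x_\varepsilon,\varepsilon))=B(\theta)\,\pi/(|M|\log(1/\varepsilon))\,(1+o(1))$ with $B(\theta)=1/(1+\theta)$.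
   Context: Setting. $M\subset\mathbb R^2$ is the closure of a bounded connected open set. $d_M(x,y)$ is the infimum of the lengths of rectifiable curves in $M$ joining $x$ to $y$; $B_M(x,\varepsilon)=\{y\in M:d_M(x,y)<\varepsilon\}$; $\mu(A)=|A|/|M|$ is normalized Lebesgue measure on $M$. $M$ satisfies: (1) positive reach (every $z$ with $0<\operatorname{dist}(z,M)<\operatorname{reach}(M)$, $\operatorname{reach}(M)>0$, has a unique nearest point in $M$); (2) there are $c_{ie}\ge1$, $\rho_{ie}>0$ with $d_M(x,y)\le c_{ie}|x-y|$ whenever $x,y\in M$, $|x-y|<\rho_{ie}$; (3) there are $c_{vol},C_{vol},\rho_{vol}>0$ with $c_{vol}\varepsilon^2\le\mu(B_M(x,\varepsilon))\le C_{vol}\varepsilon^2$ for all $x\in M$, $0<\varepsilon<\rho_{vol}$; (4) $M$ is an admissible reflecting domain: reflected Brownian motion exists and is unique in law with symmetric Neumann heat kernel, compact Neumann semigroup on $L^2(M,\mu)$, discrete Neumann spectrum with positive gap, and uniform bi-Lipschitz charts at a fixed scale (onto balls in the interior, half-balls with $\partial M$ flattened near $\partial M$). Notation. $\mathcal E(f,g)=\frac12\int_M\nabla f\cdot\nabla g\,d\mu$ on $H^1(M)$; for $A\subset M$ of positive capacity, $\lambda(A)=\lambda_A=\inf\{\mathcal E(f,f)/\|f\|_{L^2(\mu)}^2: f\in H^1(M),\ f=0\text{ quasi-everywhere on }A,\ f\ne0\}$. *)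

theory Defs
  imports "HOL-Probability.Probability" "HOL-Library.Landau_Symbols"
begin

section \<open>Intrinsic metric, normalized volume, geometric hypotheses\<close>

definition bounded_domain_closure :: "(real^2) set \<Rightarrow> bool" where
  "bounded_domain_closure M \<longleftrightarrow>
     (\<exists>U. open U \<and> bounded U \<and> connected U \<and> U \<noteq> {} \<and> M = closure U)"

definition curve_length :: "(real \<Rightarrow> real^2) \<Rightarrow> ennreal" where
  "curve_length \<gamma> =
     (SUP (n, t) \<in> {(n :: nat, t :: nat \<Rightarrow> real). t 0 = 0 \<and> t n = 1 \<and> mono_on {0..n} t}.
        \<Sum>i<n. ennreal (dist (\<gamma> (t i)) (\<gamma> (t (Suc i)))))"

text \<open>Points that no rectifiable curve in the set joins have distance \<open>\<infinity>\<close>.\<close>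

definition intrinsic_dist :: "(real^2) set \<Rightarrow> real^2 \<Rightarrow> real^2 \<Rightarrow> ennreal" where
  "intrinsic_dist M x y =
     (INF \<gamma> \<in> {\<gamma>. path \<gamma> \<and> path_image \<gamma> \<subseteq> M \<and> pathstart \<gamma> = x \<and> pathfinish \<gamma> = y
                     \<and> curve_length \<gamma> < \<infinity>}. curve_length \<gamma>)"

definition intrinsic_ball :: "(real^2) set \<Rightarrow> real^2 \<Rightarrow> real \<Rightarrow> (real^2) set" where
  "intrinsic_ball M x \<epsilon> = {y \<in> M. intrinsic_dist M x y < ennreal \<epsilon>}"

definition nvol :: "(real^2) set \<Rightarrow> (real^2) measure" where
  "nvol M = uniform_measure lebesgue M"

definition reach :: "(real^2) set \<Rightarrow> ereal" where
  "reach M = (SUP r \<in> {r. 0 \<le> r \<and>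
       (\<forall>z. 0 < infdist z M \<and> infdist z M < r \<longrightarrow> (\<exists>!p. p \<in> M \<and> dist z p = infdist z M))}. ereal r)"

definition positive_reach :: "(real^2) set \<Rightarrow> bool" where
  "positive_reach M \<longleftrightarrow> 0 < reach M"

definition intrinsic_euclidean_comparable :: "(real^2) set \<Rightarrow> bool" where
  "intrinsic_euclidean_comparable M \<longleftrightarrow>
     (\<exists>c\<ge>1. \<exists>\<rho>>0. \<forall>x\<in>M. \<forall>y\<in>M. dist x y < \<rho> \<longrightarrow>
        intrinsic_dist M x y \<le> ennreal (c * dist x y))"

definition quadratic_volume_growth :: "(real^2) set \<Rightarrow> bool" where
  "quadratic_volume_growth M \<longleftrightarrow>
     (\<exists>c>0. \<exists>C>0. \<exists>\<rho>>0. \<forall>x\<in>M. \<forall>\<epsilon>. 0 < \<epsilon> \<and> \<epsilon> < \<rho> \<longrightarrow>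
        c * \<epsilon>\<^sup>2 \<le> measure (nvol M) (intrinsic_ball M x \<epsilon>) \<and>
        measure (nvol M) (intrinsic_ball M x \<epsilon>) \<le> C * \<epsilon>\<^sup>2)"

text \<open>Near every boundary point, after a rigid motion taking that point to the origin, \<open>M\<close> is
  the region above the graph of a function with bounded, Lipschitz derivative. Uniformity means
  that the radius \<open>r\<close> and the bound \<open>K\<close> do not depend on the boundary point.\<close>

definition uniformly_C11_boundary :: "(real^2) set \<Rightarrow> bool" where
  "uniformly_C11_boundary M \<longleftrightarrow>
     (\<exists>r>0. \<exists>K\<ge>0. \<forall>p\<in>frontier M. \<exists>T :: real^2 \<Rightarrow> real^2. \<exists>h h' :: real \<Rightarrow> real.
        orthogonal_transformation T \<and> h 0 = 0 \<and>
        (\<forall>s. (h has_real_derivative h' s) (at s) \<and> \<bar>h' s\<bar> \<le> K) \<and>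
        K-lipschitz_on UNIV h' \<and>
        M \<inter> ball p r = (\<lambda>y. p + T y) ` {y. h (y $ 1) \<le> y $ 2} \<inter> ball p r)"

section \<open>The Sobolev space and the Dirichlet form\<close>

primrec C_k :: "nat \<Rightarrow> (real^2 \<Rightarrow> real) set" where
  "C_k 0 = {\<phi>. continuous_on UNIV \<phi>}"
| "C_k (Suc k) = {\<phi>. \<phi> differentiable_on UNIV \<and>
     (\<forall>i. (\<lambda>x. frechet_derivative \<phi> (at x) (axis i 1)) \<in> C_k k)}"

definition test_functions :: "(real^2) set \<Rightarrow> (real^2 \<Rightarrow> real) set" where
  "test_functions U = {\<phi>. (\<forall>k. \<phi> \<in> C_k k) \<and>
     compact (closure {x. \<phi> x \<noteq> 0}) \<and> closure {x. \<phi> x \<noteq> 0} \<subseteq> U}"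

text \<open>Elements of \<open>L\<^sup>2(M, \<mu>)\<close> are represented by functions on the plane; their values outside
  \<open>M\<close> are irrelevant because \<open>nvol M\<close> does not charge the complement of \<open>M\<close>. Equality of
  elements is equality almost everywhere with respect to \<open>nvol M\<close>.\<close>

definition L2 :: "(real^2) set \<Rightarrow> (real^2 \<Rightarrow> real) set" where
  "L2 M = {f \<in> borel_measurable (nvol M). integrable (nvol M) (\<lambda>x. (f x)\<^sup>2)}"

definition L2_inner :: "(real^2) set \<Rightarrow> (real^2 \<Rightarrow> real) \<Rightarrow> (real^2 \<Rightarrow> real) \<Rightarrow> real" where
  "L2_inner M f g = (\<integral>x. f x * g x \<partial>(nvol M))"

definition L2_norm :: "(real^2) set \<Rightarrow> (real^2 \<Rightarrow> real) \<Rightarrow> real" where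
  "L2_norm M f = sqrt (L2_inner M f f)"

text \<open>Weak derivatives are taken on the interior of \<open>M\<close>. The gradient is set to zero elsewhere,
  which makes it unique almost everywhere; for a \<open>C\<^sup>1\<^sup>,\<^sup>1\<close> boundary this only affects a null set.\<close>

definition has_weak_gradient :: "(real^2) set \<Rightarrow> (real^2 \<Rightarrow> real) \<Rightarrow> (real^2 \<Rightarrow> real^2) \<Rightarrow> bool" where
  "has_weak_gradient M f G \<longleftrightarrow>
     (\<forall>i. (\<lambda>x. G x $ i) \<in> L2 M) \<and>
     (\<forall>x. x \<notin> interior M \<longrightarrow> G x = 0) \<and>
     (\<forall>\<phi>\<in>test_functions (interior M). \<forall>i.
        (LINT x:interior M|lebesgue. f x * frechet_derivative \<phi> (at x) (axis i 1)) =
        - (LINT x:interior M|lebesgue. G x $ i * \<phi> x))"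

definition H1 :: "(real^2) set \<Rightarrow> (real^2 \<Rightarrow> real) set" where
  "H1 M = {f \<in> L2 M. \<exists>G. has_weak_gradient M f G}"

definition weak_gradient :: "(real^2) set \<Rightarrow> (real^2 \<Rightarrow> real) \<Rightarrow> real^2 \<Rightarrow> real^2" where
  "weak_gradient M f = (SOME G. has_weak_gradient M f G)"

definition dirichlet_form :: "(real^2) set \<Rightarrow> (real^2 \<Rightarrow> real) \<Rightarrow> (real^2 \<Rightarrow> real) \<Rightarrow> real" where
  "dirichlet_form M f g =
     1/2 * (\<integral>x. weak_gradient M f x \<bullet> weak_gradient M g x \<partial>(nvol M))"

section \<open>Capacity, quasi-everywhere, principal Dirichlet eigenvalue\<close>

text \<open>Capacity of the form \<open>\<E>(u,u) + \<parallel>u\<parallel>\<^sup>2\<close>. The constant function 1 is admissible for every set,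
  so the infimum is over a nonempty set of nonnegative numbers.\<close>

definition form_capacity :: "(real^2) set \<Rightarrow> (real^2) set \<Rightarrow> real" where
  "form_capacity M A = Inf {dirichlet_form M u u + L2_inner M u u | u.
     u \<in> H1 M \<and> (\<exists>G. openin (top_of_set M) G \<and> A \<inter> M \<subseteq> G \<and> (AE x in nvol M. x \<in> G \<longrightarrow> 1 \<le> u x))}"

definition quasi_continuous :: "(real^2) set \<Rightarrow> (real^2 \<Rightarrow> real) \<Rightarrow> bool" where
  "quasi_continuous M f \<longleftrightarrow>
     (\<forall>\<eta>>0. \<exists>G. openin (top_of_set M) G \<and> form_capacity M G < \<eta> \<and> continuous_on (M - G) f)"

text \<open>As usual, the condition refers to a quasi-continuous version of the class of \<open>f\<close>.\<close>

definition zero_qe_on :: "(real^2) set \<Rightarrow> (real^2) set \<Rightarrow> (real^2 \<Rightarrow> real) \<Rightarrow> bool" where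
  "zero_qe_on M A f \<longleftrightarrow>
     (\<exists>g. quasi_continuous M g \<and> (AE x in nvol M. g x = f x) \<and>
          form_capacity M {x \<in> A. g x \<noteq> 0} = 0)"

definition dirichlet_eigenvalue :: "(real^2) set \<Rightarrow> (real^2) set \<Rightarrow> real" where
  "dirichlet_eigenvalue M A = Inf {dirichlet_form M f f / (L2_norm M f)\<^sup>2 | f.
     f \<in> H1 M \<and> zero_qe_on M A f \<and> \<not> (AE x in nvol M. f x = 0)}"

section \<open>Neumann semigroup, Neumann spectrum, reflected Brownian motion\<close>

text \<open>The nonnegative self-adjoint operator of the form, that is \<open>-\<Delta>/2\<close> with Neumann boundary
  conditions: \<open>h\<close> is the image of \<open>f\<close>.\<close>

definition neumann_operator :: "(real^2) set \<Rightarrow> (real^2 \<Rightarrow> real) \<Rightarrow> (real^2 \<Rightarrow> real) \<Rightarrow> bool" where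
  "neumann_operator M f h \<longleftrightarrow>
     f \<in> H1 M \<and> h \<in> L2 M \<and> (\<forall>v\<in>H1 M. dirichlet_form M f v = L2_inner M h v)"

text \<open>Strongly continuous symmetric contraction semigroup on \<open>L\<^sup>2(M, \<mu>)\<close> whose generator is
  minus the Neumann operator.\<close>

definition neumann_semigroup ::
    "(real^2) set \<Rightarrow> (real \<Rightarrow> (real^2 \<Rightarrow> real) \<Rightarrow> (real^2 \<Rightarrow> real)) \<Rightarrow> bool" where
  "neumann_semigroup M P \<longleftrightarrow>
     (\<forall>t\<ge>0. \<forall>f\<in>L2 M. P t f \<in> L2 M \<and> L2_norm M (P t f) \<le> L2_norm M f) \<and>
     (\<forall>t\<ge>0. \<forall>f\<in>L2 M. \<forall>g\<in>L2 M. (AE x in nvol M. f x = g x) \<longrightarrow> (AE x in nvol M. P t f x = P t g x)) \<and>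
     (\<forall>t\<ge>0. \<forall>f\<in>L2 M. \<forall>g\<in>L2 M. \<forall>a b.
        AE x in nvol M. P t (\<lambda>y. a * f y + b * g y) x = a * P t f x + b * P t g x) \<and>
     (\<forall>t\<ge>0. \<forall>f\<in>L2 M. \<forall>g\<in>L2 M. L2_inner M (P t f) g = L2_inner M f (P t g)) \<and>
     (\<forall>f\<in>L2 M. AE x in nvol M. P 0 f x = f x) \<and>
     (\<forall>s\<ge>0. \<forall>t\<ge>0. \<forall>f\<in>L2 M. AE x in nvol M. P (s + t) f x = P s (P t f) x) \<and>
     (\<forall>f\<in>L2 M. ((\<lambda>t. L2_norm M (\<lambda>x. P t f x - f x)) \<longlongrightarrow> 0) (at_right 0)) \<and>
     (\<forall>f\<in>L2 M. \<forall>h\<in>L2 M.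
        ((\<lambda>t. L2_norm M (\<lambda>x. (P t f x - f x) / t + h x)) \<longlongrightarrow> 0) (at_right 0)
          \<longleftrightarrow> neumann_operator M f h)"

definition compact_on_L2 :: "(real^2) set \<Rightarrow> ((real^2 \<Rightarrow> real) \<Rightarrow> (real^2 \<Rightarrow> real)) \<Rightarrow> bool" where
  "compact_on_L2 M T \<longleftrightarrow>
     (\<forall>F :: nat \<Rightarrow> real^2 \<Rightarrow> real. (\<forall>n. F n \<in> L2 M \<and> L2_norm M (F n) \<le> 1) \<longrightarrow>
        (\<exists>g\<in>L2 M. \<exists>r :: nat \<Rightarrow> nat. strict_mono r \<and>
           (\<lambda>n. L2_norm M (\<lambda>x. T (F (r n)) x - g x)) \<longlonglongrightarrow> 0))"

text \<open>Discrete spectrum \<open>0 = \<nu>\<^sub>0 < \<nu>\<^sub>1 \<le> \<nu>\<^sub>2 \<le> \<dots> \<rightarrow> \<infinity>\<close>, eigenvalues listed with multiplicity, for a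
  complete orthonormal system of Neumann eigenfunctions; \<open>\<nu>\<^sub>1\<close> is the gap.\<close>

definition discrete_neumann_spectrum_with_gap :: "(real^2) set \<Rightarrow> bool" where
  "discrete_neumann_spectrum_with_gap M \<longleftrightarrow>
     (\<exists>(\<phi> :: nat \<Rightarrow> real^2 \<Rightarrow> real) (\<nu> :: nat \<Rightarrow> real).
        (\<forall>k. neumann_operator M (\<phi> k) (\<lambda>x. \<nu> k * \<phi> k x)) \<and>
        (\<forall>j k. L2_inner M (\<phi> j) (\<phi> k) = (if j = k then 1 else 0)) \<and>
        (\<forall>f\<in>L2 M. (\<forall>k. L2_inner M f (\<phi> k) = 0) \<longrightarrow> (AE x in nvol M. f x = 0)) \<and>
        incseq \<nu> \<and> filterlim \<nu> at_top sequentially \<and> \<nu> 0 = 0 \<and> 0 < \<nu> 1)"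

text \<open>Continuous paths from \<open>[0,\<infinity>)\<close> to \<open>M\<close> with the \<open>\<sigma>\<close>-algebra generated by the coordinates.\<close>

definition path_space :: "(real^2) set \<Rightarrow> (real \<Rightarrow> real^2) measure" where
  "path_space M = restrict_space (Pi\<^sub>M {0..} (\<lambda>_. borel))
     {\<omega>. continuous_on {0..} \<omega> \<and> \<omega> ` {0..} \<subseteq> M}"

text \<open>\<open>Q x\<close> is the law of the process started at \<open>x\<close>. Reflected Brownian motion is the continuous
  Markov process with Feller transition function whose \<open>L\<^sup>2\<close>-semigroup is the Neumann semigroup,
  that is, the diffusion of the Dirichlet form; the Feller property pins down the laws for
  every starting point rather than for almost every one. The Markov property at time \<open>s\<close> is
  stated with the events \<open>{\<omega>. restrict \<omega> {0..s} \<in> S}\<close> of the natural filtration.\<close>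

definition reflected_brownian_motion ::
    "(real^2) set \<Rightarrow> (real^2 \<Rightarrow> (real \<Rightarrow> real^2) measure) \<Rightarrow> bool" where
  "reflected_brownian_motion M Q \<longleftrightarrow>
     (\<forall>x\<in>M. prob_space (Q x) \<and> sets (Q x) = sets (path_space M) \<and> (AE \<omega> in Q x. \<omega> 0 = x)) \<and>
     (\<forall>x\<in>M. \<forall>s\<ge>0. \<forall>t\<ge>0. \<forall>S\<in>sets (Pi\<^sub>M {0..s} (\<lambda>_. borel)). \<forall>f. continuous_on UNIV f \<longrightarrow>
        (\<integral>\<omega>. indicator S (restrict \<omega> {0..s}) * f (\<omega> (s + t)) \<partial>(Q x)) =
        (\<integral>\<omega>. indicator S (restrict \<omega> {0..s}) * (\<integral>\<eta>. f (\<eta> t) \<partial>(Q (\<omega> s))) \<partial>(Q x) :: real)) \<and>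
     (\<forall>t\<ge>0. \<forall>f :: real^2 \<Rightarrow> real. continuous_on UNIV f \<longrightarrow>
        continuous_on M (\<lambda>x. \<integral>\<omega>. f (\<omega> t) \<partial>(Q x))) \<and>
     (\<exists>P. neumann_semigroup M P \<and>
        (\<forall>t\<ge>0. \<forall>f. continuous_on UNIV f \<longrightarrow>
           (AE x in nvol M. (\<integral>\<omega>. f (\<omega> t) \<partial>(Q x)) = P t f x)))"

definition symmetric_heat_kernel ::
    "(real^2) set \<Rightarrow> (real^2 \<Rightarrow> (real \<Rightarrow> real^2) measure) \<Rightarrow> (real \<Rightarrow> real^2 \<Rightarrow> real^2 \<Rightarrow> real) \<Rightarrow> bool" where
  "symmetric_heat_kernel M Q p \<longleftrightarrow>
     (\<forall>t>0. (\<lambda>(x, y). p t x y) \<in> borel_measurable (nvol M \<Otimes>\<^sub>M nvol M) \<and>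
        (\<forall>x\<in>M. \<forall>y\<in>M. 0 \<le> p t x y \<and> p t x y = p t y x) \<and>
        (\<forall>x\<in>M. integrable (nvol M) (p t x)) \<and>
        (\<forall>x\<in>M. \<forall>f. continuous_on UNIV f \<longrightarrow>
           (\<integral>\<omega>. f (\<omega> t) \<partial>(Q x)) = (\<integral>y. p t x y * f y \<partial>(nvol M))))"

text \<open>All charts have the same target radius \<open>r\<close> and bi-Lipschitz constant \<open>L\<close>, and each covers
  the part of \<open>M\<close> within the fixed distance \<open>s\<close> of its base point. Points closer than \<open>s\<close> to the
  boundary must therefore have a chart of the second kind.\<close>

definition uniform_bilipschitz_charts :: "(real^2) set \<Rightarrow> bool" where
  "uniform_bilipschitz_charts M \<longleftrightarrow>
     (\<exists>r>0. \<exists>s>0. \<exists>L\<ge>1. \<forall>x\<in>M. \<exists>V. \<exists>\<Phi> :: real^2 \<Rightarrow> real^2.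
        openin (top_of_set M) V \<and> M \<inter> ball x s \<subseteq> V \<and>
        L-lipschitz_on V \<Phi> \<and> (\<forall>y\<in>V. \<forall>z\<in>V. dist y z \<le> L * dist (\<Phi> y) (\<Phi> z)) \<and>
        (V \<inter> frontier M = {} \<and> \<Phi> ` V = ball 0 r \<or>
         \<Phi> ` V = {y \<in> ball 0 r. 0 \<le> y $ 2} \<and>
         \<Phi> ` (V \<inter> frontier M) = {y \<in> ball 0 r. y $ 2 = 0}))"

definition admissible_reflecting_domain :: "(real^2) set \<Rightarrow> bool" where
  "admissible_reflecting_domain M \<longleftrightarrow>
     (\<exists>Q. reflected_brownian_motion M Q \<and>
        (\<forall>Q'. reflected_brownian_motion M Q' \<longrightarrow> (\<forall>x\<in>M. Q' x = Q x)) \<and>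
        (\<exists>p. symmetric_heat_kernel M Q p)) \<and>
     (\<exists>P. neumann_semigroup M P \<and> (\<forall>t>0. compact_on_L2 M (P t))) \<and>
     discrete_neumann_spectrum_with_gap M \<and>
     uniform_bilipschitz_charts M"

section \<open>The boundary factor\<close>

definition boundary_factor :: "real \<Rightarrow> real" where
  "boundary_factor \<theta> = 1 / (1 + \<theta>)"

end

theory Submission
  imports Defs "HOL-Real_Asymp.Real_Asymp"
begin

text \<open>Write \<open>\<delta>\<close> for the distance of the center from the boundary and put \<open>T = log (1/\<epsilon>) + log
  (1/max \<epsilon> \<delta>)\<close>, called \<open>scale\<close> below. Everything follows from one asymptotic that is uniform in
  the center (\<open>eigenvalue_scale\<close>): \<open>\<lambda> |M| T / \<pi> \<rightarrow> 1\<close>. Indeed \<open>log (1/max \<epsilon> \<delta>) / log (1/\<epsilon>)\<close>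
  tends to \<open>1\<close>, to \<open>\<theta>\<close> and to \<open>0\<close> in the three regimes, so that \<open>T\<close> is asymptotic to \<open>(1 + \<theta>)
  log (1/\<epsilon>)\<close>.

  The reason for the asymptotic is electrostatic. The eigenvalue of a small hole is, to leading
  order, \<open>1/(2|M|)\<close> times the capacity of the hole relative to macroscopic distances, that is,
  times the inverse of a resistance. Between the radii \<open>\<epsilon>\<close> and \<open>\<delta>\<close> the domain contains full
  circles around the center, and the resistance is \<open>1/(2\<pi>)\<close> per unit of \<open>log r\<close>. Between \<open>\<delta>\<close>
  and a fixed radius only about half of each circle lies in the domain, which doubles the
  resistance. The sum is \<open>(log (\<delta>/\<epsilon>) + 2 log (1/\<delta>)) / (2\<pi>) = T / (2\<pi>)\<close>; if \<open>\<delta> < \<epsilon>\<close>, then \<open>\<epsilon>\<close>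
  takes the place of \<open>\<delta>\<close>.

  Upper bound (\<open>eigenvalue_upper_bound\<close>, Dirichlet principle). The test function is \<open>log (r/\<epsilon>)\<close>
  up to the radius \<open>\<delta>\<close>, essentially continues with twice the slope up to a small fixed radius,
  and is constant afterwards. Outside a set of small volume it is at least \<open>T\<close> up to a
  constant, and its energy is bounded because beyond \<open>\<delta>\<close> the domain lies almost in a half-plane
  (\<open>domain_in_halfplane\<close>).

  Lower bound (\<open>eigenvalue_lower_bound\<close>, Thomson principle). A smooth vector field with compact
  support in the interior carries a unit flux from the hole to a density at a fixed distance:
  it is radial in the disc of radius \<open>\<delta>\<close>, is then turned into a sector of opening almost \<open>\<pi>\<close>,
  and is radial in the sector, which stays in the domain (\<open>sector_in_interior\<close>). Testing the
  weak gradient of \<open>f\<close> with this field bounds the mean of \<open>f\<close> against the final density by the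
  energies of \<open>f\<close> and of the field; the Poincare inequality, which is the spectral gap, turns
  this into a bound for the norm of \<open>f\<close> (\<open>flux_inequality\<close>). As \<open>f\<close> is only ever paired with
  smooth fields, the defining identity of its weak gradient suffices, and vanishing
  quasi-everywhere enters through vanishing almost everywhere (\<open>zero_qe_AE\<close>).

  Both computations are done in the coordinates \<open>s = log r\<close> and angle, in which energies have
  no weight and divergences are plain partial derivatives up to a conformal factor. The
  regularity of the boundary is used in the form of tangent parabolas of uniform size
  (\<open>tangent_parabolas\<close>).\<close>

section \<open>Smooth functions of one real variable\<close>

text \<open>The derivative is a witness, so it is supplied directly by differentiation rules; iterating
  \<open>deriv\<close> would require its values to be known first.\<close>

primrec smooth_upto :: "nat \<Rightarrow> (real \<Rightarrow> real) \<Rightarrow> bool" where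
  "smooth_upto 0 f = continuous_on UNIV f"
| "smooth_upto (Suc k) f =
     (\<exists>f'. (\<forall>t. (f has_real_derivative f' t) (at t)) \<and> smooth_upto k f')"

definition smooth :: "(real \<Rightarrow> real) \<Rightarrow> bool" where
  "smooth f \<longleftrightarrow> (\<forall>k. smooth_upto k f)"

lemma smooth_upto_pred: "smooth_upto (Suc k) f \<Longrightarrow> smooth_upto k f"
proof (induction k arbitrary: f)
  case 0
  then show ?case
    by (auto intro!: continuous_at_imp_continuous_on intro: DERIV_isCont)
next
  case (Suc k)
  then obtain f' where "\<forall>t. (f has_real_derivative f' t) (at t)" "smooth_upto (Suc k) f'"
    by auto
  then show ?case using Suc.IH by auto
qed

lemma smooth_upto_add:
  "smooth_upto k f \<Longrightarrow> smooth_upto k g \<Longrightarrow> smooth_upto k (\<lambda>t. f t + g t)"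
proof (induction k arbitrary: f g)
  case 0
  then show ?case by (auto intro!: continuous_intros)
next
  case (Suc k)
  from Suc.prems obtain f' g' where
    "\<And>t. (f has_real_derivative f' t) (at t)" "smooth_upto k f'"
    "\<And>t. (g has_real_derivative g' t) (at t)" "smooth_upto k g'" by auto
  then show ?case
    using Suc.IH[of f' g'] by (auto intro!: exI[of _ "\<lambda>t. f' t + g' t"] derivative_eq_intros)
qed

lemma smooth_upto_const: "smooth_upto k (\<lambda>t. c)"
  by (induction k arbitrary: c) (auto intro!: exI[of _ "\<lambda>t. 0"])

lemma smooth_upto_id: "smooth_upto k (\<lambda>t. t)"
  by (cases k) (auto intro!: exI[of _ "\<lambda>t. 1"] smooth_upto_const derivative_eq_intros)

lemma smooth_upto_mult:
  "smooth_upto k f \<Longrightarrow> smooth_upto k g \<Longrightarrow> smooth_upto k (\<lambda>t. f t * g t)"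
proof (induction k arbitrary: f g)
  case 0
  then show ?case by (auto intro!: continuous_intros)
next
  case (Suc k)
  from Suc.prems obtain f' g' where
    d: "\<And>t. (f has_real_derivative f' t) (at t)" "smooth_upto k f'"
    "\<And>t. (g has_real_derivative g' t) (at t)" "smooth_upto k g'" by auto
  have "smooth_upto k (\<lambda>t. f' t * g t + g' t * f t)"
    using Suc.IH d Suc.prems[THEN smooth_upto_pred] by (intro smooth_upto_add) auto
  then show ?case
    using d by (auto intro!: exI[of _ "\<lambda>t. f' t * g t + g' t * f t"] derivative_eq_intros)
qed

lemma smooth_upto_compose:
  "smooth_upto k f \<Longrightarrow> smooth_upto k g \<Longrightarrow> smooth_upto k (\<lambda>t. f (g t))"
proof (induction k arbitrary: f g)
  case 0
  then show ?case
    using continuous_on_compose2[of UNIV f UNIV g] by auto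
next
  case (Suc k)
  from Suc.prems obtain f' g' where
    d: "\<And>t. (f has_real_derivative f' t) (at t)" "smooth_upto k f'"
    "\<And>t. (g has_real_derivative g' t) (at t)" "smooth_upto k g'" by auto
  have "smooth_upto k (\<lambda>t. f' (g t) * g' t)"
    using Suc.IH d Suc.prems[THEN smooth_upto_pred] by (intro smooth_upto_mult) auto
  moreover have "((\<lambda>t. f (g t)) has_real_derivative f' (g t) * g' t) (at t)" for t
    using DERIV_chain2[OF d(1) d(3)] by simp
  ultimately show ?case
    unfolding smooth_upto.simps by (intro exI[of _ "\<lambda>t. f' (g t) * g' t"]) blast
qed

lemma smooth_upto_inverse:
  "smooth_upto k f \<Longrightarrow> (\<And>t. f t \<noteq> 0) \<Longrightarrow> smooth_upto k (\<lambda>t. inverse (f t))"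
proof (induction k arbitrary: f)
  case 0
  then show ?case by (auto intro!: continuous_intros)
next
  case (Suc k)
  from Suc.prems obtain f' where
    d: "\<And>t. (f has_real_derivative f' t) (at t)" "smooth_upto k f'" by auto
  have "smooth_upto k (\<lambda>t. - 1 * (f' t * (inverse (f t) * inverse (f t))))"
    using Suc.IH d Suc.prems(1)[THEN smooth_upto_pred] Suc.prems(2)
    by (intro smooth_upto_mult smooth_upto_const) auto
  moreover have "((\<lambda>t. inverse (f t)) has_real_derivative
      - 1 * (f' t * (inverse (f t) * inverse (f t)))) (at t)" for t
    using DERIV_inverse'[OF d(1) Suc.prems(2)] by (simp add: ac_simps)
  ultimately show ?case
    unfolding smooth_upto.simps
    by (intro exI[of _ "\<lambda>t. - 1 * (f' t * (inverse (f t) * inverse (f t)))"]) blast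
qed

lemma smooth_const [intro]: "smooth (\<lambda>t. c)"
  and smooth_id [intro]: "smooth (\<lambda>t. t)"
  and smooth_add [intro]: "smooth f \<Longrightarrow> smooth g \<Longrightarrow> smooth (\<lambda>t. f t + g t)"
  and smooth_mult [intro]: "smooth f \<Longrightarrow> smooth g \<Longrightarrow> smooth (\<lambda>t. f t * g t)"
  and smooth_compose: "smooth f \<Longrightarrow> smooth g \<Longrightarrow> smooth (\<lambda>t. f (g t))"
  and smooth_inverse: "smooth f \<Longrightarrow> (\<And>t. f t \<noteq> 0) \<Longrightarrow> smooth (\<lambda>t. inverse (f t))"
  by (auto simp: smooth_def smooth_upto_const smooth_upto_id smooth_upto_add smooth_upto_mult
      smooth_upto_compose smooth_upto_inverse)

lemma smooth_minus [intro]: "smooth f \<Longrightarrow> smooth (\<lambda>t. - f t)"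
  using smooth_mult[OF smooth_const[of "-1"], of f] by simp

lemma smooth_diff [intro]: "smooth f \<Longrightarrow> smooth g \<Longrightarrow> smooth (\<lambda>t. f t - g t)"
  using smooth_add[OF _ smooth_minus, of f g] by simp

lemma smooth_power [intro]: "smooth f \<Longrightarrow> smooth (\<lambda>t. f t ^ n)"
  by (induction n) auto

lemma smooth_shift: "smooth f \<Longrightarrow> smooth (\<lambda>t. f (t - a))"
  by (rule smooth_compose) auto

lemma smooth_antiderivative:
  assumes "\<And>t. (f has_real_derivative f' t) (at t)" "smooth f'"
  shows "smooth f"
  unfolding smooth_def
proof
  fix k show "smooth_upto k f"
    using assms smooth_upto_pred[of k f] by (auto simp: smooth_def)
qed

lemma smooth_has_derivative:
  assumes "smooth f"
  shows "(f has_real_derivative deriv f t) (at t)"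
proof -
  from assms have "smooth_upto 1 f" by (simp add: smooth_def)
  then show ?thesis by (auto dest!: DERIV_imp_deriv simp del: fun_eq_iff) (metis DERIV_imp_deriv)
qed

lemma smooth_deriv [intro]:
  assumes "smooth f"
  shows "smooth (deriv f)"
  unfolding smooth_def
proof
  fix k
  from assms have "smooth_upto (Suc k) f" by (simp add: smooth_def)
  then obtain f' where f': "\<forall>t. (f has_real_derivative f' t) (at t)" "smooth_upto k f'" by auto
  then have "deriv f = f'" using DERIV_imp_deriv by blast
  with f' show "smooth_upto k (deriv f)" by simp
qed

lemma smooth_continuous_on: "smooth f \<Longrightarrow> continuous_on S f"
  unfolding smooth_def using smooth_upto.simps(1) continuous_on_subset by blast

lemma smooth_exp: "smooth exp"
proof -
  have "smooth_upto k exp" for k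
    by (induction k) (auto intro!: exI[of _ exp] continuous_intros DERIV_exp)
  then show ?thesis by (simp add: smooth_def)
qed

lemma smooth_sin: "smooth sin" and smooth_cos: "smooth cos"
proof -
  have "smooth_upto k sin \<and> smooth_upto k cos" for k
  proof (induction k)
    case 0
    then show ?case by (auto intro!: continuous_intros)
  next
    case (Suc k)
    then have "smooth_upto k (\<lambda>t. - 1 * sin t)"
      by (intro smooth_upto_mult smooth_upto_const) auto
    then have "smooth_upto (Suc k) cos"
      unfolding smooth_upto.simps by (intro exI[of _ "\<lambda>t. - 1 * sin t"]) auto
    moreover have "smooth_upto (Suc k) sin"
      unfolding smooth_upto.simps using Suc by (intro exI[of _ cos]) auto
    ultimately show ?case by blast
  qed
  then show "smooth sin" "smooth cos" by (auto simp: smooth_def)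
qed

lemmas smooth_intros = smooth_const smooth_id smooth_add smooth_mult smooth_minus smooth_diff
  smooth_power smooth_deriv smooth_exp smooth_sin smooth_cos
  smooth_compose[OF smooth_exp] smooth_compose[OF smooth_sin] smooth_compose[OF smooth_cos]

text \<open>The functions \<open>p(1/t) exp(-1/t)\<close>, extended by \<open>0\<close> to \<open>t \<le> 0\<close>, form a class that is closed
  under differentiation, because the exponential beats every polynomial at \<open>0\<close>; so all of them
  are smooth. They are the source of all smooth cutoffs below.\<close>

definition flat_poly :: "real poly \<Rightarrow> real \<Rightarrow> real" where
  "flat_poly p t = (if t \<le> 0 then 0 else poly p (1 / t) * exp (- 1 / t))"

lemma poly_times_exp_tendsto_0: "((\<lambda>x. poly p x * exp (- x)) \<longlongrightarrow> (0::real)) at_top"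
proof -
  have "((\<lambda>x. \<Sum>i\<le>degree p. coeff p i * (x ^ i / exp x)) \<longlongrightarrow> (\<Sum>i\<le>degree p. coeff p i * 0)) at_top"
    by (intro tendsto_intros tendsto_power_div_exp_0)
  then show ?thesis
    by (simp add: poly_altdef exp_minus field_simps sum_distrib_left sum_distrib_right sum_divide_distrib)
qed

lemma flat_poly_has_derivative:
  "(flat_poly p has_real_derivative flat_poly ([:0, 0, 1:] * (p - pderiv p)) t) (at t)"
proof -
  consider "t < 0" | "t > 0" | "t = 0" by linarith
  then show ?thesis
  proof cases
    case 1
    have "((\<lambda>x::real. 0) has_real_derivative 0) (at t)" by simp
    then have "(flat_poly p has_real_derivative 0) (at t)"
      by (rule has_field_derivative_transform_within_open[where S = "{..<0}"])
        (use 1 in \<open>auto simp: flat_poly_def\<close>)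
    with 1 show ?thesis by (simp add: flat_poly_def)
  next
    case 2
    have "((\<lambda>x. poly p (1 / x) * exp (- 1 / x)) has_real_derivative
        flat_poly ([:0, 0, 1:] * (p - pderiv p)) t) (at t)"
      using 2 by (auto intro!: derivative_eq_intros DERIV_chain2[OF poly_DERIV]
          simp: flat_poly_def field_simps power2_eq_square)
    then show ?thesis
      by (rule has_field_derivative_transform_within_open[where S = "{0<..}"])
        (use 2 in \<open>auto simp: flat_poly_def\<close>)
  next
    case 3
    have r: "((\<lambda>h. flat_poly p h / h) \<longlongrightarrow> 0) (at_right 0)"
    proof -
      have "((\<lambda>h. poly ([:0, 1:] * p) (inverse h) * exp (- inverse h)) \<longlongrightarrow> 0) (at_right 0)"
        by (rule filterlim_compose[OF poly_times_exp_tendsto_0 filterlim_inverse_at_top_right])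
      then show ?thesis
        by (rule Lim_transform_eventually)
          (auto simp: flat_poly_def eventually_at_filter field_simps)
    qed
    have l: "((\<lambda>h. flat_poly p h / h) \<longlongrightarrow> 0) (at_left 0)"
      by (rule Lim_transform_eventually[OF tendsto_const])
        (auto simp: flat_poly_def eventually_at_filter)
    have "((\<lambda>h. flat_poly p h / h) \<longlongrightarrow> 0) (at 0)"
      using l r by (simp add: filterlim_at_split)
    then show ?thesis
      using 3 by (simp add: DERIV_def flat_poly_def)
  qed
qed

lemma smooth_flat_poly: "smooth (flat_poly p)"
proof -
  have "smooth_upto k (flat_poly p)" for k
  proof (induction k arbitrary: p)
    case 0
    then show ?case
      by (auto intro!: continuous_at_imp_continuous_on DERIV_isCont[OF flat_poly_has_derivative])
  next
    case (Suc k)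
    then show ?case using flat_poly_has_derivative by auto
  qed
  then show ?thesis by (simp add: smooth_def)
qed

definition flat :: "real \<Rightarrow> real" where "flat = flat_poly 1"

lemma smooth_flat: "smooth flat"
  unfolding flat_def by (rule smooth_flat_poly)

lemma flat_nonpos: "t \<le> 0 \<Longrightarrow> flat t = 0" and flat_pos: "0 < t \<Longrightarrow> 0 < flat t"
  and flat_nonneg: "0 \<le> flat t" and flat_less_1: "flat t < 1"
  by (auto simp: flat_def flat_poly_def)

definition smooth_step :: "real \<Rightarrow> real" where
  "smooth_step t = flat t / (flat t + flat (1 - t))"

lemma flat_denominator_pos: "0 < flat t + flat (1 - t)"
  using flat_pos[of t] flat_pos[of "1 - t"] flat_nonneg[of t] flat_nonneg[of "1 - t"]
  by (cases "0 < t") auto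

lemma smooth_smooth_step: "smooth smooth_step"
proof -
  have "smooth (\<lambda>t. flat (1 - t))"
    by (rule smooth_compose[OF smooth_flat]) (auto intro: smooth_intros)
  then have "smooth (\<lambda>t. flat t * inverse (flat t + flat (1 - t)))"
    using flat_denominator_pos
    by (intro smooth_mult smooth_inverse smooth_add smooth_flat) (auto simp: less_imp_neq[symmetric])
  moreover have "smooth_step = (\<lambda>t. flat t * inverse (flat t + flat (1 - t)))"
    by (auto simp: smooth_step_def field_simps)
  ultimately show ?thesis by simp
qed

lemma smooth_step_0: "t \<le> 0 \<Longrightarrow> smooth_step t = 0"
  by (simp add: smooth_step_def flat_nonpos)

lemma smooth_step_1: "1 \<le> t \<Longrightarrow> smooth_step t = 1"
  using flat_pos[of t] by (simp add: smooth_step_def flat_nonpos)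

lemma smooth_step_nonneg: "0 \<le> smooth_step t" and smooth_step_le_1: "smooth_step t \<le> 1"
  using flat_denominator_pos[of t] flat_nonneg[of t] flat_nonneg[of "1 - t"]
  by (auto simp: smooth_step_def divide_le_eq)

text \<open>Outside \<open>[0, 1]\<close> the step is locally constant.\<close>

lemma deriv_smooth_step_0:
  assumes "t \<le> 0 \<or> 1 \<le> t" shows "deriv smooth_step t = 0"
proof -
  have eq: "deriv smooth_step u = 0" if "u < 0 \<or> 1 < u" for u
  proof -
    have "(smooth_step has_real_derivative 0) (at u)"
    proof (cases "u < 0")
      case True
      have "((\<lambda>x::real. 0::real) has_real_derivative 0) (at u)" by simp
      then show ?thesis
        by (rule has_field_derivative_transform_within_open[where S = "{..<0}"])
          (use True in \<open>auto simp: smooth_step_0\<close>)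
    next
      case False
      have "((\<lambda>x::real. 1::real) has_real_derivative 0) (at u)" by simp
      then show ?thesis
        by (rule has_field_derivative_transform_within_open[where S = "{1<..}"])
          (use False that in \<open>auto simp: smooth_step_1\<close>)
    qed
    then show ?thesis by (rule DERIV_imp_deriv)
  qed
  have cont: "continuous_on UNIV (deriv smooth_step)"
    by (intro smooth_continuous_on smooth_deriv smooth_smooth_step)
  have "closed {u. deriv smooth_step u = 0}"
    using closed_Collect_eq[OF cont continuous_on_const] by simp
  then have "closure ({..<0} \<union> {1<..}) \<subseteq> {u. deriv smooth_step u = 0}"
    by (intro closure_minimal) (auto simp: eq)
  then show ?thesis using assms by auto
qed

section \<open>Functions in logarithmic polar coordinates\<close>

definition pol :: "real \<Rightarrow> real \<Rightarrow> real^2" where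
  "pol s t = vector [exp s * cos t, exp s * sin t]"

lemma pol_nth [simp]: "pol s t $ 1 = exp s * cos t" "pol s t $ 2 = exp s * sin t"
  by (simp_all add: pol_def)

lemma norm_square_2: "(norm (u :: real^2))\<^sup>2 = (u $ 1)\<^sup>2 + (u $ 2)\<^sup>2"
  by (simp add: norm_vec_def L2_set_def sum_2)

lemma norm_pol [simp]: "norm (pol s t) = exp s"
proof -
  have "(norm (pol s t))\<^sup>2 = (exp s)\<^sup>2 * ((cos t)\<^sup>2 + (sin t)\<^sup>2)"
    by (simp add: norm_square_2 power_mult_distrib distrib_left del: sin_cos_squared_add2)
  then have "(norm (pol s t))\<^sup>2 = (exp s)\<^sup>2" by simp
  then show ?thesis by (simp add: power2_eq_iff_nonneg)
qed

lemma pol_nonzero [simp]: "pol s t \<noteq> 0"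
  by (metis exp_not_eq_zero norm_eq_zero norm_pol)

lemma pol_shift: "pol s (t + 2 * pi * of_int n) = pol s t"
proof -
  have "sin (t + 2 * pi * of_int n) = sin t \<and> cos (t + 2 * pi * of_int n) = cos t"
    unfolding sin_cos_eq_iff by blast
  then show ?thesis by (simp only: pol_def)
qed

lemma pol_eq_iff: "pol s t = pol s' t' \<longleftrightarrow> s = s' \<and> (\<exists>n::int. t = t' + 2 * pi * of_int n)"
proof
  assume eq: "pol s t = pol s' t'"
  then have s: "s = s'" by (metis exp_inj_iff norm_pol)
  with eq have "sin t = sin t' \<and> cos t = cos t'"
    by (auto simp: vec_eq_iff forall_2)
  then show "s = s' \<and> (\<exists>n::int. t = t' + 2 * pi * of_int n)"
    using s by (simp add: sin_cos_eq_iff)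
next
  assume "s = s' \<and> (\<exists>n::int. t = t' + 2 * pi * of_int n)"
  then show "pol s t = pol s' t'" using pol_shift by auto
qed

lemma pol_exists:
  assumes "y \<noteq> x"
  obtains t where "y = x + pol (ln (norm (y - x))) t"
proof -
  have r: "0 < norm (y - x)" using assms by simp
  have n: "(norm (y - x))\<^sup>2 = ((y - x) $ 1)\<^sup>2 + ((y - x) $ 2)\<^sup>2"
    by (rule norm_square_2)
  then have "((y - x) $ 1 / norm (y - x))\<^sup>2 + ((y - x) $ 2 / norm (y - x))\<^sup>2 = 1"
    unfolding power_divide add_divide_distrib[symmetric] n[symmetric] using r by simp
  then obtain t where t: "(y - x) $ 1 / norm (y - x) = cos t" "(y - x) $ 2 / norm (y - x) = sin t"
    by (rule sincos_total_2pi)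
  have "(y - x) $ 1 = norm (y - x) * cos t" "(y - x) $ 2 = norm (y - x) * sin t"
    unfolding t[symmetric] using r by simp_all
  then have "y - x = pol (ln (norm (y - x))) t"
    unfolding vec_eq_iff forall_2 pol_nth exp_ln[OF r] by blast
  then show ?thesis using that[of t] by (metis add.commute diff_add_cancel)
qed

lemma continuous_on_pol [continuous_intros]:
  fixes f g :: "'a :: t2_space \<Rightarrow> real"
  assumes "continuous_on S f" "continuous_on S g"
  shows "continuous_on S (\<lambda>w. pol (f w) (g w))"
proof -
  have "continuous_on S (\<lambda>w. \<chi> i :: 2. if i = 1 then exp (f w) * cos (g w) else exp (f w) * sin (g w))"
  proof (rule continuous_on_vec_lambda)
    show "continuous_on S (\<lambda>w. if i = 1 then exp (f w) * cos (g w) else exp (f w) * sin (g w))"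
      for i :: 2
      by (cases "i = 1")
        (auto intro!: continuous_on_mult continuous_on_exp continuous_on_cos continuous_on_sin assms)
  qed
  moreover have "(\<chi> i :: 2. if i = 1 then exp (f w) * cos (g w) else exp (f w) * sin (g w)) = pol (f w) (g w)" for w
    by (simp add: vec_eq_iff forall_2)
  ultimately show ?thesis by simp
qed

text \<open>Which of the possible angles is chosen is immaterial, since the angle is only passed to periodic
  functions.\<close>

definition angle :: "real^2 \<Rightarrow> real" where
  "angle u = (SOME t. u = pol (ln (norm u)) t)"

lemma pol_angle: "u \<noteq> 0 \<Longrightarrow> pol (ln (norm u)) (angle u) = u"
  unfolding angle_def using pol_exists[of u 0] by (metis (mono_tags, lifting) add_0 diff_zero someI)

definition periodic :: "(real \<Rightarrow> real) \<Rightarrow> bool" where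
  "periodic h \<longleftrightarrow> (\<forall>t. h (t + 2 * pi) = h t)"

lemma periodic_int: "periodic h \<Longrightarrow> h (t + 2 * pi * of_int n) = h t"
proof -
  assume h: "periodic h"
  have nat: "h (t + 2 * pi * real k) = h t" for t k
  proof (induction k)
    case (Suc k)
    have "h (t + 2 * pi * real (Suc k)) = h ((t + 2 * pi * real k) + 2 * pi)"
      by (simp add: algebra_simps)
    then show ?case using h Suc by (simp add: periodic_def)
  qed simp
  show ?thesis
  proof (cases n)
    case (nonneg k)
    then show ?thesis using nat by simp
  next
    case (neg k)
    have "t + 2 * pi * of_int n + 2 * pi * real (Suc k) = t"
      by (simp add: neg algebra_simps)
    then show ?thesis using nat[of "t + 2 * pi * of_int n" "Suc k"] by metis
  qed
qed

text \<open>The value at the center is \<open>0\<close>: only factors \<open>A\<close> that vanish near \<open>-\<infinity>\<close> will be used.\<close>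

definition polar :: "real^2 \<Rightarrow> (real \<Rightarrow> real) \<Rightarrow> (real \<Rightarrow> real) \<Rightarrow> real^2 \<Rightarrow> real" where
  "polar x A h y = (if y = x then 0 else A (ln (norm (y - x))) * h (angle (y - x)))"

lemma polar_pol [simp]:
  assumes "periodic h"
  shows "polar x A h (x + pol s t) = A s * h t"
proof -
  have "pol s t = pol s (angle (pol s t))"
    using pol_angle[of "pol s t"] by simp
  then obtain n :: int where "t = angle (pol s t) + 2 * pi * of_int n"
    by (auto simp: pol_eq_iff)
  then have "h t = h (angle (pol s t))" using periodic_int[OF assms] by metis
  then show ?thesis by (simp add: polar_def)
qed

text \<open>Near a point with angle \<open>\<tau>\<close> the angle is \<open>\<tau>\<close> plus an arc tangent, up to a multiple
  of \<open>2\<pi>\<close> that periodic functions do not see.\<close>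

lemma polar_local:
  fixes y x :: "real^2"
  defines "u \<equiv> y - x"
  assumes "periodic h" and pos: "0 < u $ 1 * cos \<tau> + u $ 2 * sin \<tau>"
  shows "polar x A h y = A (ln (norm (y - x))) *
    h (\<tau> + arctan ((u $ 2 * cos \<tau> - u $ 1 * sin \<tau>) / (u $ 1 * cos \<tau> + u $ 2 * sin \<tau>)))"
proof -
  have "y \<noteq> x" using pos by (auto simp: u_def)
  then obtain t where t: "y = x + pol (ln (norm (y - x))) t" using pol_exists by blast
  have r: "0 < norm u" using \<open>y \<noteq> x\<close> by (simp add: u_def)
  have u: "u = pol (ln (norm u)) t" using t by (simp add: u_def algebra_simps)
  have u1: "u $ 1 = norm u * cos t" and u2: "u $ 2 = norm u * sin t"
    using r pol_nth[of "ln (norm u)" t] u by (metis exp_ln)+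
  have c: "u $ 1 * cos \<tau> + u $ 2 * sin \<tau> = norm u * cos (t - \<tau>)"
    and s: "u $ 2 * cos \<tau> - u $ 1 * sin \<tau> = norm u * sin (t - \<tau>)"
    unfolding u1 u2 by (simp_all add: cos_diff sin_diff algebra_simps)
  have cpos: "0 < cos (t - \<tau>)" using pos r unfolding c by (simp add: zero_less_mult_iff)
  define a where "a = arctan ((u $ 2 * cos \<tau> - u $ 1 * sin \<tau>) / (u $ 1 * cos \<tau> + u $ 2 * sin \<tau>))"
  have a: "a = arctan (tan (t - \<tau>))" using r by (simp add: a_def c s tan_def)
  have "cos a = cos (t - \<tau>) \<and> sin a = sin (t - \<tau>)"
  proof -
    have sq: "sqrt (1 + (tan (t - \<tau>))\<^sup>2) = 1 / cos (t - \<tau>)"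
    proof (rule real_sqrt_unique)
      have "(cos (t - \<tau>))\<^sup>2 * (1 + (tan (t - \<tau>))\<^sup>2) = 1"
        using cpos by (simp add: tan_def field_simps power2_eq_square[symmetric] flip: sin_squared_eq)
      then show "(1 / cos (t - \<tau>))\<^sup>2 = 1 + (tan (t - \<tau>))\<^sup>2"
        using cpos by (simp add: field_simps)
    qed (use cpos in simp)
    show ?thesis using cpos by (simp add: a cos_arctan sin_arctan sq) (simp add: tan_def)
  qed
  then obtain n :: int where "a = (t - \<tau>) + 2 * pi * of_int n"
    using sin_cos_eq_iff[of a "t - \<tau>"] by auto
  then have "\<tau> + a = t + 2 * pi * of_int n" by simp
  then have "h (\<tau> + a) = h t" using periodic_int[OF assms(2)] by simp
  then show ?thesis
    using t polar_pol[OF assms(2), of x A "ln (norm (y - x))" t] by (simp flip: a_def u_def)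
qed

text \<open>At a given point the formula of \<open>polar_local\<close>, taken with the angle of that very point as \<open>\<tau>\<close>, is
  differentiated by the chain rule; there the arc tangent is \<open>0\<close> with derivative \<open>1\<close>.\<close>

lemma polar_has_derivative:
  assumes h: "periodic h" "\<And>t. (h has_real_derivative h' t) (at t)"
    and A: "(A has_real_derivative A' s) (at s)"
  shows "(polar x A h has_derivative
     (\<lambda>v. exp (- s) * ((A' s * h t) * (v $ 1 * cos t + v $ 2 * sin t) +
                       (A s * h' t) * (v $ 2 * cos t - v $ 1 * sin t)))) (at (x + pol s t))"
    (is "(_ has_derivative ?D) (at ?y)")
proof -
  define c where "c y = (y - x) $ 1 * cos t + (y - x) $ 2 * sin t" for y :: "real^2"
  define d where "d y = (y - x) $ 2 * cos t - (y - x) $ 1 * sin t" for y :: "real^2"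
  define q where "q y = ((y - x) $ 1)\<^sup>2 + ((y - x) $ 2)\<^sup>2" for y :: "real^2"
  have cy: "c ?y = exp s" and dy: "d ?y = 0" and qy: "q ?y = (exp s)\<^sup>2"
  proof -
    have "c ?y = exp s * ((cos t)\<^sup>2 + (sin t)\<^sup>2)" "q ?y = (exp s)\<^sup>2 * ((cos t)\<^sup>2 + (sin t)\<^sup>2)"
      by (simp_all add: c_def q_def distrib_left power_mult_distrib power2_eq_square[of "cos t"]
          power2_eq_square[of "sin t"] del: sin_cos_squared_add3)
    then show "c ?y = exp s" "q ?y = (exp s)\<^sup>2" by simp_all
    show "d ?y = 0" by (simp add: d_def)
  qed
  have lnq: "ln (norm (y - x)) = ln (q y) / 2" if "0 < c y" for y
  proof -
    have "norm (y - x) = sqrt (q y)"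
      by (simp add: q_def norm_vec_def L2_set_def sum_2)
    moreover have "0 < q y"
      using that by (auto simp: q_def c_def sum_power2_gt_zero_iff)
    ultimately show ?thesis by (simp add: ln_sqrt)
  qed
  have D1: "(c has_derivative (\<lambda>v. v $ 1 * cos t + v $ 2 * sin t)) (at ?y)"
    and D2: "(d has_derivative (\<lambda>v. v $ 2 * cos t - v $ 1 * sin t)) (at ?y)"
    unfolding c_def d_def
    by (auto intro!: derivative_eq_intros bounded_linear_imp_has_derivative bounded_linear_vec_nth)
  have D3: "(q has_derivative (\<lambda>v. 2 * exp s * (v $ 1 * cos t + v $ 2 * sin t))) (at ?y)"
    unfolding q_def
    by (auto intro!: derivative_eq_intros bounded_linear_imp_has_derivative bounded_linear_vec_nth
        simp: algebra_simps)
  have E1: "((\<lambda>y. ln (q y) / 2) has_derivative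
      (\<lambda>v. exp (- s) * (v $ 1 * cos t + v $ 2 * sin t))) (at ?y)"
    using D3 by (auto intro!: derivative_eq_intros simp: qy field_simps exp_minus power2_eq_square)
  have E2: "((\<lambda>y. t + arctan (d y / c y)) has_derivative
      (\<lambda>v. exp (- s) * (v $ 2 * cos t - v $ 1 * sin t))) (at ?y)"
    using D1 D2 by (auto intro!: derivative_eq_intros simp: cy dy field_simps exp_minus power2_eq_square)
  have F1: "((\<lambda>y. A (ln (q y) / 2)) has_derivative
      (\<lambda>v. (exp (- s) * (v $ 1 * cos t + v $ 2 * sin t)) * A' s)) (at ?y)"
    using has_derivative_compose[OF E1, of A "\<lambda>v. v * A' s"] A
    by (simp add: qy ln_realpow has_field_derivative_def mult_commute_abs[of "A' s"])
  have F2: "((\<lambda>y. h (t + arctan (d y / c y))) has_derivative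
      (\<lambda>v. (exp (- s) * (v $ 2 * cos t - v $ 1 * sin t)) * h' t)) (at ?y)"
    using has_derivative_compose[OF E2, of h "\<lambda>v. v * h' t"] h(2)[of t]
    by (simp add: dy has_field_derivative_def mult_commute_abs[of "h' t"])
  have F: "((\<lambda>y. A (ln (q y) / 2) * h (t + arctan (d y / c y))) has_derivative ?D) (at ?y)"
    using has_derivative_mult[OF F1 F2]
    by (simp add: qy dy ln_realpow algebra_simps)
  have "open {y. 0 < c y}"
    unfolding c_def by (intro open_Collect_less continuous_intros)
  moreover have "?y \<in> {y. 0 < c y}" using cy by simp
  moreover have "A (ln (q y) / 2) * h (t + arctan (d y / c y)) = polar x A h y"
    if "y \<in> {y. 0 < c y}" for y
    using polar_local[OF h(1), of y x t A] lnq[of y] that unfolding c_def d_def by simp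
  ultimately show ?thesis
    using has_derivative_transform_within_open[OF F] by blast
qed

section \<open>Test functions and test fields in logarithmic polar coordinates\<close>

lemma C_k_SucI:
  assumes "\<And>y. (\<phi> has_derivative D y) (at y)" "\<And>i. (\<lambda>y. D y (axis i 1)) \<in> C_k k"
  shows "\<phi> \<in> C_k (Suc k)"
proof -
  have "frechet_derivative \<phi> (at y) = D y" for y
    using frechet_derivative_at[OF assms(1)] by simp
  then show ?thesis
    using assms by (auto simp: differentiable_on_def differentiable_def intro: has_derivative_at_withinI)
qed

lemma C_k_add: "f \<in> C_k k \<Longrightarrow> g \<in> C_k k \<Longrightarrow> (\<lambda>y. f y + g y) \<in> C_k k"
proof (induction k arbitrary: f g)
  case 0
  then show ?case by (auto intro: continuous_intros)
next
  case (Suc k)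
  have f: "(f has_derivative frechet_derivative f (at y)) (at y)"
    and g: "(g has_derivative frechet_derivative g (at y)) (at y)" for y
    using Suc.prems by (auto simp: differentiable_on_def frechet_derivative_works)
  show ?case
  proof (rule C_k_SucI)
    show "((\<lambda>y. f y + g y) has_derivative
        (\<lambda>v. frechet_derivative f (at y) v + frechet_derivative g (at y) v)) (at y)" for y
      by (intro has_derivative_add f g)
    show "(\<lambda>y. frechet_derivative f (at y) (axis i 1) + frechet_derivative g (at y) (axis i 1))
        \<in> C_k k" for i
      using Suc by auto
  qed
qed

lemma test_functionsI:
  assumes "\<And>k. \<phi> \<in> C_k k" "compact K" "K \<subseteq> U" "\<And>y. y \<notin> K \<Longrightarrow> \<phi> y = 0"
  shows "\<phi> \<in> test_functions U"
proof -
  have "closure {y. \<phi> y \<noteq> 0} \<subseteq> K"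
    using assms by (intro closure_minimal) (auto simp: compact_imp_closed)
  then show ?thesis
    using assms compact_Int_closed[OF assms(2), of "closure {y. \<phi> y \<noteq> 0}"]
    by (auto simp: test_functions_def Int_absorb1)
qed

lemma periodic_deriv:
  assumes "periodic h" "smooth h"
  shows "periodic (deriv h)"
  unfolding periodic_def
proof
  fix t
  have "((\<lambda>t. h (t + 2 * pi)) has_real_derivative deriv h (t + 2 * pi)) (at t)"
    by (rule DERIV_shift[THEN iffD1, OF smooth_has_derivative[OF assms(2)]])
  moreover have "(\<lambda>t. h (t + 2 * pi)) = h" using assms(1) by (auto simp: periodic_def)
  ultimately show "deriv h (t + 2 * pi) = deriv h t"
    using DERIV_imp_deriv by metis
qed

lemma periodic_intros:
  "periodic (\<lambda>t. c)" "periodic sin" "periodic cos"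
  "periodic g \<Longrightarrow> periodic h \<Longrightarrow> periodic (\<lambda>t. g t * h t)"
  "periodic g \<Longrightarrow> periodic h \<Longrightarrow> periodic (\<lambda>t. g t - h t)"
  by (auto simp: periodic_def)

lemma periodic_compose_cos: "periodic (\<lambda>t. g (cos (t - a)))"
proof -
  have "cos (t + 2 * pi - a) = cos (t - a)" for t
    using cos_periodic[of "t - a"] by (simp add: algebra_simps)
  then show ?thesis by (simp add: periodic_def)
qed

lemma polar_near_center:
  assumes "\<And>s. s \<le> s0 \<Longrightarrow> A s = 0" "norm (y - x) \<le> exp s0"
  shows "polar x A h y = 0"
proof (cases "y = x")
  case False
  then have "ln (norm (y - x)) \<le> s0"
    using assms(2) by (simp add: ln_le_cancel_iff[symmetric] del: ln_le_cancel_iff)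
  then show ?thesis using assms(1) by (simp add: polar_def)
qed (simp add: polar_def)

text \<open>The two partial derivatives of \<open>polar x A h\<close>, written as combinations of functions of the same
  kind, so that they can be differentiated again.\<close>

definition polar_dx :: "real^2 \<Rightarrow> (real \<Rightarrow> real) \<Rightarrow> (real \<Rightarrow> real) \<Rightarrow> real^2 \<Rightarrow> real" where
  "polar_dx x A h y = polar x (\<lambda>s. exp (- s) * deriv A s) (\<lambda>t. cos t * h t) y +
     polar x (\<lambda>s. - (exp (- s) * A s)) (\<lambda>t. sin t * deriv h t) y"

definition polar_dy :: "real^2 \<Rightarrow> (real \<Rightarrow> real) \<Rightarrow> (real \<Rightarrow> real) \<Rightarrow> real^2 \<Rightarrow> real" where
  "polar_dy x A h y = polar x (\<lambda>s. exp (- s) * deriv A s) (\<lambda>t. sin t * h t) y +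
     polar x (\<lambda>s. exp (- s) * A s) (\<lambda>t. cos t * deriv h t) y"

locale polar_pair =
  fixes A h :: "real \<Rightarrow> real" and s0 :: real
  assumes smooth_A: "smooth A" and smooth_h: "smooth h" and periodic_h: "periodic h"
    and vanish: "s \<le> s0 \<Longrightarrow> A s = 0"
begin

lemma vanish_deriv: "s \<le> s0 - 1 \<Longrightarrow> deriv A s = 0"
proof -
  assume "s \<le> s0 - 1"
  have "((\<lambda>x::real. 0::real) has_real_derivative 0) (at s)" by simp
  then have "(A has_real_derivative 0) (at s)"
    by (rule has_field_derivative_transform_within_open[where S = "{..<s0}"])
      (use \<open>s \<le> s0 - 1\<close> vanish in auto)
  then show "deriv A s = 0" by (rule DERIV_imp_deriv)
qed

lemmas per = periodic_intros periodic_h periodic_deriv[OF periodic_h smooth_h]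

lemma polar_dx_pol: "polar_dx x A h (x + pol s t) =
    exp (- s) * (deriv A s * h t * cos t - A s * deriv h t * sin t)"
  and polar_dy_pol: "polar_dy x A h (x + pol s t) =
    exp (- s) * (deriv A s * h t * sin t + A s * deriv h t * cos t)"
  by (simp_all add: polar_dx_def polar_dy_def per algebra_simps)

lemma has_derivative:
  "(polar x A h has_derivative (\<lambda>v. v $ 1 * polar_dx x A h y + v $ 2 * polar_dy x A h y)) (at y)"
proof (cases "y = x")
  case True
  have "((\<lambda>y. 0) has_derivative (\<lambda>v::real^2. 0::real)) (at x)" by simp
  then have "(polar x A h has_derivative (\<lambda>v. 0)) (at x)"
    by (rule has_derivative_transform_within_open[OF _ open_ball[of x "exp s0"]])
      (auto simp: polar_near_center[where ?s0.0 = s0] vanish dist_norm norm_minus_commute)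
  then show ?thesis by (simp add: True polar_dx_def polar_dy_def polar_def)
next
  case False
  then obtain s t where y: "y = x + pol s t" using pol_exists by blast
  show ?thesis
    using polar_has_derivative[OF periodic_h smooth_has_derivative[OF smooth_h]
        smooth_has_derivative[OF smooth_A], where x = x and s = s and t = t]
    by (simp add: y polar_dx_pol polar_dy_pol algebra_simps)
qed

lemma continuous: "continuous_on S (polar x A h)"
  by (intro continuous_at_imp_continuous_on ballI has_derivative_continuous[OF has_derivative])

lemma frechet_derivative_1: "frechet_derivative (polar x A h) (at y) (axis 1 1) = polar_dx x A h y"
  and frechet_derivative_2: "frechet_derivative (polar x A h) (at y) (axis 2 1) = polar_dy x A h y"
  using frechet_derivative_at[OF has_derivative, symmetric, of x y] by (simp_all add: axis_def)

end

text \<open>By induction on \<open>k\<close> for all pairs of factors at once: the partial derivatives are again sums of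
  functions of this form. Differentiation costs one unit of the interval on which the first factor
  vanishes.\<close>

lemma polar_in_C_k:
  assumes "polar_pair A h s0"
  shows "polar x A h \<in> C_k k"
  using assms
proof (induction k arbitrary: A h s0)
  case 0
  then show ?case using polar_pair.continuous by auto
next
  case (Suc k)
  then interpret polar_pair A h s0 by simp
  note sm = smooth_intros smooth_A smooth_h
  have "polar_pair (\<lambda>s. exp (- s) * deriv A s) (\<lambda>t. cos t * h t) (s0 - 1)"
    "polar_pair (\<lambda>s. - (exp (- s) * A s)) (\<lambda>t. sin t * deriv h t) (s0 - 1)"
    "polar_pair (\<lambda>s. exp (- s) * deriv A s) (\<lambda>t. sin t * h t) (s0 - 1)"
    "polar_pair (\<lambda>s. exp (- s) * A s) (\<lambda>t. cos t * deriv h t) (s0 - 1)"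
    by (unfold_locales; auto intro!: per sm vanish vanish_deriv)+
  then have "polar_dx x A h \<in> C_k k" "polar_dy x A h \<in> C_k k"
    by (simp_all add: polar_dx_def[abs_def] polar_dy_def[abs_def] C_k_add Suc.IH)
  then have "(\<lambda>y. axis i 1 $ 1 * polar_dx x A h y + axis i 1 $ 2 * polar_dy x A h y) \<in> C_k k"
    for i :: 2
    using exhaust_2[of i] by (auto simp: axis_def)
  then show ?case by (intro C_k_SucI[OF has_derivative])
qed

text \<open>Fields with radial, respectively angular, component \<open>A(s) h(t) / r\<close> where \<open>s = ln r\<close>.\<close>

definition radial_field :: "real^2 \<Rightarrow> (real \<Rightarrow> real) \<Rightarrow> (real \<Rightarrow> real) \<Rightarrow> real^2 \<Rightarrow> real^2" where
  "radial_field x A h y = vector [polar x (\<lambda>s. exp (- s) * A s) (\<lambda>t. cos t * h t) y,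
     polar x (\<lambda>s. exp (- s) * A s) (\<lambda>t. sin t * h t) y]"

definition angular_field :: "real^2 \<Rightarrow> (real \<Rightarrow> real) \<Rightarrow> (real \<Rightarrow> real) \<Rightarrow> real^2 \<Rightarrow> real^2" where
  "angular_field x A h y = vector [polar x (\<lambda>s. - (exp (- s) * A s)) (\<lambda>t. sin t * h t) y,
     polar x (\<lambda>s. exp (- s) * A s) (\<lambda>t. cos t * h t) y]"

definition divergence :: "(real^2 \<Rightarrow> real^2) \<Rightarrow> real^2 \<Rightarrow> real" where
  "divergence V y = (\<Sum>i\<in>UNIV. frechet_derivative (\<lambda>y. V y $ i) (at y) (axis i 1))"

context polar_pair
begin

lemma field_pairs:
  "polar_pair (\<lambda>s. exp (- s) * A s) (\<lambda>t. cos t * h t) s0"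
  "polar_pair (\<lambda>s. exp (- s) * A s) (\<lambda>t. sin t * h t) s0"
  "polar_pair (\<lambda>s. - (exp (- s) * A s)) (\<lambda>t. sin t * h t) s0"
  by (unfold_locales; auto intro!: per smooth_intros smooth_A smooth_h vanish)+

lemma deriv_exp_A: "deriv (\<lambda>s. exp (- s) * A s) s = exp (- s) * (deriv A s - A s)"
  and deriv_minus_exp_A: "deriv (\<lambda>s. - (exp (- s) * A s)) s = - (exp (- s) * (deriv A s - A s))"
  and deriv_cos_h: "deriv (\<lambda>t. cos t * h t) t = cos t * deriv h t - sin t * h t"
  and deriv_sin_h: "deriv (\<lambda>t. sin t * h t) t = sin t * deriv h t + cos t * h t"
  by (rule DERIV_imp_deriv; auto intro!: derivative_eq_intros
      smooth_has_derivative[OF smooth_A] smooth_has_derivative[OF smooth_h] simp: algebra_simps)+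

text \<open>In the orthonormal polar frame the field has the components \<open>A(s) h(t) / r\<close> and \<open>0\<close>; the factor
  \<open>1/r\<close> is exactly what makes the divergence \<open>1/r\<^sup>2\<close> times the derivative with respect to \<open>s\<close>, without
  a term of order zero. For angular fields it is the derivative with respect to the angle.\<close>

lemma divergence_radial_field:
  "divergence (radial_field x A h) y = polar x (\<lambda>s. exp (- 2 * s) * deriv A s) h y"
proof -
  have "divergence (radial_field x A h) y =
      polar_dx x (\<lambda>s. exp (- s) * A s) (\<lambda>t. cos t * h t) y +
      polar_dy x (\<lambda>s. exp (- s) * A s) (\<lambda>t. sin t * h t) y"
    using polar_pair.frechet_derivative_1[OF field_pairs(1)]
      polar_pair.frechet_derivative_2[OF field_pairs(2)]
    by (simp add: divergence_def sum_2 radial_field_def)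
  also have "\<dots> = polar x (\<lambda>s. exp (- 2 * s) * deriv A s) h y"
  proof (cases "y = x")
    case True
    then show ?thesis by (simp add: polar_dx_def polar_dy_def polar_def)
  next
    case False
    then obtain s t where y: "y = x + pol s t" using pol_exists by blast
    have e: "exp (- s) * exp (- s) = exp (- (2 * s))" by (simp add: exp_add[symmetric])
    have "polar_dx x (\<lambda>s. exp (- s) * A s) (\<lambda>t. cos t * h t) y +
      polar_dy x (\<lambda>s. exp (- s) * A s) (\<lambda>t. sin t * h t) y =
      exp (- s) * exp (- s) * deriv A s * h t * ((cos t)\<^sup>2 + (sin t)\<^sup>2)"
      unfolding y field_pairs(1,2,3)[THEN polar_pair.polar_dx_pol] field_pairs(1,2,3)[THEN polar_pair.polar_dy_pol]
        deriv_exp_A deriv_minus_exp_A deriv_cos_h deriv_sin_h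
      by algebra
    then show ?thesis by (simp add: y periodic_h e)
  qed
  finally show ?thesis .
qed

lemma divergence_angular_field:
  "divergence (angular_field x A h) y = polar x (\<lambda>s. exp (- 2 * s) * A s) (deriv h) y"
proof -
  have "divergence (angular_field x A h) y =
      polar_dx x (\<lambda>s. - (exp (- s) * A s)) (\<lambda>t. sin t * h t) y +
      polar_dy x (\<lambda>s. exp (- s) * A s) (\<lambda>t. cos t * h t) y"
    using polar_pair.frechet_derivative_1[OF field_pairs(3)]
      polar_pair.frechet_derivative_2[OF field_pairs(1)]
    by (simp add: divergence_def sum_2 angular_field_def)
  also have "\<dots> = polar x (\<lambda>s. exp (- 2 * s) * A s) (deriv h) y"
  proof (cases "y = x")
    case True
    then show ?thesis by (simp add: polar_dx_def polar_dy_def polar_def)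
  next
    case False
    then obtain s t where y: "y = x + pol s t" using pol_exists by blast
    have e: "exp (- s) * exp (- s) = exp (- (2 * s))" by (simp add: exp_add[symmetric])
    have "polar_dx x (\<lambda>s. - (exp (- s) * A s)) (\<lambda>t. sin t * h t) y +
      polar_dy x (\<lambda>s. exp (- s) * A s) (\<lambda>t. cos t * h t) y =
      exp (- s) * exp (- s) * A s * deriv h t * ((cos t)\<^sup>2 + (sin t)\<^sup>2)"
      unfolding y field_pairs(1,2,3)[THEN polar_pair.polar_dx_pol] field_pairs(1,2,3)[THEN polar_pair.polar_dy_pol]
        deriv_exp_A deriv_minus_exp_A deriv_cos_h deriv_sin_h
      by algebra
    then show ?thesis by (simp add: y per e)
  qed
  finally show ?thesis .
qed

lemma polar_outside:
  assumes K: "\<And>s t. A s * h t \<noteq> 0 \<Longrightarrow> x + pol s t \<in> K" and "y \<notin> K" "y \<noteq> x"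
  shows "\<exists>s t. y = x + pol s t \<and> A s * h t = 0"
proof -
  obtain s t where "y = x + pol s t" using pol_exists \<open>y \<noteq> x\<close> by blast
  then show ?thesis using assms by blast
qed

lemma test_radial_field:
  assumes K: "\<And>s t. A s * h t \<noteq> 0 \<Longrightarrow> x + pol s t \<in> K" and "compact K" "K \<subseteq> U"
  shows "(\<lambda>y. radial_field x A h y $ i) \<in> test_functions U"
    and "(\<lambda>y. angular_field x A h y $ i) \<in> test_functions U"
proof -
  have 0: "polar x (\<lambda>s. exp (- s) * A s) (\<lambda>t. cos t * h t) y = 0 \<and>
      polar x (\<lambda>s. exp (- s) * A s) (\<lambda>t. sin t * h t) y = 0 \<and>
      polar x (\<lambda>s. - (exp (- s) * A s)) (\<lambda>t. sin t * h t) y = 0" if yK: "y \<notin> K" for y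
  proof (cases "y = x")
    case False
    then obtain s t where "y = x + pol s t" "A s * h t = 0"
      using polar_outside[of x K y, OF K yK] by blast
    then show ?thesis by (auto simp: per)
  qed (simp add: polar_def)
  note T = test_functionsI[OF polar_in_C_k assms(2,3)]
  show "(\<lambda>y. radial_field x A h y $ i) \<in> test_functions U"
    using exhaust_2[of i] 0 T[OF field_pairs(1)] T[OF field_pairs(2)]
    by (auto simp: radial_field_def)
  show "(\<lambda>y. angular_field x A h y $ i) \<in> test_functions U"
    using exhaust_2[of i] 0 T[OF field_pairs(1)] T[OF field_pairs(3)]
    by (auto simp: angular_field_def)
qed

end

section \<open>Integration in logarithmic polar coordinates\<close>

lemma measurable_vector_2: "(\<lambda>(s, t). vector [s, t] :: real^2) \<in> borel_measurable (lborel \<Otimes>\<^sub>M lborel)"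
proof -
  have c: "continuous_on UNIV (\<lambda>w::real\<times>real. \<chi> i :: 2. if i = 1 then fst w else snd w)"
  proof (rule continuous_on_vec_lambda)
    show "continuous_on UNIV (\<lambda>w::real\<times>real. if i = 1 then fst w else snd w)" for i :: 2
      by (cases "i = 1") (auto intro: continuous_intros)
  qed
  have e: "(\<lambda>w::real\<times>real. \<chi> i :: 2. if i = 1 then fst w else snd w) = (\<lambda>(s, t). vector [s, t])"
    by (auto simp: fun_eq_iff vec_eq_iff forall_2)
  show ?thesis
    using borel_measurable_continuous_onI[OF c] unfolding e by (simp add: lborel_prod)
qed

lemma lborel_plane:
  "(lborel :: (real^2) measure) = distr (lborel \<Otimes>\<^sub>M lborel) borel (\<lambda>(s, t). vector [s, t])"
proof (rule lborel_eqI)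
  fix l u :: "real^2" assume lu: "\<And>b. b \<in> Basis \<Longrightarrow> l \<bullet> b \<le> u \<bullet> b"
  then have lu': "l $ i \<le> u $ i" for i
    by (metis axis_in_Basis_iff inner_axis mult.right_neutral inner_real_def singletonI Basis_real_def)
  have "emeasure (distr (lborel \<Otimes>\<^sub>M lborel) borel (\<lambda>(s, t). vector [s, t])) (box l u) =
      emeasure (lborel \<Otimes>\<^sub>M lborel) ({l $ 1 <..< u $ 1} \<times> {l $ 2 <..< u $ 2})"
    by (subst emeasure_distr[OF measurable_vector_2]) (auto intro!: arg_cong2[where f = emeasure]
        simp: space_pair_measure mem_box_cart forall_2)
  also have "\<dots> = ennreal ((u $ 1 - l $ 1) * (u $ 2 - l $ 2))"
    using lu' by (simp add: lborel.emeasure_pair_measure_Times ennreal_mult)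
  also have "(u $ 1 - l $ 1) * (u $ 2 - l $ 2) = (\<Prod>b\<in>Basis. (u - l) \<bullet> b)"
  proof -
    have "(\<Prod>b\<in>Basis. (u - l) \<bullet> b) = measure lborel (cbox l u)"
      using lu by (simp add: measure_lborel_cbox_eq)
    also have "\<dots> = (u $ 1 - l $ 1) * (u $ 2 - l $ 2)"
      using content_cbox_cart[of l u] lu' by (simp add: UNIV_2 interval_ne_empty_cart)
    finally show ?thesis by simp
  qed
  finally show "emeasure (distr (lborel \<Otimes>\<^sub>M lborel) borel (\<lambda>(s, t). vector [s, t])) (box l u) =
      ennreal (\<Prod>b\<in>Basis. (u - l) \<bullet> b)" .
qed simp

lemma pol_axis: "pol s t = (exp s * cos t) *\<^sub>R axis 1 1 + (exp s * sin t) *\<^sub>R axis 2 1"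
  by (simp add: vec_eq_iff forall_2 axis_def)

lemma negligible_line: "negligible {y :: real^2. (y - x) \<bullet> v = 0}" if "v \<noteq> 0"
proof -
  have "{y. (y - x) \<bullet> v = 0} = {y. v \<bullet> y = v \<bullet> x}"
    unfolding inner_diff_left inner_commute[of v] by auto
  then show ?thesis using negligible_hyperplane[of v "v \<bullet> x"] that by simp
qed

text \<open>The density \<open>exp (2 s)\<close> is the Jacobian determinant. Both measures are compared on boxes,
  where the change of variables formula applies to the part of the strip that is mapped into the
  box. The image of the strip misses only points of one line, the one in the direction \<open>\<tau>\<close>.\<close>

lemma lborel_log_polar:
  "lborel = distr (density lborel (\<lambda>w::real^2. ennreal (exp (2 * w $ 1)) *
      indicator {\<tau> - pi<..<\<tau> + pi} (w $ 2))) borel (\<lambda>w. x + pol (w $ 1) (w $ 2))"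
    (is "_ = distr ?N borel ?g")
proof (rule lborel_eqI)
  define I where "I = {\<tau> - pi<..<\<tau> + pi}"
  have g_meas: "?g \<in> borel_measurable borel"
    by (intro borel_measurable_continuous_onI continuous_intros)
  have nth_meas [measurable]: "(\<lambda>w::real^2. w $ i) \<in> borel_measurable borel" for i
    by (intro borel_measurable_continuous_onI continuous_intros)
  fix l u :: "real^2" assume lu: "\<And>b. b \<in> Basis \<Longrightarrow> l \<bullet> b \<le> u \<bullet> b"
  define S where "S = {w. w $ 2 \<in> I \<and> ?g w \<in> box l u}"
  have S_meas: "S \<in> sets borel"
    unfolding S_def I_def using g_meas by measurable
  define g' where "g' w v = (exp (w $ 1) * (v $ 1 * cos (w $ 2) - v $ 2 * sin (w $ 2))) *\<^sub>R axis 1 1 +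
      (exp (w $ 1) * (v $ 1 * sin (w $ 2) + v $ 2 * cos (w $ 2))) *\<^sub>R (axis 2 1 :: real^2)" for w v :: "real^2"
  have der: "(?g has_derivative g' w) (at w within S)" for w
    unfolding pol_axis g'_def
    by (auto intro!: derivative_eq_intros bounded_linear_imp_has_derivative bounded_linear_vec_nth
        simp: algebra_simps)
  have inj: "inj_on ?g S"
  proof (rule inj_onI)
    fix w w' assume w: "w \<in> S" "w' \<in> S" and "?g w = ?g w'"
    then have "pol (w $ 1) (w $ 2) = pol (w' $ 1) (w' $ 2)" by simp
    then obtain n :: int where n: "w $ 1 = w' $ 1" "w $ 2 = w' $ 2 + 2 * pi * of_int n"
      by (auto simp: pol_eq_iff)
    have "\<bar>w $ 2 - w' $ 2\<bar> < 2 * pi" using w by (auto simp: S_def I_def abs_if)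
    then have "\<bar>2 * pi * of_int n\<bar> < 2 * pi * (1::real)" using n by simp
    then have "\<bar>of_int n :: real\<bar> < 1" by (simp add: abs_mult)
    then have "n = 0" by linarith
    with n show "w = w'" by (simp add: vec_eq_iff forall_2)
  qed
  have det: "det (matrix (g' w)) = exp (2 * w $ 1)" for w
  proof -
    have "det (matrix (g' w)) = exp (w $ 1) * exp (w $ 1) * ((cos (w $ 2))\<^sup>2 + (sin (w $ 2))\<^sup>2)"
      unfolding det_2 matrix_def g'_def
      by (simp add: axis_def algebra_simps power2_eq_square del: sin_cos_squared_add3)
    then show ?thesis by (simp flip: exp_add)
  qed
  have img: "?g ` S \<in> sets lebesgue" "emeasure lebesgue (?g ` S) = emeasure lborel (box l u)"
  proof -
    \<comment> \<open>A normal of the line through \<open>x\<close> that is missed.\<close>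
    define v :: "real^2" where "v = vector [- sin \<tau>, cos \<tau>]"
    have "v \<noteq> 0" by (metis (no_types) v_def norm_pol norm_zero pol_nonzero vector_2 zero_index sin_zero_abs_cos_one abs_zero neg_equal_0_iff_equal zero_neq_one)
    have "box l u - {y. (y - x) \<bullet> v = 0} \<subseteq> ?g ` S"
    proof
      fix y assume y: "y \<in> box l u - {y. (y - x) \<bullet> v = 0}"
      then have "y \<noteq> x" by auto
      then obtain s t where t: "y = x + pol s t" using pol_exists by blast
      define n where "n = \<lfloor>(\<tau> + pi - t) / (2 * pi)\<rfloor>"
      define t' where "t' = t + 2 * pi * of_int n"
      have "of_int n \<le> (\<tau> + pi - t) / (2 * pi)" "(\<tau> + pi - t) / (2 * pi) < of_int n + 1"
        unfolding n_def by linarith+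
      then have "t' \<le> \<tau> + pi" "\<tau> - pi < t'"
        by (auto simp: t'_def field_simps)
      moreover have "t' \<noteq> \<tau> + pi"
      proof
        assume "t' = \<tau> + pi"
        then have "y = x + pol s (\<tau> + pi)" using t pol_shift[of s t n] by (simp add: t'_def)
        then have "(y - x) \<bullet> v = 0"
          by (simp add: inner_vec_def sum_2 v_def)
        with y show False by simp
      qed
      moreover have "y = ?g (vector [s, t'])" using t pol_shift[of s t n] by (simp add: t'_def)
      ultimately show "y \<in> ?g ` S"
        using y by (auto simp: S_def I_def intro!: image_eqI[where x = "vector [s, t']"])
    qed
    moreover have "?g ` S \<subseteq> box l u" by (auto simp: S_def)
    ultimately have sd: "(box l u - ?g ` S) \<union> (?g ` S - box l u) \<subseteq> {y. (y - x) \<bullet> v = 0}" by blast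
    then have neg: "negligible ((box l u - ?g ` S) \<union> (?g ` S - box l u))"
      using negligible_line[OF \<open>v \<noteq> 0\<close>] negligible_subset by blast
    show i: "?g ` S \<in> sets lebesgue"
      by (rule sets_negligible_symdiff[OF _ neg]) simp
    have "emeasure lebesgue (?g ` S) = emeasure lebesgue (box l u)"
    proof (rule emeasure_eq_AE)
      have "AE y in lebesgue. y \<notin> (box l u - ?g ` S) \<union> (?g ` S - box l u)"
        using neg by (intro AE_not_in) (simp add: negligible_iff_null_sets)
      then show "AE y in lebesgue. (y \<in> ?g ` S) = (y \<in> box l u)" by eventually_elim blast
    qed (use i in auto)
    then show "emeasure lebesgue (?g ` S) = emeasure lborel (box l u)" by simp
  qed
  have fin: "?g ` S \<in> lmeasurable"
    using img by (auto simp: fmeasurable_def emeasure_lborel_box_eq)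
  have one: "(\<lambda>y. 1 :: real^1) absolutely_integrable_on ?g ` S"
    using fin by (simp add: absolutely_integrable_on_const)
  have int1: "(\<lambda>w. \<bar>det (matrix (g' w))\<bar> *\<^sub>R (1 :: real^1)) absolutely_integrable_on S"
      "integral S (\<lambda>w. \<bar>det (matrix (g' w))\<bar> *\<^sub>R (1 :: real^1)) = integral (?g ` S) (\<lambda>y. 1)"
    using has_absolute_integral_change_of_variables[OF _ der inj, of "\<lambda>y. 1 :: real^1"] S_meas one
    by auto
  have int: "(\<lambda>w. exp (2 * w $ 1)) absolutely_integrable_on S"
      "integral S (\<lambda>w. exp (2 * w $ 1)) = measure lebesgue (?g ` S)"
    using int1 lmeasure_integral[OF fin]
    by (simp_all add: absolutely_integrable_on_1_iff integral_on_1_eq det vec_eq_iff)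
  have "emeasure (distr ?N borel ?g) (box l u) = (\<integral>\<^sup>+ w. ennreal (exp (2 * w $ 1)) * indicator S w \<partial>lborel)"
  proof -
    have "?g -` box l u \<in> sets borel"
      using measurable_sets[OF g_meas, of "box l u"] by simp
    then show ?thesis
      using g_meas
      by (simp add: emeasure_distr emeasure_density)
        (auto intro!: nn_integral_cong simp: S_def I_def indicator_def)
  qed
  also have "\<dots> = ennreal (measure lebesgue (?g ` S))"
  proof -
    have "((\<lambda>w. if w \<in> S then exp (2 * w $ 1) else 0) has_integral measure lebesgue (?g ` S)) UNIV"
      using int(2) set_lebesgue_integral_eq_integral(1)[OF int(1)]
      unfolding has_integral_restrict_UNIV by (metis integrable_integral)
    then have "(\<integral>\<^sup>+ w. ennreal (if w \<in> S then exp (2 * w $ 1) else 0) \<partial>lborel) =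
        ennreal (measure lebesgue (?g ` S))"
      using S_meas by (intro nn_integral_has_integral_lborel) auto
    moreover have "(\<integral>\<^sup>+ w. ennreal (exp (2 * w $ 1)) * indicator S w \<partial>lborel) =
        (\<integral>\<^sup>+ w. ennreal (if w \<in> S then exp (2 * w $ 1) else 0) \<partial>lborel)"
      by (intro nn_integral_cong) (auto split: split_indicator)
    ultimately show ?thesis by simp
  qed
  also have "\<dots> = emeasure lborel (box l u)"
    using img(2) emeasure_eq_measure2[OF fin] by simp
  finally show "emeasure (distr ?N borel ?g) (box l u) = ennreal (\<Prod>b\<in>Basis. (u - l) \<bullet> b)"
    using lu by (simp add: emeasure_lborel_box)
qed simp

lemma nn_integral_log_polar:
  assumes F: "F \<in> borel_measurable borel"
  shows "(\<integral>\<^sup>+ y. F y \<partial>lborel) = (\<integral>\<^sup>+ s. \<integral>\<^sup>+ t. F (x + pol s t) * ennreal (exp (2 * s)) *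
    indicator {\<tau> - pi<..<\<tau> + pi} t \<partial>lborel \<partial>lborel)"
proof -
  have [measurable]: "F \<in> borel_measurable borel" by fact
  have nth_meas [measurable]: "(\<lambda>w::real^2. w $ i) \<in> borel_measurable borel" for i
    by (intro borel_measurable_continuous_onI continuous_intros)
  have g [measurable]: "(\<lambda>w::real^2. x + pol (w $ 1) (w $ 2)) \<in> borel_measurable borel"
    by (intro borel_measurable_continuous_onI continuous_intros)
  have Fg [measurable]: "(\<lambda>w::real^2. F (x + pol (w $ 1) (w $ 2))) \<in> borel_measurable borel"
    by (rule measurable_compose[OF g F])
  note v [measurable] = measurable_vector_2
  have "(\<integral>\<^sup>+ y. F y \<partial>lborel) = (\<integral>\<^sup>+ w. ennreal (exp (2 * w $ 1)) *
      indicator {\<tau> - pi<..<\<tau> + pi} (w $ 2) * F (x + pol (w $ 1) (w $ 2)) \<partial>(lborel :: (real^2) measure))"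
    by (subst lborel_log_polar[of \<tau> x]) (simp add: nn_integral_distr nn_integral_density)
  also have "\<dots> = (\<integral>\<^sup>+ (s, t). ennreal (exp (2 * s)) *
      indicator {\<tau> - pi<..<\<tau> + pi} t * F (x + pol s t) \<partial>(lborel \<Otimes>\<^sub>M lborel))"
    by (subst lborel_plane) (simp add: nn_integral_distr case_prod_unfold)
  also have "\<dots> = (\<integral>\<^sup>+ s. \<integral>\<^sup>+ t. ennreal (exp (2 * s)) *
      indicator {\<tau> - pi<..<\<tau> + pi} t * F (x + pol s t) \<partial>lborel \<partial>lborel)"
  proof -
    have "(\<lambda>w. F (x + pol (fst w) (snd w))) \<in> borel_measurable (lborel \<Otimes>\<^sub>M lborel)"
      using measurable_compose[OF v, of "\<lambda>w. F (x + pol (w $ 1) (w $ 2))" borel] Fg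
      by (simp add: split_beta)
    then have "(\<lambda>w. ennreal (exp (2 * fst w)) * indicator {\<tau> - pi<..<\<tau> + pi} (snd w) *
        F (x + pol (fst w) (snd w))) \<in> borel_measurable (lborel \<Otimes>\<^sub>M lborel)"
      by measurable
    from lborel.nn_integral_fst[OF this] show ?thesis by (simp add: case_prod_unfold)
  qed
  finally show ?thesis by (simp add: mult_ac)
qed

text \<open>The form in which energies are estimated: the factor \<open>exp (2 s)\<close> cancels the \<open>1/r\<^sup>2\<close> of a squared
  gradient, and what remains is bounded by constants on finitely many rectangles of the strip, the
  \<open>j\<close>-th with angular width \<open>2 w\<^sub>j\<close>.\<close>

lemma nn_integral_log_polar_le:
  fixes F :: "real^2 \<Rightarrow> real"
  assumes [measurable]: "F \<in> borel_measurable borel" and "finite J"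
    and c: "\<And>j. j \<in> J \<Longrightarrow> 0 \<le> c j" and w: "\<And>j. j \<in> J \<Longrightarrow> 0 \<le> w j"
    and le: "\<And>s t. \<bar>t - \<tau>\<bar> < pi \<Longrightarrow> F (x + pol s t) * exp (2 * s) \<le>
      (\<Sum>j\<in>J. c j * indicator {a j..b j} s * indicator {\<tau> - w j..\<tau> + w j} t)"
  shows "(\<integral>\<^sup>+ y. ennreal (F y) \<partial>lborel) \<le> ennreal (\<Sum>j\<in>J. c j * max 0 (b j - a j) * (2 * w j))"
proof -
  have "(\<integral>\<^sup>+ y. ennreal (F y) \<partial>lborel) \<le> (\<integral>\<^sup>+ s. \<integral>\<^sup>+ t. (\<Sum>j\<in>J. ennreal (c j) * indicator {a j..b j} s *
      indicator {\<tau> - w j..\<tau> + w j} t) \<partial>lborel \<partial>lborel)"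
  proof (subst nn_integral_log_polar[of _ x \<tau>], simp, intro nn_integral_mono)
    fix s t :: real
    show "ennreal (F (x + pol s t)) * ennreal (exp (2 * s)) * indicator {\<tau> - pi<..<\<tau> + pi} t \<le>
      (\<Sum>j\<in>J. ennreal (c j) * indicator {a j..b j} s * indicator {\<tau> - w j..\<tau> + w j} t)"
    proof (cases "t \<in> {\<tau> - pi<..<\<tau> + pi}")
      case True
      then have "ennreal (F (x + pol s t) * exp (2 * s)) \<le>
          ennreal (\<Sum>j\<in>J. c j * indicator {a j..b j} s * indicator {\<tau> - w j..\<tau> + w j} t)"
        by (intro ennreal_leI le) auto
      also have "\<dots> = (\<Sum>j\<in>J. ennreal (c j * indicator {a j..b j} s * indicator {\<tau> - w j..\<tau> + w j} t))"
        using c by (intro sum_ennreal[symmetric]) (auto simp: indicator_def)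
      also have "\<dots> = (\<Sum>j\<in>J. ennreal (c j) * indicator {a j..b j} s * indicator {\<tau> - w j..\<tau> + w j} t)"
        by (intro sum.cong) (auto simp: indicator_def)
      finally show ?thesis using True by (simp add: ennreal_mult'')
    qed simp
  qed
  also have "\<dots> = (\<Sum>j\<in>J. ennreal (c j) * ennreal (max 0 (b j - a j)) * ennreal (2 * w j))"
  proof -
    have "(\<integral>\<^sup>+ s. \<integral>\<^sup>+ t. (\<Sum>j\<in>J. ennreal (c j) * indicator {a j..b j} s *
      indicator {\<tau> - w j..\<tau> + w j} t) \<partial>lborel \<partial>lborel) =
      (\<integral>\<^sup>+ s. (\<Sum>j\<in>J. ennreal (c j) * indicator {a j..b j} s * emeasure lborel {\<tau> - w j..\<tau> + w j}) \<partial>lborel)"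
      by (simp add: nn_integral_sum nn_integral_cmult)
    also have "\<dots> = (\<Sum>j\<in>J. ennreal (c j) * emeasure lborel {a j..b j} * emeasure lborel {\<tau> - w j..\<tau> + w j})"
      by (simp add: nn_integral_sum nn_integral_multc nn_integral_cmult)
    also have "\<dots> = (\<Sum>j\<in>J. ennreal (c j) * ennreal (max 0 (b j - a j)) * ennreal (2 * w j))"
      using w by (intro sum.cong refl) (auto simp: emeasure_lborel_Icc_eq max_def)
    finally show ?thesis .
  qed
  also have "\<dots> = (\<Sum>j\<in>J. ennreal (c j * max 0 (b j - a j) * (2 * w j)))"
    using c w by (intro sum.cong refl) (simp add: ennreal_mult'')
  also have "\<dots> = ennreal (\<Sum>j\<in>J. c j * max 0 (b j - a j) * (2 * w j))"
    using c w by (intro sum_ennreal) auto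
  finally show ?thesis .
qed

lemma nn_integral_polar:
  assumes "periodic h" and [measurable]: "A \<in> borel_measurable borel" "h \<in> borel_measurable borel"
      "polar x (\<lambda>s. exp (- 2 * s) * A s) h \<in> borel_measurable borel"
    and "\<And>s. 0 \<le> A s" "\<And>t. 0 \<le> h t"
  shows "(\<integral>\<^sup>+ y. ennreal (polar x (\<lambda>s. exp (- 2 * s) * A s) h y) \<partial>lborel) =
    (\<integral>\<^sup>+ s. ennreal (A s) \<partial>lborel) * (\<integral>\<^sup>+ t. ennreal (h t) * indicator {\<tau> - pi<..<\<tau> + pi} t \<partial>lborel)"
proof -
  have e: "ennreal (exp (- 2 * s) * A s * h t) * ennreal (exp (2 * s)) = ennreal (A s) * ennreal (h t)" for s t
  proof -
    have "exp (- 2 * s) * A s * h t * exp (2 * s) = A s * h t"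
      by (simp add: exp_minus field_simps)
    then show ?thesis
      using ennreal_mult''[of "exp (2 * s)" "exp (- 2 * s) * A s * h t"]
        ennreal_mult''[OF assms(6), of "A s" t] by (simp only: exp_ge_zero)
  qed
  have m: "(\<lambda>y. ennreal (polar x (\<lambda>s. exp (- 2 * s) * A s) h y)) \<in> borel_measurable borel"
    by (rule measurable_compose[OF assms(4)]) simp
  have "(\<integral>\<^sup>+ y. ennreal (polar x (\<lambda>s. exp (- 2 * s) * A s) h y) \<partial>lborel) =
      (\<integral>\<^sup>+ s. \<integral>\<^sup>+ t. ennreal (A s) * (ennreal (h t) * indicator {\<tau> - pi<..<\<tau> + pi} t) \<partial>lborel \<partial>lborel)"
    unfolding nn_integral_log_polar[OF m, of x \<tau>] polar_pol[OF assms(1)] e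
    by (simp only: mult.assoc)
  then show ?thesis
    by (simp add: nn_integral_cmult nn_integral_multc)
qed

section \<open>Functions orthogonal to all test functions\<close>

lemma tensor_in_C_k:
  assumes "smooth g" "smooth h"
  shows "(\<lambda>y. g (y $ 1) * h (y $ 2)) \<in> C_k k"
  using assms
proof (induction k arbitrary: g h)
  case 0
  have "continuous_on UNIV (\<lambda>y::real^2. g (y $ 1))" "continuous_on UNIV (\<lambda>y::real^2. h (y $ 2))"
    by (rule continuous_on_compose2[OF smooth_continuous_on[of _ UNIV]];
        use 0 in \<open>auto intro: continuous_intros\<close>)+
  then show ?case by (auto intro: continuous_on_mult)
next
  case (Suc k)
  show ?case
  proof (rule C_k_SucI)
    fix y :: "real^2"
    have g: "((\<lambda>y. g (y $ 1)) has_derivative (\<lambda>v. v $ 1 * deriv g (y $ 1))) (at y)"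
      using has_derivative_compose[of "\<lambda>y. y $ 1" "\<lambda>v. v $ 1" y UNIV g "\<lambda>v. v * deriv g (y $ 1)"]
        smooth_has_derivative[OF Suc.prems(1), of "y $ 1"]
      by (simp add: has_field_derivative_def mult_commute_abs[of "deriv g (y $ 1)"]
          bounded_linear_imp_has_derivative bounded_linear_vec_nth)
    have h: "((\<lambda>y. h (y $ 2)) has_derivative (\<lambda>v. v $ 2 * deriv h (y $ 2))) (at y)"
      using has_derivative_compose[of "\<lambda>y. y $ 2" "\<lambda>v. v $ 2" y UNIV h "\<lambda>v. v * deriv h (y $ 2)"]
        smooth_has_derivative[OF Suc.prems(2), of "y $ 2"]
      by (simp add: has_field_derivative_def mult_commute_abs[of "deriv h (y $ 2)"]
          bounded_linear_imp_has_derivative bounded_linear_vec_nth)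
    show "((\<lambda>y. g (y $ 1) * h (y $ 2)) has_derivative (\<lambda>v. g (y $ 1) * (v $ 2 * deriv h (y $ 2)) +
        v $ 1 * deriv g (y $ 1) * h (y $ 2))) (at y)"
      by (rule has_derivative_mult[OF g h])
  next
    fix i :: 2
    show "(\<lambda>y. g (y $ 1) * (axis i 1 $ 2 * deriv h (y $ 2)) + axis i 1 $ 1 * deriv g (y $ 1) * h (y $ 2))
        \<in> C_k k"
      using exhaust_2[of i] Suc.IH[OF Suc.prems(1) smooth_deriv[OF Suc.prems(2)]]
        Suc.IH[OF smooth_deriv[OF Suc.prems(1)] Suc.prems(2)]
      by (auto simp: axis_def)
  qed
qed

text \<open>For large \<open>n\<close> these smooth functions approximate the indicator of the interval from below.\<close>

definition bump :: "real \<Rightarrow> real \<Rightarrow> nat \<Rightarrow> real \<Rightarrow> real" where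
  "bump a b n t = 1 - (1 - flat (t - a) * flat (b - t)) ^ n"

lemma smooth_bump: "smooth (bump a b n)"
proof -
  have "smooth (\<lambda>t. flat (t - a))" "smooth (\<lambda>t. flat (b - t))"
    by (rule smooth_compose[OF smooth_flat]; auto intro: smooth_intros)+
  then show ?thesis unfolding bump_def[abs_def] by (intro smooth_intros)
qed

lemma flat_product: "0 \<le> flat s * flat t" "flat s * flat t < 1"
  using flat_nonneg[of s] flat_nonneg[of t] flat_less_1[of s] flat_less_1[of t]
    mult_strict_mono'[of "flat s" 1 "flat t" 1] by auto

lemma bump_bounds: "0 \<le> bump a b n t" "bump a b n t \<le> 1"
  using flat_product[of "t - a" "b - t"] by (auto simp: bump_def power_le_one)

lemma bump_outside: "t \<notin> {a<..<b} \<Longrightarrow> bump a b n t = 0"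
  by (auto simp: bump_def flat_nonpos not_less)

lemma bump_tendsto: "(\<lambda>n. bump a b n t) \<longlonglongrightarrow> indicator {a<..<b} t"
proof (cases "t \<in> {a<..<b}")
  case True
  define p where "p = flat (t - a) * flat (b - t)"
  have "0 < p" using True unfolding p_def by (intro mult_pos_pos flat_pos) auto
  moreover have "p < 1" unfolding p_def by (rule flat_product)
  ultimately have "(\<lambda>n. (1 - p) ^ n) \<longlonglongrightarrow> 0" by (intro LIMSEQ_realpow_zero) auto
  then have "(\<lambda>n. (1 - flat (t - a) * flat (b - t)) ^ n) \<longlonglongrightarrow> 0" by (simp only: p_def)
  then have "(\<lambda>n. 1 - (1 - flat (t - a) * flat (b - t)) ^ n) \<longlonglongrightarrow> 1 - 0"
    by (rule tendsto_diff[OF tendsto_const])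
  then show ?thesis using True by (simp add: bump_def)
qed (simp add: bump_outside)

text \<open>Products of bumps in the two coordinates converge boundedly to the indicator of a box.\<close>

lemma integral_box_eq_0:
  fixes H :: "real^2 \<Rightarrow> real"
  assumes H: "set_integrable lebesgue U H" "open U"
    and zero: "\<And>\<phi>. \<phi> \<in> test_functions U \<Longrightarrow> (LINT y:U|lebesgue. H y * \<phi> y) = 0"
    and sub: "cbox a b \<subseteq> U"
  shows "(LINT y:box a b|lebesgue. H y) = 0"
proof -
  define \<phi> where "\<phi> n y = bump (a $ 1) (b $ 1) n (y $ 1) * bump (a $ 2) (b $ 2) n (y $ 2)"
    for n and y :: "real^2"
  have out: "\<phi> n y = 0" if "y \<notin> box a b" for n y
    using that bump_outside by (auto simp: \<phi>_def mem_box_cart forall_2)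
  have C: "\<phi> n \<in> C_k k" for n k
    unfolding \<phi>_def[abs_def] by (rule tensor_in_C_k[OF smooth_bump smooth_bump])
  have "\<phi> n \<in> test_functions U" for n
    by (rule test_functionsI[OF C compact_cbox[of a b] sub]) (use out box_subset_cbox in blast)
  then have 0: "(LINT y:U|lebesgue. H y * \<phi> n y) = 0" for n by (rule zero)
  have "(\<lambda>n. LINT y:U|lebesgue. H y * \<phi> n y) \<longlonglongrightarrow> (LINT y:box a b|lebesgue. H y)"
    unfolding set_lebesgue_integral_def
  proof (rule integral_dominated_convergence)
    have "continuous_on UNIV (\<phi> n)" for n using C[of n 0] by simp
    then have \<phi>: "\<phi> n \<in> borel_measurable lebesgue" for n
      by (simp add: borel_measurable_continuous_onI measurable_completion)
    show "integrable lebesgue (\<lambda>y. \<bar>indicator U y *\<^sub>R H y\<bar>)"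
      using H by (simp add: set_integrable_def)
    have HU: "(\<lambda>y. indicator U y *\<^sub>R H y) \<in> borel_measurable lebesgue"
      using H by (simp add: set_integrable_def borel_measurable_integrable)
    show "(\<lambda>y. indicator U y *\<^sub>R (H y * \<phi> n y)) \<in> borel_measurable lebesgue" for n
      using borel_measurable_times[OF HU \<phi>[of n]] by (simp add: mult.assoc)
    have "(\<lambda>y. indicator (box a b) y *\<^sub>R H y) = (\<lambda>y. indicator (box a b) y * (indicator U y *\<^sub>R H y))"
      using sub box_subset_cbox[of a b] by (auto simp: indicator_def fun_eq_iff)
    moreover have "\<dots> \<in> borel_measurable lebesgue"
      by (intro borel_measurable_times[OF borel_measurable_indicator HU]) simp
    ultimately show "(\<lambda>y. indicator (box a b) y *\<^sub>R H y) \<in> borel_measurable lebesgue"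
      by (simp only:)
    show "AE y in lebesgue. (\<lambda>n. indicator U y *\<^sub>R (H y * \<phi> n y)) \<longlonglongrightarrow> indicator (box a b) y *\<^sub>R H y"
    proof (rule AE_I2)
      fix y :: "real^2"
      have "(\<lambda>n. indicator U y * (H y * \<phi> n y)) \<longlonglongrightarrow> indicator U y * (H y *
          (indicator {a $ 1<..<b $ 1} (y $ 1) * indicator {a $ 2<..<b $ 2} (y $ 2)))"
        unfolding \<phi>_def by (intro tendsto_intros bump_tendsto)
      moreover have "indicator U y * (H y *
          (indicator {a $ 1<..<b $ 1} (y $ 1) * indicator {a $ 2<..<b $ 2} (y $ 2))) =
          indicator (box a b) y * H y"
        using sub box_subset_cbox[of a b] by (auto simp: indicator_def mem_box_cart forall_2)
      ultimately show "(\<lambda>n. indicator U y *\<^sub>R (H y * \<phi> n y)) \<longlonglongrightarrow> indicator (box a b) y *\<^sub>R H y"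
        by simp
    qed
    show "AE y in lebesgue. norm (indicator U y *\<^sub>R (H y * \<phi> n y)) \<le> \<bar>indicator U y *\<^sub>R H y\<bar>" for n
    proof (rule AE_I2)
      fix y
      have "\<bar>\<phi> n y\<bar> \<le> 1" unfolding \<phi>_def abs_mult
        using bump_bounds by (auto intro!: mult_le_one)
      then show "norm (indicator U y *\<^sub>R (H y * \<phi> n y)) \<le> \<bar>indicator U y *\<^sub>R H y\<bar>"
        by (auto simp: indicator_def abs_mult mult_left_le)
    qed
  qed
  then show ?thesis unfolding 0 by (simp add: LIMSEQ_const_iff)
qed

text \<open>Boxes generate the Borel sets and are stable under intersection, so the integral over every
  Borel set vanishes; applied to the sets where \<open>H\<close> is positive or negative this gives the claim. The
  total integral is needed to pass to complements.\<close>

lemma AE_zero_if_integral_boxes_zero: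
  fixes H :: "real^2 \<Rightarrow> real"
  assumes H: "integrable lebesgue H"
    and zero: "\<And>l u. (LINT y:box l u|lebesgue. H y) = 0" and total: "(LINT y|lebesgue. H y) = 0"
  shows "AE y in lebesgue. H y = 0"
proof -
  have set_int: "set_integrable lebesgue A H" if "A \<in> sets borel" for A
    using integrable_mult_indicator[OF _ H, of A] that
    by (simp add: set_integrable_def sets_completionI_sets)
  have borel: "(LINT y:A|lebesgue. H y) = 0" if "A \<in> sets borel" for A
  proof -
    let ?G = "range (\<lambda>(a, b). box a b :: (real^2) set)"
    have stable: "Int_stable ?G"
    proof (rule Int_stableI)
      fix B C assume "B \<in> ?G" "C \<in> ?G"
      then obtain a b c d where "B = box a b" "C = box c d" by auto
      then show "B \<inter> C \<in> ?G" using box_Int_box[of a b c d] by auto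
    qed
    have "A \<in> sigma_sets UNIV ?G"
      using that by (simp add: borel_eq_box)
    with stable subset_UNIV[of ?G, folded Pow_UNIV] show ?thesis
    proof (induction rule: sigma_sets_induct_disjoint)
      case (basic A)
      then show ?case using zero by auto
    next
      case empty
      show ?case by (simp add: set_lebesgue_integral_def)
    next
      case (compl A)
      then have A: "A \<in> sets borel" by (simp add: borel_eq_box)
      have "(LINT y:UNIV|lebesgue. H y) = (LINT y:A|lebesgue. H y) + (LINT y:UNIV - A|lebesgue. H y)"
        using set_integral_Un[of A "UNIV - A" lebesgue H] set_int[OF A] set_int[of "UNIV - A"] A
        by (simp add: Compl_partition2 Diff_eq)
      then show ?case using compl total by (simp add: set_lebesgue_integral_def)
    next
      case (union A)
      then have A: "A i \<in> sets borel" for i by (auto simp: borel_eq_box)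
      have "(LINT y:(\<Union>i. A i)|lebesgue. H y) = (\<Sum>i. LINT y:A i|lebesgue. H y)"
        using A union(1) set_int[of "\<Union>i. A i"]
        by (intro lebesgue_integral_countable_add) (auto simp: disjoint_family_on_def)
      then show ?case using union by simp
    qed
  qed
  obtain H' where H': "H' \<in> borel_measurable lborel" "AE y in lborel. H y = H' y"
    using completion_ex_borel_measurable_real[of H lborel] H by (auto dest: borel_measurable_integrable)
  have ae: "AE y in lebesgue. H y = H' y" using H'(2) by (rule AE_completion)
  have pos: "AE y in lebesgue. indicator {y. 0 < c * H' y} y * (c * H y) = 0" if "c = 1 \<or> c = -1" for c :: real
  proof -
    have A: "{y. 0 < c * H' y} \<in> sets borel" using H'(1) by simp
    have "(LINT y|lebesgue. indicator {y. 0 < c * H' y} y * (c * H y)) = c * (LINT y:{y. 0 < c * H' y}|lebesgue. H y)"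
      by (simp add: set_lebesgue_integral_def mult.left_commute)
    then have "(LINT y|lebesgue. indicator {y. 0 < c * H' y} y * (c * H y)) = 0"
      using borel[OF A] by simp
    moreover have "integrable lebesgue (\<lambda>y. indicator {y. 0 < c * H' y} y * (c * H y))"
      using set_int[OF A] by (simp add: set_integrable_def mult.left_commute)
    moreover have "AE y in lebesgue. 0 \<le> indicator {y. 0 < c * H' y} y * (c * H y)"
      using ae by eventually_elim (auto simp: indicator_def)
    ultimately show ?thesis by (simp add: integral_nonneg_eq_0_iff_AE)
  qed
  from ae pos[OF disjI1[OF refl]] pos[OF disjI2[OF refl]] show ?thesis
    by eventually_elim (auto simp: indicator_def split: if_splits)
qed

text \<open>An open set is a countable union of closed boxes, and the previous lemma applies to \<open>H\<close> cut off
  outside each of them. The weak gradient is unique almost everywhere for this reason.\<close>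

lemma AE_zero_if_orthogonal_to_test_functions:
  fixes H :: "real^2 \<Rightarrow> real"
  assumes H: "set_integrable lebesgue U H" "open U"
    and zero: "\<And>\<phi>. \<phi> \<in> test_functions U \<Longrightarrow> (LINT y:U|lebesgue. H y * \<phi> y) = 0"
  shows "AE y in lebesgue. y \<in> U \<longrightarrow> H y = 0"
proof -
  have box: "AE y in lebesgue. y \<in> cbox a b \<longrightarrow> H y = 0" if sub: "cbox a b \<subseteq> U" for a b
  proof -
    have "AE y in lebesgue. indicator (box a b) y * H y = 0"
    proof (rule AE_zero_if_integral_boxes_zero)
      have "set_integrable lebesgue (box a b) H"
        using H(1) by (rule set_integrable_subset) (use sub box_subset_cbox in auto)
      then show "integrable lebesgue (\<lambda>y. indicator (box a b) y * H y)"
        by (simp add: set_integrable_def)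
      show "(LINT y|lebesgue. indicator (box a b) y * H y) = 0"
        using integral_box_eq_0[OF H zero sub] unfolding set_lebesgue_integral_def by simp
      fix l u :: "real^2"
      obtain p q where pq: "box a b \<inter> box l u = box p q"
        by (rule that[OF box_Int_box])
      show "(LINT y:box l u|lebesgue. indicator (box a b) y * H y) = 0"
      proof (cases "box p q = {}")
        case True
        then have "(\<lambda>y. indicator (box l u) y *\<^sub>R (indicator (box a b) y * H y)) = (\<lambda>y. 0)"
          using pq by (auto simp: indicator_def fun_eq_iff)
        then show ?thesis unfolding set_lebesgue_integral_def by simp
      next
        case False
        then have "cbox p q \<subseteq> cbox a b"
          using pq closure_mono[of "box p q" "box a b"]
          by (metis Int_lower1 closure_box closure_empty subset_empty)
        then have "(LINT y:box p q|lebesgue. H y) = 0"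
          using sub by (intro integral_box_eq_0[OF H zero]) auto
        moreover have "(\<lambda>y. indicator (box l u) y *\<^sub>R (indicator (box a b) y * H y)) =
            (\<lambda>y. indicator (box p q) y *\<^sub>R H y)"
          using pq by (auto simp: indicator_def fun_eq_iff)
        ultimately show ?thesis unfolding set_lebesgue_integral_def by simp
      qed
    qed
    moreover have "AE y in lebesgue. y \<notin> cbox a b - box a b"
      by (intro AE_not_in) (simp add: negligible_frontier_interval flip: negligible_iff_null_sets)
    ultimately show ?thesis by eventually_elim (auto simp: indicator_def)
  qed
  obtain D where D: "countable D" "D \<subseteq> Pow U" "\<And>X. X \<in> D \<Longrightarrow> \<exists>a b. X = cbox a b" "\<Union>D = U"
    using open_countable_Union_open_cbox[OF H(2)] by metis
  have "AE y in lebesgue. \<forall>X\<in>D. y \<in> X \<longrightarrow> H y = 0"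
    using D box by (intro AE_ball_countable[THEN iffD2]) (auto, blast)
  then show ?thesis unfolding D(4)[symmetric] by eventually_elim auto
qed

section \<open>The space \<open>L\<^sup>2(M, \<mu>)\<close>\<close>

locale plane_domain =
  fixes M :: "(real^2) set"
  assumes compact_M: "compact M" and interior_M: "interior M \<noteq> {}"
begin

definition vol :: real where "vol = measure lebesgue M"

lemma M_borel: "M \<in> sets borel" and M_lebesgue: "M \<in> sets lebesgue"
  and interior_lebesgue: "interior M \<in> sets lebesgue"
  using compact_M by (auto simp: compact_imp_closed)

lemma emeasure_M: "emeasure lebesgue M = ennreal vol" and vol_pos: "0 < vol"
proof -
  have fin: "M \<in> lmeasurable" using compact_M by (rule lmeasurable_compact)
  then show e: "emeasure lebesgue M = ennreal vol" by (simp add: vol_def emeasure_eq_measure2)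
  obtain x r where "0 < r" "ball x r \<subseteq> M"
    using interior_M by (meson ex_in_conv mem_interior)
  then have "measure lebesgue (ball x r) \<le> vol"
    unfolding vol_def by (intro measure_mono_fmeasurable fin) auto
  moreover have "0 < measure lebesgue (ball x r)"
    using \<open>0 < r\<close> content_ball_pos[of r x] by simp
  ultimately show "0 < vol" by linarith
qed

lemma sets_nvol [simp]: "sets (nvol M) = sets lebesgue"
  and space_nvol [simp]: "space (nvol M) = UNIV"
  by (simp_all add: nvol_def)

lemma measurable_nvol [simp]: "borel_measurable (nvol M) = borel_measurable lebesgue"
  by (rule measurable_cong_sets) simp_all

lemma prob_space_nvol: "prob_space (nvol M)"
  unfolding nvol_def using vol_pos by (intro prob_space_uniform_measure) (simp_all add: emeasure_M)

lemma AE_nvol: "(AE y in nvol M. P y) \<longleftrightarrow> (AE y in lebesgue. y \<in> M \<longrightarrow> P y)"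
  unfolding nvol_def using vol_pos by (intro AE_uniform_measure) (simp_all add: emeasure_M)

lemma nvol_density: "nvol M = density lebesgue (\<lambda>y. ennreal (indicator M y / vol))"
  unfolding nvol_def uniform_measure_def emeasure_M
  using vol_pos by (intro arg_cong2[where f = density] refl)
    (auto simp: fun_eq_iff indicator_def divide_ennreal[of 1, simplified])

lemma integrable_nvol:
  fixes f :: "real^2 \<Rightarrow> real"
  assumes "f \<in> borel_measurable lebesgue"
  shows "integrable (nvol M) f \<longleftrightarrow> set_integrable lebesgue M f"
proof -
  have "integrable (nvol M) f \<longleftrightarrow> integrable lebesgue (\<lambda>y. (indicator M y / vol) *\<^sub>R f y)"
    unfolding nvol_density using assms M_lebesgue vol_pos by (intro integrable_density) auto
  also have "(\<lambda>y. (indicator M y / vol) *\<^sub>R f y) = (\<lambda>y. (1 / vol) * (indicator M y *\<^sub>R f y))" by auto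
  also have "integrable lebesgue \<dots> \<longleftrightarrow> set_integrable lebesgue M f"
    unfolding integrable_mult_left_iff set_integrable_def using vol_pos by simp
  finally show ?thesis .
qed

lemma integral_nvol:
  fixes f :: "real^2 \<Rightarrow> real"
  assumes "f \<in> borel_measurable lebesgue"
  shows "(\<integral>y. f y \<partial>(nvol M)) = (LINT y:M|lebesgue. f y) / vol"
proof -
  have "(\<integral>y. f y \<partial>(nvol M)) = (\<integral>y. (indicator M y / vol) *\<^sub>R f y \<partial>lebesgue)"
    unfolding nvol_density using assms M_lebesgue vol_pos by (intro integral_density) auto
  also have "(\<lambda>y. (indicator M y / vol) *\<^sub>R f y) = (\<lambda>y. (indicator M y *\<^sub>R f y) / vol)" by auto
  finally show ?thesis by (simp add: set_lebesgue_integral_def)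
qed

lemma L2_measurable: "f \<in> L2 M \<Longrightarrow> f \<in> borel_measurable lebesgue"
  by (simp add: L2_def)

lemma L2_mult_integrable:
  assumes "f \<in> L2 M" "g \<in> L2 M"
  shows "integrable (nvol M) (\<lambda>y. f y * g y)"
proof (rule Bochner_Integration.integrable_bound)
  show "integrable (nvol M) (\<lambda>y. (f y)\<^sup>2 + (g y)\<^sup>2)"
    using assms by (auto simp: L2_def)
  show "(\<lambda>y. f y * g y) \<in> borel_measurable (nvol M)"
    using assms by (auto simp: L2_def)
  show "AE y in nvol M. norm (f y * g y) \<le> norm ((f y)\<^sup>2 + (g y)\<^sup>2)"
  proof (rule AE_I2)
    fix y
    have "0 \<le> (\<bar>f y\<bar> - \<bar>g y\<bar>)\<^sup>2" by simp
    then have "2 * (\<bar>f y\<bar> * \<bar>g y\<bar>) \<le> (f y)\<^sup>2 + (g y)\<^sup>2" by (simp add: power2_diff)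
    moreover have "0 \<le> \<bar>f y\<bar> * \<bar>g y\<bar>" by simp
    ultimately have "\<bar>f y\<bar> * \<bar>g y\<bar> \<le> (f y)\<^sup>2 + (g y)\<^sup>2" by linarith
    then show "norm (f y * g y) \<le> norm ((f y)\<^sup>2 + (g y)\<^sup>2)"
      by (simp add: abs_mult)
  qed
qed

lemma L2_lincomb:
  assumes "f \<in> L2 M" "g \<in> L2 M"
  shows "(\<lambda>y. a * f y + b * g y) \<in> L2 M"
proof -
  have "integrable (nvol M) (\<lambda>y. a\<^sup>2 * (f y)\<^sup>2 + 2 * a * b * (f y * g y) + b\<^sup>2 * (g y)\<^sup>2)"
    using assms L2_mult_integrable[OF assms]
    by (intro Bochner_Integration.integrable_add integrable_mult_right) (auto simp: L2_def)
  moreover have "(\<lambda>y. a\<^sup>2 * (f y)\<^sup>2 + 2 * a * b * (f y * g y) + b\<^sup>2 * (g y)\<^sup>2) = (\<lambda>y. (a * f y + b * g y)\<^sup>2)"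
    by (auto simp: power2_eq_square algebra_simps)
  ultimately show ?thesis using assms by (auto simp: L2_def)
qed

lemma bounded_L2:
  assumes "f \<in> borel_measurable lebesgue" "\<And>y. y \<in> M \<Longrightarrow> \<bar>f y\<bar> \<le> C"
  shows "f \<in> L2 M"
proof -
  interpret prob_space "nvol M" by (rule prob_space_nvol)
  have "integrable (nvol M) (\<lambda>y. (f y)\<^sup>2)"
  proof (rule integrable_const_bound)
    show "AE y in nvol M. norm ((f y)\<^sup>2) \<le> C\<^sup>2"
      unfolding AE_nvol using assms(2) by (intro AE_I2) (force simp: abs_le_square_iff[symmetric])
  qed (use assms in auto)
  then show ?thesis using assms by (simp add: L2_def)
qed

lemma L2_integrable: "f \<in> L2 M \<Longrightarrow> integrable (nvol M) f"
  using L2_mult_integrable[of f "\<lambda>_. 1"] bounded_L2[of "\<lambda>_. 1" 1] by auto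

lemma L2_inner_eq:
  assumes "f \<in> L2 M" "g \<in> L2 M"
  shows "L2_inner M f g = (LINT y:M|lebesgue. f y * g y) / vol"
  using assms L2_measurable by (simp add: L2_inner_def integral_nvol)

lemma L2_inner_commute: "L2_inner M f g = L2_inner M g f"
  by (simp add: L2_inner_def mult.commute)

lemma L2_inner_lincomb:
  assumes "f \<in> L2 M" "g \<in> L2 M" "h \<in> L2 M"
  shows "L2_inner M (\<lambda>y. a * f y + b * g y) h = a * L2_inner M f h + b * L2_inner M g h"
proof -
  have "L2_inner M (\<lambda>y. a * f y + b * g y) h = (\<integral>y. a * (f y * h y) + b * (g y * h y) \<partial>(nvol M))"
    unfolding L2_inner_def by (intro Bochner_Integration.integral_cong) (auto simp: algebra_simps)
  then show ?thesis
    using L2_mult_integrable assms by (simp add: L2_inner_def)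
qed

lemma L2_inner_nonneg: "0 \<le> L2_inner M f f"
  by (simp add: L2_inner_def)

lemma L2_norm_square: "(L2_norm M f)\<^sup>2 = L2_inner M f f"
  using L2_inner_nonneg by (simp add: L2_norm_def)

lemma L2_inner_self_eq_0: "f \<in> L2 M \<Longrightarrow> L2_inner M f f = 0 \<longleftrightarrow> (AE y in nvol M. f y = 0)"
  unfolding L2_inner_def using L2_mult_integrable[of f f]
  by (subst integral_nonneg_eq_0_iff_AE) auto

lemma L2_Cauchy_Schwarz:
  assumes "f \<in> L2 M" "g \<in> L2 M"
  shows "(L2_inner M f g)\<^sup>2 \<le> L2_inner M f f * L2_inner M g g"
proof -
  let ?a = "L2_inner M f f" and ?b = "L2_inner M f g" and ?c = "L2_inner M g g"
  have q: "0 \<le> s\<^sup>2 * ?a + 2 * s * t * ?b + t\<^sup>2 * ?c" for s t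
  proof -
    let ?h = "\<lambda>y. s * f y + t * g y"
    have h: "?h \<in> L2 M" by (rule L2_lincomb[OF assms])
    have "L2_inner M ?h ?h = s * L2_inner M f ?h + t * L2_inner M g ?h"
      by (rule L2_inner_lincomb[OF assms h])
    also have "L2_inner M f ?h = s * ?a + t * ?b"
      using L2_inner_lincomb[OF assms assms(1)] by (simp add: L2_inner_commute)
    also have "L2_inner M g ?h = s * ?b + t * ?c"
      using L2_inner_lincomb[OF assms assms(2)] by (simp add: L2_inner_commute)
    finally have "L2_inner M ?h ?h = s\<^sup>2 * ?a + 2 * s * t * ?b + t\<^sup>2 * ?c"
      by (simp add: power2_eq_square algebra_simps)
    then show ?thesis using L2_inner_nonneg[of ?h] by simp
  qed
  have c: "0 \<le> ?c" and a: "0 \<le> ?a" by (rule L2_inner_nonneg)+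
  show ?thesis
  proof (cases "?c = 0")
    case True
    have "?b = 0"
    proof (rule ccontr)
      assume "?b \<noteq> 0"
      moreover have "0 \<le> 1 * ?a + 2 * 1 * (- (?a + 1) / (2 * ?b)) * ?b"
        using q[of 1 "- (?a + 1) / (2 * ?b)"] True by simp
      ultimately show False by (simp add: field_simps)
    qed
    then show ?thesis using True by simp
  next
    case False
    then have "0 < ?c" using c by simp
    have "0 \<le> ?c * (?a * ?c - ?b\<^sup>2)"
      using q[of "?c" "- ?b"] by (simp add: power2_eq_square algebra_simps)
    then show ?thesis using \<open>0 < ?c\<close> by (simp add: zero_le_mult_iff)
  qed
qed

end

section \<open>The Dirichlet form\<close>

text \<open>The difference quotients in the given direction have integral \<open>0\<close> because Lebesgue
  measure is invariant under translations, and they converge boundedly to the derivative.\<close>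

lemma integral_partial_derivative:
  fixes \<phi> :: "real^2 \<Rightarrow> real"
  assumes der: "\<And>y. (\<phi> has_derivative D y) (at y)"
    and cont: "continuous_on UNIV (\<lambda>y. D y e)"
    and K: "compact K" "\<And>y. y \<notin> K \<Longrightarrow> \<phi> y = 0" and e: "norm e = 1"
  shows "(LINT y|lebesgue. D y e) = 0"
proof -
  have D0: "D y e = 0" if "y \<notin> K" for y
  proof -
    have "((\<lambda>y. 0) has_derivative (\<lambda>v. 0)) (at y)" by simp
    then have "(\<phi> has_derivative (\<lambda>v. 0)) (at y)"
      by (rule has_derivative_transform_within_open[where s = "- K"])
        (use that K in \<open>auto simp: compact_imp_closed\<close>)
    then have "D y = (\<lambda>v. 0)" using der has_derivative_unique by blast
    then show ?thesis by simp
  qed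
  have "compact ((\<lambda>y. D y e) ` K)"
    using K(1) cont by (intro compact_continuous_image) (auto intro: continuous_on_subset)
  then obtain B0 where B0: "\<And>y. y \<in> K \<Longrightarrow> \<bar>D y e\<bar> \<le> B0"
    by (meson bounded_real compact_imp_bounded imageI)
  define B where "B = max 0 B0"
  have B: "\<bar>D y e\<bar> \<le> B" for y using B0[of y] D0[of y] by (cases "y \<in> K") (auto simp: B_def)
  have B_nonneg: "0 \<le> B" by (simp add: B_def)
  obtain R where R: "\<And>y. y \<in> K \<Longrightarrow> norm y \<le> R"
    using compact_imp_bounded[OF K(1)] unfolding bounded_iff by blast
  define q where "q n y = (\<phi> (y + (1 / real (Suc n)) *\<^sub>R e) - \<phi> y) / (1 / real (Suc n))" for n y
  have cont_\<phi>: "continuous_on UNIV \<phi>"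
    by (intro continuous_at_imp_continuous_on ballI has_derivative_continuous[OF der])
  have \<phi>_meas [measurable]: "\<phi> \<in> borel_measurable borel"
    by (rule borel_measurable_continuous_onI[OF cont_\<phi>])
  have \<phi>_int: "integrable lborel \<phi>"
  proof -
    have "integrable lborel (\<lambda>y. indicator K y *\<^sub>R \<phi> y)"
      using borel_integrable_compact[OF K(1) continuous_on_subset[OF cont_\<phi>]] by simp
    moreover have "(\<lambda>y. indicator K y *\<^sub>R \<phi> y) = \<phi>" using K(2) by (auto simp: fun_eq_iff split: split_indicator)
    ultimately show ?thesis by simp
  qed
  have q0: "(LINT y|lborel. q n y) = 0" for n
  proof -
    let ?c = "(1 / real (Suc n)) *\<^sub>R e"
    have i: "integrable lborel (\<lambda>y. \<phi> (?c + y))"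
      using \<phi>_int by (subst (asm) lborel_distr_plus[of ?c, symmetric]) (simp add: integrable_distr_eq)
    have "(LINT y|lborel. \<phi> (?c + y)) = (LINT y|lborel. \<phi> y)"
      by (subst (2) lborel_distr_plus[of ?c, symmetric]) (simp add: integral_distr)
    then have "(LINT y|lborel. \<phi> (?c + y) - \<phi> y) = 0"
      using i \<phi>_int by (subst Bochner_Integration.integral_diff) auto
    then have "(LINT y|lborel. (\<phi> (?c + y) - \<phi> y) / (1 / real (Suc n))) = 0"
      unfolding integral_divide_zero by simp
    then show ?thesis unfolding q_def add.commute[of _ "?c"] .
  qed
  have lim: "(\<lambda>n. q n y) \<longlonglongrightarrow> D y e" for y
  proof -
    have "((\<lambda>t. \<phi> (y + t *\<^sub>R e)) has_derivative (\<lambda>t. D y (t *\<^sub>R e))) (at 0)"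
      by (rule has_derivative_compose[where g = \<phi>])
        (use der[of y] in \<open>auto intro!: derivative_eq_intros\<close>)
    moreover have "D y (t *\<^sub>R e) = t * D y e" for t
      using has_derivative_bounded_linear[OF der[of y]] by (simp add: linear_simps)
    ultimately have "((\<lambda>t. \<phi> (y + t *\<^sub>R e)) has_real_derivative D y e) (at 0)"
      by (simp add: has_field_derivative_def mult_commute_abs)
    then have "((\<lambda>h. (\<phi> (y + h *\<^sub>R e) - \<phi> y) / h) \<longlongrightarrow> D y e) (at 0)"
      by (simp add: DERIV_def)
    moreover have "filterlim (\<lambda>n. 1 / real (Suc n)) (at 0) sequentially"
      unfolding filterlim_at using LIMSEQ_Suc[OF lim_1_over_n] by auto
    ultimately show ?thesis
      unfolding q_def by (rule filterlim_compose)
  qed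
  have lip: "\<bar>\<phi> (y + t *\<^sub>R e) - \<phi> y\<bar> \<le> B * t" if "0 < t" for y t
  proof -
    have "\<exists>z. 0 < z \<and> z < t \<and> \<phi> (y + t *\<^sub>R e) - \<phi> (y + 0 *\<^sub>R e) = (t - 0) * D (y + z *\<^sub>R e) e"
    proof (rule MVT2[OF that])
      fix s :: real
      have "((\<lambda>t. \<phi> (y + t *\<^sub>R e)) has_derivative (\<lambda>t. D (y + s *\<^sub>R e) (t *\<^sub>R e))) (at s)"
        by (rule has_derivative_compose[where g = \<phi>])
          (use der in \<open>auto intro!: derivative_eq_intros\<close>)
      moreover have "D (y + s *\<^sub>R e) (t *\<^sub>R e) = t * D (y + s *\<^sub>R e) e" for t
        using has_derivative_bounded_linear[OF der[of "y + s *\<^sub>R e"]] by (simp add: linear_simps)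
      ultimately show "((\<lambda>t. \<phi> (y + t *\<^sub>R e)) has_real_derivative D (y + s *\<^sub>R e) e) (at s)"
        by (simp add: has_field_derivative_def mult_commute_abs)
    qed
    then obtain z where "\<phi> (y + t *\<^sub>R e) - \<phi> y = t * D (y + z *\<^sub>R e) e" by auto
    then show ?thesis using B[of "y + z *\<^sub>R e"] that by (simp add: abs_mult mult.commute)
  qed
  have "(\<lambda>n. LINT y|lborel. q n y) \<longlonglongrightarrow> (LINT y|lborel. D y e)"
  proof (rule integral_dominated_convergence)
    show "integrable lborel (\<lambda>y. B * indicator (cball 0 (R + 1)) y)"
      by (intro integrable_mult_right integrable_real_indicator) (use emeasure_bounded_finite[OF bounded_cball, of 0 "R + 1"] in \<open>auto simp: less_top\<close>)
    show "(\<lambda>y. D y e) \<in> borel_measurable lborel"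
      using borel_measurable_continuous_onI[OF cont] by simp
    show "q n \<in> borel_measurable lborel" for n
      unfolding q_def[abs_def] by measurable
    show "AE y in lborel. (\<lambda>n. q n y) \<longlonglongrightarrow> D y e" using lim by simp
    show "AE y in lborel. norm (q n y) \<le> B * indicator (cball 0 (R + 1)) y" for n
    proof (rule AE_I2)
      fix y :: "real^2"
      let ?t = "1 / real (Suc n)"
      have t: "0 < ?t" "?t \<le> 1" by auto
      show "norm (q n y) \<le> B * indicator (cball 0 (R + 1)) y"
      proof (cases "norm y \<le> R + 1")
        case True
        have "\<bar>q n y\<bar> = \<bar>\<phi> (y + ?t *\<^sub>R e) - \<phi> y\<bar> / ?t"
          by (simp only: q_def abs_divide abs_of_pos[OF t(1)])
        also have "\<dots> \<le> B" using lip[OF t(1), of y] t(1) by (subst pos_divide_le_eq) auto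
        finally show ?thesis using True by simp
      next
        case False
        have "norm y \<le> norm (y + ?t *\<^sub>R e) + norm (?t *\<^sub>R e)"
          by (metis add_diff_cancel_right' norm_triangle_ineq4)
        moreover have "norm (?t *\<^sub>R e) \<le> 1" using e t by simp
        ultimately have "\<not> norm (y + ?t *\<^sub>R e) \<le> R" "\<not> norm y \<le> R"
          using False by linarith+
        then have nk: "y + ?t *\<^sub>R e \<notin> K" "y \<notin> K" using R by blast+
        have "q n y = 0" unfolding q_def nk[THEN K(2)] by simp
        then show ?thesis using B_nonneg by (simp add: indicator_def)
      qed
    qed
  qed
  then have "(LINT y|lborel. D y e) = 0" unfolding q0 by (simp add: LIMSEQ_const_iff)
  moreover have "(\<lambda>y. D y e) \<in> borel_measurable lborel"
    using borel_measurable_continuous_onI[OF cont] by simp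
  ultimately show ?thesis by (simp add: integral_completion)
qed

context plane_domain
begin

definition partial :: "2 \<Rightarrow> (real^2 \<Rightarrow> real) \<Rightarrow> real^2 \<Rightarrow> real" where
  "partial i \<phi> y = frechet_derivative \<phi> (at y) (axis i 1)"

lemma test_function_derivative:
  assumes "\<phi> \<in> test_functions U"
  shows "(\<phi> has_derivative frechet_derivative \<phi> (at y)) (at y)"
    and "continuous_on UNIV (partial i \<phi>)" and "continuous_on UNIV \<phi>"
proof -
  have "\<phi> \<in> C_k (Suc 0)" "\<phi> \<in> C_k 0"
    using assms unfolding test_functions_def by blast+
  then show "(\<phi> has_derivative frechet_derivative \<phi> (at y)) (at y)"
    "continuous_on UNIV (partial i \<phi>)" "continuous_on UNIV \<phi>"
    by (auto simp: differentiable_on_def frechet_derivative_works partial_def[abs_def])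
qed

lemma test_function_support:
  assumes "\<phi> \<in> test_functions U"
  obtains K where "compact K" "K \<subseteq> U" "\<And>y. y \<notin> K \<Longrightarrow> \<phi> y = 0" "\<And>y i. y \<notin> K \<Longrightarrow> partial i \<phi> y = 0"
proof -
  define K where "K = closure {y. \<phi> y \<noteq> 0}"
  have K: "compact K" "K \<subseteq> U" using assms unfolding K_def test_functions_def by blast+
  have 0: "\<phi> y = 0" if "y \<notin> K" for y
    using that closure_subset[of "{y. \<phi> y \<noteq> 0}"] unfolding K_def by blast
  have "partial i \<phi> y = 0" if "y \<notin> K" for y i
  proof -
    have "((\<lambda>y. 0) has_derivative (\<lambda>v. 0)) (at y)" by simp
    then have "(\<phi> has_derivative (\<lambda>v. 0)) (at y)"
      by (rule has_derivative_transform_within_open[where s = "- K"])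
        (use that K in \<open>simp_all add: 0 compact_imp_closed open_Compl\<close>)
    from frechet_derivative_at[OF this] show ?thesis unfolding partial_def by metis
  qed
  with K 0 show ?thesis by (rule that)
qed

lemma continuous_L2: "continuous_on UNIV g \<Longrightarrow> g \<in> L2 M"
proof -
  assume g: "continuous_on UNIV g"
  have "compact (g ` M)"
    using compact_M g by (intro compact_continuous_image) (auto intro: continuous_on_subset)
  then obtain B where "\<And>y. y \<in> M \<Longrightarrow> \<bar>g y\<bar> \<le> B"
    by (meson bounded_real compact_imp_bounded imageI)
  moreover have "g \<in> borel_measurable lebesgue"
    using borel_measurable_continuous_onI[OF g] by (simp add: measurable_completion)
  ultimately show ?thesis by (rule bounded_L2[rotated])
qed

lemma test_function_L2:
  assumes "\<phi> \<in> test_functions U"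
  shows "\<phi> \<in> L2 M" "partial i \<phi> \<in> L2 M"
  using test_function_derivative[OF assms] continuous_L2 by blast+

lemma set_integral_interior:
  fixes f g :: "real^2 \<Rightarrow> real"
  assumes "\<And>y. y \<in> M - interior M \<Longrightarrow> f y = 0"
  shows "(LINT y:interior M|lebesgue. f y) = (LINT y:M|lebesgue. f y)"
proof -
  have "(\<lambda>y. indicator (interior M) y *\<^sub>R f y) = (\<lambda>y. indicator M y *\<^sub>R f y)"
    using assms interior_subset by (auto simp: fun_eq_iff split: split_indicator)
  then show ?thesis unfolding set_lebesgue_integral_def by simp
qed

text \<open>In terms of the normalized inner product on \<open>M\<close> the defining identity of weak derivatives is an
  adjointness relation, to which the calculus of the inner product applies.\<close>

lemma weak_derivative_identity_iff:
  assumes f: "f \<in> L2 M" and g: "g \<in> L2 M" and \<phi>: "\<phi> \<in> test_functions (interior M)"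
  shows "(LINT y:interior M|lebesgue. f y * frechet_derivative \<phi> (at y) (axis i 1)) =
        - (LINT y:interior M|lebesgue. g y * \<phi> y) \<longleftrightarrow>
      L2_inner M f (partial i \<phi>) = - L2_inner M g \<phi>"
proof -
  obtain K where K: "K \<subseteq> interior M" "\<And>y. y \<notin> K \<Longrightarrow> \<phi> y = 0" "\<And>y i. y \<notin> K \<Longrightarrow> partial i \<phi> y = 0"
    using test_function_support[OF \<phi>] by metis
  have "(LINT y:interior M|lebesgue. f y * partial i \<phi> y) = (LINT y:M|lebesgue. f y * partial i \<phi> y)"
    "(LINT y:interior M|lebesgue. g y * \<phi> y) = (LINT y:M|lebesgue. g y * \<phi> y)"
    by (rule set_integral_interior; use K in force)+
  then show ?thesis
    using f g test_function_L2[OF \<phi>] vol_pos by (auto simp: L2_inner_eq partial_def field_simps)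
qed

lemma has_weak_gradient_iff:
  assumes "f \<in> L2 M"
  shows "has_weak_gradient M f G \<longleftrightarrow> (\<forall>i. (\<lambda>y. G y $ i) \<in> L2 M) \<and> (\<forall>y. y \<notin> interior M \<longrightarrow> G y = 0) \<and>
    (\<forall>\<phi>\<in>test_functions (interior M). \<forall>i. L2_inner M f (partial i \<phi>) = - L2_inner M (\<lambda>y. G y $ i) \<phi>)"
  unfolding has_weak_gradient_def using weak_derivative_identity_iff[OF assms] by blast

lemma weak_gradient_unique:
  assumes f: "f \<in> L2 M" and G: "has_weak_gradient M f G" and G': "has_weak_gradient M f G'"
  shows "AE y in lebesgue. G y = G' y"
proof -
  have "AE y in lebesgue. y \<in> interior M \<longrightarrow> G y $ i - G' y $ i = 0" for i
  proof (rule AE_zero_if_orthogonal_to_test_functions)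
    have L: "(\<lambda>y. G y $ i) \<in> L2 M" "(\<lambda>y. G' y $ i) \<in> L2 M"
      using G G' by (auto simp: has_weak_gradient_def)
    have d: "(\<lambda>y. G y $ i - G' y $ i) \<in> L2 M"
      using L2_lincomb[OF L, of 1 "-1"] by simp
    have "set_integrable lebesgue M (\<lambda>y. G y $ i - G' y $ i)"
      using L2_integrable[OF d] L2_measurable[OF d] integrable_nvol by blast
    then show "set_integrable lebesgue (interior M) (\<lambda>y. G y $ i - G' y $ i)"
      by (rule set_integrable_subset) (auto simp: interior_lebesgue interior_subset)
    fix \<phi> assume \<phi>: "\<phi> \<in> test_functions (interior M)"
    have "L2_inner M (\<lambda>y. G y $ i) \<phi> = L2_inner M (\<lambda>y. G' y $ i) \<phi>"
      using G G' \<phi> unfolding has_weak_gradient_iff[OF f] by (metis neg_equal_iff_equal)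
    then have "L2_inner M (\<lambda>y. G y $ i - G' y $ i) \<phi> = 0"
      using L2_inner_lincomb[OF L test_function_L2(1)[OF \<phi>], of 1 "-1"] by simp
    then have "(LINT y:M|lebesgue. (G y $ i - G' y $ i) * \<phi> y) = 0"
      using L2_inner_eq[OF d test_function_L2(1)[OF \<phi>]] vol_pos by simp
    moreover obtain K where "K \<subseteq> interior M" "\<And>y. y \<notin> K \<Longrightarrow> \<phi> y = 0"
      using test_function_support[OF \<phi>] by metis
    ultimately show "(LINT y:interior M|lebesgue. (G y $ i - G' y $ i) * \<phi> y) = 0"
      by (subst set_integral_interior) auto
  qed simp
  from this[of 1] this[of 2] show ?thesis
  proof eventually_elim
    case (elim y)
    have "G y = 0" "G' y = 0" if "y \<notin> interior M"
      using G G' that unfolding has_weak_gradient_def by blast+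
    with elim show ?case
      by (cases "y \<in> interior M") (simp_all add: vec_eq_iff forall_2)
  qed
qed

lemma weak_gradient: "f \<in> H1 M \<Longrightarrow> has_weak_gradient M f (weak_gradient M f)"
  unfolding weak_gradient_def H1_def by (elim CollectE conjE someI_ex)

lemma H1_L2: "f \<in> H1 M \<Longrightarrow> f \<in> L2 M"
  by (simp add: H1_def)

lemma H1I: "f \<in> L2 M \<Longrightarrow> has_weak_gradient M f G \<Longrightarrow> f \<in> H1 M"
  by (auto simp: H1_def)

lemma dirichlet_form_eq:
  assumes "f \<in> L2 M" "has_weak_gradient M f F" "g \<in> L2 M" "has_weak_gradient M g G"
  shows "dirichlet_form M f g = (\<Sum>i\<in>UNIV. L2_inner M (\<lambda>y. F y $ i) (\<lambda>y. G y $ i)) / 2"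
proof -
  have F: "AE y in lebesgue. weak_gradient M f y = F y" and G: "AE y in lebesgue. weak_gradient M g y = G y"
    using assms weak_gradient H1I weak_gradient_unique by blast+
  have L: "(\<lambda>y. F y $ i) \<in> L2 M" "(\<lambda>y. G y $ i) \<in> L2 M"
      "(\<lambda>y. weak_gradient M f y $ i) \<in> L2 M" "(\<lambda>y. weak_gradient M g y $ i) \<in> L2 M" for i
    using assms weak_gradient[OF H1I[OF assms(1,2)]] weak_gradient[OF H1I[OF assms(3,4)]]
    by (auto simp: has_weak_gradient_def)
  have int: "integrable (nvol M) (\<lambda>y. F y $ i * G y $ i)" for i
    using L2_mult_integrable L by blast
  have "(\<integral>y. weak_gradient M f y \<bullet> weak_gradient M g y \<partial>(nvol M)) = (\<integral>y. (\<Sum>i\<in>UNIV. F y $ i * G y $ i) \<partial>(nvol M))"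
  proof (rule integral_cong_AE)
    show "(\<lambda>y. weak_gradient M f y \<bullet> weak_gradient M g y) \<in> borel_measurable (nvol M)"
      unfolding inner_vec_def inner_real_def measurable_nvol
      by (intro borel_measurable_sum borel_measurable_times L2_measurable L)
    show "(\<lambda>y. \<Sum>i\<in>UNIV. F y $ i * G y $ i) \<in> borel_measurable (nvol M)"
      unfolding measurable_nvol by (intro borel_measurable_sum borel_measurable_times L2_measurable L)
    show "AE y in nvol M. weak_gradient M f y \<bullet> weak_gradient M g y = (\<Sum>i\<in>UNIV. F y $ i * G y $ i)"
      unfolding AE_nvol using F G by eventually_elim (auto simp: inner_vec_def)
  qed
  also have "\<dots> = (\<Sum>i\<in>UNIV. \<integral>y. F y $ i * G y $ i \<partial>(nvol M))"
    by (rule Bochner_Integration.integral_sum) (rule int)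
  finally show ?thesis by (simp add: dirichlet_form_def L2_inner_def)
qed

lemma has_weak_gradient_lincomb:
  assumes f: "f \<in> L2 M" "has_weak_gradient M f F" and g: "g \<in> L2 M" "has_weak_gradient M g G"
  shows "has_weak_gradient M (\<lambda>y. a * f y + b * g y) (\<lambda>y. a *\<^sub>R F y + b *\<^sub>R G y)"
proof -
  have L: "(\<lambda>y. F y $ i) \<in> L2 M" "(\<lambda>y. G y $ i) \<in> L2 M" for i
    using f g by (auto simp: has_weak_gradient_def)
  show ?thesis
    unfolding has_weak_gradient_iff[OF L2_lincomb[OF f(1) g(1)]]
  proof (intro conjI allI ballI impI)
    show "(\<lambda>y. (a *\<^sub>R F y + b *\<^sub>R G y) $ i) \<in> L2 M" for i
      using L2_lincomb[OF L] by simp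
    show "a *\<^sub>R F y + b *\<^sub>R G y = 0" if "y \<notin> interior M" for y
      using f(2) g(2) that by (auto simp: has_weak_gradient_def)
    fix \<phi> i assume \<phi>: "\<phi> \<in> test_functions (interior M)"
    have "L2_inner M f (partial i \<phi>) = - L2_inner M (\<lambda>y. F y $ i) \<phi>"
      "L2_inner M g (partial i \<phi>) = - L2_inner M (\<lambda>y. G y $ i) \<phi>"
      using f g \<phi> has_weak_gradient_iff by blast+
    then show "L2_inner M (\<lambda>y. a * f y + b * g y) (partial i \<phi>) =
        - L2_inner M (\<lambda>y. (a *\<^sub>R F y + b *\<^sub>R G y) $ i) \<phi>"
      using f g L2_inner_lincomb[OF L test_function_L2(1)[OF \<phi>]]
        L2_inner_lincomb[OF f(1) g(1) test_function_L2(2)[OF \<phi>]] by simp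
  qed
qed

lemma H1_lincomb:
  assumes "f \<in> H1 M" "g \<in> H1 M"
  shows "(\<lambda>y. a * f y + b * g y) \<in> H1 M"
  using assms H1I[OF L2_lincomb has_weak_gradient_lincomb] weak_gradient H1_L2 by metis

lemma dirichlet_form_commute: "dirichlet_form M f g = dirichlet_form M g f"
  by (simp add: dirichlet_form_def inner_commute)

lemma dirichlet_form_nonneg: "0 \<le> dirichlet_form M f f"
  by (simp add: dirichlet_form_def)

lemma dirichlet_form_lincomb:
  assumes f: "f \<in> H1 M" and g: "g \<in> H1 M" and h: "h \<in> H1 M"
  shows "dirichlet_form M (\<lambda>y. a * f y + b * g y) h = a * dirichlet_form M f h + b * dirichlet_form M g h"
proof -
  note W = f[THEN H1_L2] f[THEN weak_gradient] g[THEN H1_L2] g[THEN weak_gradient]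
    h[THEN H1_L2] h[THEN weak_gradient]
  have L: "(\<lambda>y. weak_gradient M k y $ i) \<in> L2 M" if "k \<in> H1 M" for k i
    using weak_gradient[OF that] by (auto simp: has_weak_gradient_def)
  have "L2_inner M (\<lambda>y. (a *\<^sub>R weak_gradient M f y + b *\<^sub>R weak_gradient M g y) $ i) (\<lambda>y. weak_gradient M h y $ i) =
      a * L2_inner M (\<lambda>y. weak_gradient M f y $ i) (\<lambda>y. weak_gradient M h y $ i) +
      b * L2_inner M (\<lambda>y. weak_gradient M g y $ i) (\<lambda>y. weak_gradient M h y $ i)" for i
    using L2_inner_lincomb[OF L[OF f] L[OF g] L[OF h]] by simp
  then show ?thesis
    unfolding dirichlet_form_eq[OF L2_lincomb[OF W(1,3)] has_weak_gradient_lincomb[OF W(1-4)] W(5,6)]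
      dirichlet_form_eq[OF W(1,2,5,6)] dirichlet_form_eq[OF W(3-6)]
    by (simp add: sum.distrib sum_distrib_left)
qed

text \<open>Integration by parts: the product of \<open>f\<close> with a test function has compact support, so its
  partial derivatives have integral \<open>0\<close>.\<close>

lemma has_weak_gradient_classical:
  assumes der: "\<And>y. (f has_derivative (\<lambda>v. v \<bullet> F y)) (at y)" and cont: "continuous_on UNIV F"
  shows "f \<in> L2 M" "has_weak_gradient M f (\<lambda>y. if y \<in> interior M then F y else 0)"
proof -
  have cont_f: "continuous_on UNIV f"
    by (intro continuous_at_imp_continuous_on ballI has_derivative_continuous[OF der])
  then show f: "f \<in> L2 M" by (rule continuous_L2)
  have Fi: "continuous_on UNIV (\<lambda>y. F y $ i)" for i using cont by (intro continuous_intros)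
  show "has_weak_gradient M f (\<lambda>y. if y \<in> interior M then F y else 0)"
    unfolding has_weak_gradient_def
  proof (intro conjI allI ballI impI)
    fix i :: 2
    obtain B where B: "\<And>y. y \<in> M \<Longrightarrow> \<bar>F y $ i\<bar> \<le> B"
    proof -
      have "compact ((\<lambda>y. F y $ i) ` M)"
        using compact_M Fi by (intro compact_continuous_image) (auto intro: continuous_on_subset)
      then show ?thesis by (meson bounded_real compact_imp_bounded imageI that)
    qed
    have "(\<lambda>y. F y $ i) \<in> borel_measurable lebesgue"
      using borel_measurable_continuous_onI[OF Fi] by (simp add: measurable_completion)
    then have "(\<lambda>y. if y \<in> interior M then F y $ i else 0) \<in> borel_measurable lebesgue"
      using interior_lebesgue by (intro measurable_If_set) auto
    moreover have "(\<lambda>y. (if y \<in> interior M then F y else 0) $ i) = (\<lambda>y. if y \<in> interior M then F y $ i else 0)"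
      by auto
    ultimately show "(\<lambda>y. (if y \<in> interior M then F y else 0) $ i) \<in> L2 M"
      using B interior_subset by (intro bounded_L2[where C = "max B 0"]) (auto simp: le_max_iff_disj)
  next
    fix \<phi> and i :: 2 assume \<phi>: "\<phi> \<in> test_functions (interior M)"
    obtain K where K: "compact K" "K \<subseteq> interior M" "\<And>y. y \<notin> K \<Longrightarrow> \<phi> y = 0" "\<And>y i. y \<notin> K \<Longrightarrow> partial i \<phi> y = 0"
      using test_function_support[OF \<phi>] by metis
    have prod: "((\<lambda>y. f y * \<phi> y) has_derivative (\<lambda>v. f y * frechet_derivative \<phi> (at y) v + (v \<bullet> F y) * \<phi> y)) (at y)" for y
      by (rule has_derivative_mult[OF der test_function_derivative(1)[OF \<phi>]])
    have ax: "axis i 1 \<bullet> F y = F y $ i" for y by (simp add: inner_axis')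
    have c1: "continuous_on UNIV (\<lambda>y. f y * partial i \<phi> y)" and c2: "continuous_on UNIV (\<lambda>y. F y $ i * \<phi> y)"
      using cont_f Fi test_function_derivative[OF \<phi>] by (auto intro: continuous_on_mult)
    have "(LINT y|lebesgue. f y * partial i \<phi> y + F y $ i * \<phi> y) = 0"
      using integral_partial_derivative[OF prod _ K(1), of "axis i 1"] K(3) c1 c2
      by (simp add: ax continuous_on_add flip: partial_def)
    moreover have "integrable lebesgue (\<lambda>y. g y)" if "continuous_on UNIV g" "\<And>y. y \<notin> K \<Longrightarrow> g y = 0" for g :: "real^2 \<Rightarrow> real"
    proof -
      have "integrable lborel (\<lambda>y. indicator K y *\<^sub>R g y)"
        using borel_integrable_compact[OF K(1) continuous_on_subset[OF that(1)]] by simp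
      moreover have "(\<lambda>y. indicator K y *\<^sub>R g y) = g" using that(2) by (auto simp: fun_eq_iff split: split_indicator)
      ultimately show ?thesis by (simp add: integrable_completion borel_measurable_integrable)
    qed
    ultimately have "(LINT y|lebesgue. f y * partial i \<phi> y) = - (LINT y|lebesgue. F y $ i * \<phi> y)"
      using c1 c2 K by (simp add: Bochner_Integration.integral_add)
    moreover have "(\<lambda>y. indicator (interior M) y *\<^sub>R (f y * partial i \<phi> y)) = (\<lambda>y. f y * partial i \<phi> y)"
      "(\<lambda>y. indicator (interior M) y *\<^sub>R ((if y \<in> interior M then F y else 0) $ i * \<phi> y)) = (\<lambda>y. F y $ i * \<phi> y)"
      using K by (auto simp: fun_eq_iff split: split_indicator)
    ultimately show "(LINT y:interior M|lebesgue. f y * frechet_derivative \<phi> (at y) (axis i 1)) =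
        - (LINT y:interior M|lebesgue. (if y \<in> interior M then F y else 0) $ i * \<phi> y)"
      unfolding set_lebesgue_integral_def partial_def by simp
  qed auto
qed

lemma has_weak_gradient_const: "has_weak_gradient M (\<lambda>_. c) (\<lambda>_. 0)" and const_H1: "(\<lambda>_. c) \<in> H1 M"
proof -
  have "has_weak_gradient M (\<lambda>_. c) (\<lambda>y. if y \<in> interior M then 0 else 0)"
    by (rule has_weak_gradient_classical) auto
  then show *: "has_weak_gradient M (\<lambda>_. c) (\<lambda>_. 0)" by simp
  show "(\<lambda>_. c) \<in> H1 M" by (rule H1I[OF _ *]) (auto intro: continuous_L2)
qed

lemma dirichlet_form_const:
  assumes "f \<in> H1 M"
  shows "dirichlet_form M f (\<lambda>_. c) = 0"
  unfolding dirichlet_form_eq[OF H1_L2[OF assms] weak_gradient[OF assms] H1_L2[OF const_H1] has_weak_gradient_const]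
  by (simp add: L2_inner_def)

end

section \<open>The Poincare inequality\<close>

context plane_domain
begin

lemma prob_UNIV: "measure (nvol M) UNIV = 1"
  using prob_space.prob_space[OF prob_space_nvol] by simp

lemma L2_inner_diff:
  assumes "f \<in> L2 M" "g \<in> L2 M" "h \<in> L2 M"
  shows "L2_inner M (\<lambda>y. f y - g y) h = L2_inner M f h - L2_inner M g h"
  using L2_inner_lincomb[OF assms, of 1 "-1"] by simp

lemma L2_diff: "f \<in> L2 M \<Longrightarrow> g \<in> L2 M \<Longrightarrow> (\<lambda>y. f y - g y) \<in> L2 M"
  using L2_lincomb[of f g 1 "-1"] by simp

lemma H1_sum:
  assumes "\<And>k. \<phi> k \<in> H1 M"
  shows "(\<lambda>y. \<Sum>k<(n::nat). c k * \<phi> k y) \<in> H1 M"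
proof (induction n)
  case 0
  then show ?case using const_H1[of 0] by simp
next
  case (Suc n)
  then show ?case using H1_lincomb[OF Suc assms, of 1 "c n"] by simp
qed

lemma L2_sum:
  assumes "\<And>k. \<phi> k \<in> L2 M"
  shows "(\<lambda>y. \<Sum>k<(n::nat). c k * \<phi> k y) \<in> L2 M"
proof (induction n)
  case 0
  then show ?case using H1_L2[OF const_H1[of 0]] by simp
next
  case (Suc n)
  then show ?case using L2_lincomb[OF Suc assms, of 1 "c n"] by simp
qed

lemma L2_inner_sum:
  assumes "\<And>k. \<phi> k \<in> L2 M" "h \<in> L2 M"
  shows "L2_inner M (\<lambda>y. \<Sum>k<(n::nat). c k * \<phi> k y) h = (\<Sum>k<n. c k * L2_inner M (\<phi> k) h)"
proof (induction n)
  case 0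
  then show ?case by (simp add: L2_inner_def)
next
  case (Suc n)
  then show ?case using L2_inner_lincomb[OF L2_sum[OF assms(1)] assms(1,2), where a = 1 and b = "c n"] by simp
qed

lemma dirichlet_form_sum:
  assumes "\<And>k. \<phi> k \<in> H1 M" "h \<in> H1 M"
  shows "dirichlet_form M (\<lambda>y. \<Sum>k<(n::nat). c k * \<phi> k y) h = (\<Sum>k<n. c k * dirichlet_form M (\<phi> k) h)"
proof (induction n)
  case 0
  then show ?case
    using dirichlet_form_const[OF assms(2), of 0] by (simp add: dirichlet_form_commute)
next
  case (Suc n)
  then show ?case using dirichlet_form_lincomb[OF H1_sum[OF assms(1)] assms(1,2), where a = 1 and b = "c n"] by simp
qed

text \<open>Riesz--Fischer and Parseval: the partial sums of the Fourier series are Cauchy in \<open>L\<^sup>1\<close>, so a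
  subsequence converges almost everywhere; by Fatou's lemma the limit is also the \<open>L\<^sup>2\<close> limit, and
  by completeness of the system it is the function itself.\<close>

lemma Parseval:
  assumes \<phi>: "\<And>k. \<phi> k \<in> L2 M"
    and orth: "\<And>j k. L2_inner M (\<phi> j) (\<phi> k) = (if j = k then 1 else 0)"
    and total: "\<And>f. f \<in> L2 M \<Longrightarrow> (\<And>k. L2_inner M f (\<phi> k) = 0) \<Longrightarrow> AE y in nvol M. f y = 0"
    and f: "f \<in> L2 M"
  shows "(\<lambda>k. (L2_inner M f (\<phi> k))\<^sup>2) sums L2_inner M f f"
proof -
  interpret P: prob_space "nvol M" by (rule prob_space_nvol)
  define c where "c k = L2_inner M f (\<phi> k)" for k
  define S where "S n y = (\<Sum>k<n. c k * \<phi> k y)" for n y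
  have S: "S n \<in> L2 M" for n unfolding S_def[abs_def] by (rule L2_sum[OF \<phi>])
  have S_inner: "L2_inner M (S n) h = (\<Sum>k<n. c k * L2_inner M (\<phi> k) h)" if "h \<in> L2 M" for n h
    unfolding S_def[abs_def] by (rule L2_inner_sum[OF \<phi> that])
  have fS: "L2_inner M f (S n) = (\<Sum>k<n. (c k)\<^sup>2)" for n
    using S_inner[OF f, of n] by (simp add: L2_inner_commute[of f] c_def power2_eq_square)
  have S\<phi>: "L2_inner M (S n) (\<phi> k) = (if k < n then c k else 0)" for n k
    by (simp add: S_inner[OF \<phi>] orth if_distrib cong: if_cong)
  have SS: "L2_inner M (S m) (S n) = (\<Sum>k<min m n. (c k)\<^sup>2)" for m n
  proof -
    have "L2_inner M (S m) (S n) = (\<Sum>k<m. if k < n then (c k)\<^sup>2 else 0)"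
      unfolding S_inner[OF S] by (intro sum.cong) (auto simp: L2_inner_commute[of "\<phi> _"] S\<phi> power2_eq_square)
    also have "\<dots> = (\<Sum>k<min m n. (c k)\<^sup>2)"
      by (intro sum.mono_neutral_cong_right) auto
    finally show ?thesis .
  qed
  have dist_f: "L2_inner M (\<lambda>y. f y - S n y) (\<lambda>y. f y - S n y) = L2_inner M f f - (\<Sum>k<n. (c k)\<^sup>2)" for n
  proof -
    have "L2_inner M (\<lambda>y. f y - S n y) (\<lambda>y. f y - S n y) =
        L2_inner M f (\<lambda>y. f y - S n y) - L2_inner M (S n) (\<lambda>y. f y - S n y)"
      by (rule L2_inner_diff[OF f S L2_diff[OF f S]])
    also have "\<dots> = L2_inner M f f - (\<Sum>k<n. (c k)\<^sup>2)"
      using L2_inner_diff[OF f S f, of n] L2_inner_diff[OF f S S, of n n] fS[of n] SS[of n n]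
      by (simp add: L2_inner_commute)
    finally show ?thesis .
  qed
  have bessel: "(\<Sum>k<n. (c k)\<^sup>2) \<le> L2_inner M f f" for n
    using dist_f[of n] L2_inner_nonneg[of "\<lambda>y. f y - S n y"] by simp
  have summable: "summable (\<lambda>k. (c k)\<^sup>2)"
    by (rule bounded_imp_summable[of _ "L2_inner M f f"])
      (use bessel[of "Suc _"] in \<open>auto simp: lessThan_Suc_atMost\<close>)
  define tail where "tail n = (\<Sum>k. (c k)\<^sup>2) - (\<Sum>k<n. (c k)\<^sup>2)" for n
  have tail_lim: "tail \<longlonglongrightarrow> 0"
    using tendsto_diff[OF tendsto_const summable_LIMSEQ[OF summable], of "\<Sum>k. (c k)\<^sup>2"]
    by (simp add: tail_def[abs_def])
  have dist_S: "L2_inner M (\<lambda>y. S m y - S n y) (\<lambda>y. S m y - S n y) \<le> tail (min m n)" for m n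
  proof -
    have "L2_inner M (\<lambda>y. S m y - S n y) (\<lambda>y. S m y - S n y) =
        L2_inner M (S m) (\<lambda>y. S m y - S n y) - L2_inner M (S n) (\<lambda>y. S m y - S n y)"
      by (rule L2_inner_diff[OF S S L2_diff[OF S S]])
    also have "\<dots> = (\<Sum>k<m. (c k)\<^sup>2) + (\<Sum>k<n. (c k)\<^sup>2) - 2 * (\<Sum>k<min m n. (c k)\<^sup>2)"
      using L2_inner_diff[OF S S S, of m n m] L2_inner_diff[OF S S S, of m n n] SS
      by (simp add: L2_inner_commute min.commute)
    also have "\<dots> = (\<Sum>k<max m n. (c k)\<^sup>2) - (\<Sum>k<min m n. (c k)\<^sup>2)"
      by (auto simp: min_def max_def)
    also have "\<dots> \<le> tail (min m n)"
      unfolding tail_def using sum_le_suminf[OF summable, of "{..<max m n}"] by simp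
    finally show ?thesis .
  qed
  have L1: "(\<integral>y. norm (S m y - S n y) \<partial>(nvol M)) \<le> sqrt (tail (min m n))" for m n
  proof -
    let ?d = "\<lambda>y. \<bar>S m y - S n y\<bar>"
    have d: "?d \<in> L2 M"
      using L2_diff[OF S S, of m n] by (auto simp: L2_def)
    have one: "(\<lambda>_. 1) \<in> L2 M" using H1_L2[OF const_H1] .
    have "(L2_inner M ?d (\<lambda>_. 1))\<^sup>2 \<le> L2_inner M ?d ?d * L2_inner M (\<lambda>_. 1) (\<lambda>_. 1)"
      by (rule L2_Cauchy_Schwarz[OF d one])
    also have "\<dots> = L2_inner M (\<lambda>y. S m y - S n y) (\<lambda>y. S m y - S n y)"
      by (simp add: L2_inner_def prob_UNIV)
    also have "\<dots> \<le> tail (min m n)" by (rule dist_S)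
    finally have "L2_inner M ?d (\<lambda>_. 1) \<le> sqrt (tail (min m n))" by (rule real_le_rsqrt)
    then show ?thesis by (simp add: L2_inner_def)
  qed
  obtain r where r: "strict_mono r" "AE y in nvol M. Cauchy (\<lambda>n. S (r n) y)"
  proof (rule cauchy_L1_AE_cauchy_subseq[of "nvol M" S])
    show "integrable (nvol M) (S n)" for n by (rule L2_integrable[OF S])
    fix e :: real assume "0 < e"
    then have "\<forall>\<^sub>F n in sequentially. tail n < e\<^sup>2"
      using order_tendstoD(2)[OF tail_lim, of "e\<^sup>2"] by simp
    then obtain N where N: "\<And>n. N \<le> n \<Longrightarrow> tail n < e\<^sup>2" by (auto simp: eventually_sequentially)
    have "(\<integral>y. norm (S i y - S j y) \<partial>(nvol M)) < e" if "N \<le> i" "N \<le> j" for i j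
    proof -
      have "sqrt (tail (min i j)) < sqrt (e\<^sup>2)"
        using N[of "min i j"] that by (intro real_sqrt_less_mono) simp
      also have "sqrt (e\<^sup>2) = e" using \<open>0 < e\<close> by simp
      finally show ?thesis using L1[of i j] by simp
    qed
    then show "\<exists>N. \<forall>i\<ge>N. \<forall>j\<ge>N. (\<integral>y. norm (S i y - S j y) \<partial>(nvol M)) < e" by blast
  qed
  define g where "g y = lim (\<lambda>n. S (r n) y)" for y
  have S_meas [measurable]: "S n \<in> borel_measurable (nvol M)" for n
    using S[of n] unfolding L2_def by blast
  have g_meas [measurable]: "g \<in> borel_measurable (nvol M)"
    unfolding g_def[abs_def] by (rule borel_measurable_lim_metric) (rule S_meas)
  have lim: "AE y in nvol M. (\<lambda>n. S (r n) y) \<longlonglongrightarrow> g y"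
    using r(2) by eventually_elim (auto simp: g_def Cauchy_convergent_iff convergent_LIMSEQ_iff)
  have fatou: "(\<integral>\<^sup>+ y. ennreal ((g y - S m y)\<^sup>2) \<partial>(nvol M)) \<le> ennreal (tail m)" for m
  proof -
    have "(\<integral>\<^sup>+ y. ennreal ((g y - S m y)\<^sup>2) \<partial>(nvol M)) =
        (\<integral>\<^sup>+ y. liminf (\<lambda>n. ennreal ((S (r n) y - S m y)\<^sup>2)) \<partial>(nvol M))"
    proof (rule nn_integral_cong_AE)
      show "AE y in nvol M. ennreal ((g y - S m y)\<^sup>2) = liminf (\<lambda>n. ennreal ((S (r n) y - S m y)\<^sup>2))"
        using lim
      proof eventually_elim
        case (elim y)
        have "(\<lambda>n. ennreal ((S (r n) y - S m y)\<^sup>2)) \<longlonglongrightarrow> ennreal ((g y - S m y)\<^sup>2)"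
          by (intro tendsto_ennrealI tendsto_intros elim)
        then show ?case using lim_imp_Liminf[OF sequentially_bot] by metis
      qed
    qed
    also have "\<dots> \<le> liminf (\<lambda>n. \<integral>\<^sup>+ y. ennreal ((S (r n) y - S m y)\<^sup>2) \<partial>(nvol M))"
      by (rule nn_integral_liminf) measurable
    also have "\<dots> \<le> ennreal (tail m)"
    proof (rule Liminf_le)
      have "(\<integral>\<^sup>+ y. ennreal ((S (r n) y - S m y)\<^sup>2) \<partial>(nvol M)) \<le> ennreal (tail m)" if "m \<le> n" for n
      proof -
        have "m \<le> r n" using that seq_suble[OF r(1), of n] by linarith
        then have "L2_inner M (\<lambda>y. S (r n) y - S m y) (\<lambda>y. S (r n) y - S m y) \<le> tail m"
          using dist_S[of "r n" m] by (simp add: min_def split: if_splits)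
        moreover have "(\<integral>\<^sup>+ y. ennreal ((S (r n) y - S m y)\<^sup>2) \<partial>(nvol M)) =
            ennreal (\<integral>y. (S (r n) y - S m y)\<^sup>2 \<partial>(nvol M))"
          using L2_diff[OF S S, of "r n" m] by (intro nn_integral_eq_integral) (auto simp: L2_def)
        ultimately show ?thesis by (simp add: L2_inner_def power2_eq_square ennreal_leI)
      qed
      then show "\<forall>\<^sub>F n in sequentially. (\<integral>\<^sup>+ y. ennreal ((S (r n) y - S m y)\<^sup>2) \<partial>(nvol M)) \<le> ennreal (tail m)"
        by (auto simp: eventually_sequentially)
    qed simp
    finally show ?thesis .
  qed
  have gS: "(\<lambda>y. g y - S m y) \<in> L2 M" for m
  proof -
    have m: "(\<lambda>y. g y - S m y) \<in> borel_measurable (nvol M)" by measurable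
    have "integrable (nvol M) (\<lambda>y. (g y - S m y)\<^sup>2)"
    proof (rule integrableI_nonneg)
      show "(\<lambda>y. (g y - S m y)\<^sup>2) \<in> borel_measurable (nvol M)"
        by (rule borel_measurable_power[OF m])
      show "(\<integral>\<^sup>+ y. ennreal ((g y - S m y)\<^sup>2) \<partial>(nvol M)) < \<infinity>"
        using fatou[of m] le_less_trans[OF _ ennreal_less_top] by simp
    qed simp
    then show ?thesis using m unfolding L2_def by blast
  qed
  have g: "g \<in> L2 M" using gS[of 0] by (simp add: S_def)
  have gS_le: "L2_inner M (\<lambda>y. g y - S m y) (\<lambda>y. g y - S m y) \<le> tail m" for m
  proof -
    have "0 \<le> tail m" using sum_le_suminf[OF summable, of "{..<m}"] by (simp add: tail_def)
    moreover have "(\<integral>\<^sup>+ y. ennreal ((g y - S m y)\<^sup>2) \<partial>(nvol M)) = ennreal (\<integral>y. (g y - S m y)\<^sup>2 \<partial>(nvol M))"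
      using gS[of m] by (intro nn_integral_eq_integral) (auto simp: L2_def)
    ultimately show ?thesis using fatou[of m] by (simp add: L2_inner_def power2_eq_square)
  qed
  have "L2_inner M (\<lambda>y. f y - g y) (\<phi> k) = 0" for k
  proof -
    have b: "(L2_inner M (\<lambda>y. f y - g y) (\<phi> k))\<^sup>2 \<le> tail m" if "k < m" for m
    proof -
      have "L2_inner M (\<lambda>y. f y - g y) (\<phi> k) = - L2_inner M (\<lambda>y. g y - S m y) (\<phi> k)"
        using L2_inner_diff[OF f g \<phi>, of k] L2_inner_diff[OF g S \<phi>, of m k] S\<phi>[of m k] that
        by (simp add: c_def)
      then have "(L2_inner M (\<lambda>y. f y - g y) (\<phi> k))\<^sup>2 = (L2_inner M (\<lambda>y. g y - S m y) (\<phi> k))\<^sup>2"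
        by simp
      also have "\<dots> \<le> L2_inner M (\<lambda>y. g y - S m y) (\<lambda>y. g y - S m y) * L2_inner M (\<phi> k) (\<phi> k)"
        by (rule L2_Cauchy_Schwarz[OF gS \<phi>])
      finally show ?thesis using gS_le[of m] by (simp add: orth)
    qed
    have "(L2_inner M (\<lambda>y. f y - g y) (\<phi> k))\<^sup>2 \<le> 0"
      by (rule tendsto_lowerbound[OF tail_lim]) (use b in \<open>auto simp: eventually_sequentially intro!: exI[of _ "Suc k"]\<close>)
    then show ?thesis by simp
  qed
  then have "AE y in nvol M. f y - g y = 0" by (rule total[OF L2_diff[OF f g]])
  then have fg: "AE y in nvol M. f y = g y" by eventually_elim simp
  have "L2_inner M f f - (\<Sum>k<n. (c k)\<^sup>2) \<le> tail n" for n
  proof -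
    have "L2_inner M (\<lambda>y. f y - S n y) (\<lambda>y. f y - S n y) = L2_inner M (\<lambda>y. g y - S n y) (\<lambda>y. g y - S n y)"
      unfolding L2_inner_def
      by (rule integral_cong_AE) (use fg L2_measurable[OF f] L2_measurable[OF g] L2_measurable[OF S] in \<open>auto elim!: eventually_mono\<close>)
    then show ?thesis using dist_f[of n] gS_le[of n] by simp
  qed
  then have "L2_inner M f f \<le> (\<Sum>k. (c k)\<^sup>2)" by (simp add: tail_def)
  moreover have "(\<Sum>k. (c k)\<^sup>2) \<le> L2_inner M f f"
    by (rule suminf_le_const[OF summable bessel])
  ultimately show ?thesis using summable_sums[OF summable] by (simp add: c_def)
qed

text \<open>The constants are orthogonal to all eigenfunctions with positive eigenvalue, so by completeness
  the eigenfunction of \<open>0\<close> is constant and the mean of \<open>f\<close> is its coefficient of index \<open>0\<close>, up to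
  a sign. The other coefficients carry a factor of at least \<open>\<nu>\<^sub>1\<close> in the Dirichlet form.\<close>

lemma Poincare:
  assumes "discrete_neumann_spectrum_with_gap M"
  obtains \<nu> where "0 < \<nu>"
    "\<And>f. f \<in> H1 M \<Longrightarrow> \<nu> * (L2_inner M f f - (L2_inner M f (\<lambda>_. 1))\<^sup>2) \<le> dirichlet_form M f f"
proof -
  interpret P: prob_space "nvol M" by (rule prob_space_nvol)
  obtain \<phi> \<nu> where
    op: "\<And>k. neumann_operator M (\<phi> k) (\<lambda>y. \<nu> k * \<phi> k y)"
    and orth: "\<And>j k. L2_inner M (\<phi> j) (\<phi> k) = (if j = k then 1 else 0 :: real)"
    and total: "\<And>f. f \<in> L2 M \<Longrightarrow> (\<And>k. L2_inner M f (\<phi> k) = 0) \<Longrightarrow> AE y in nvol M. f y = 0"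
    and \<nu>: "incseq \<nu>" "\<nu> 0 = 0" "0 < \<nu> (1::nat)"
    using assms unfolding discrete_neumann_spectrum_with_gap_def by metis
  have \<phi>: "\<phi> k \<in> H1 M" and \<phi>2: "\<phi> k \<in> L2 M" for k
    using op[of k] H1_L2 by (auto simp: neumann_operator_def)
  have E: "dirichlet_form M (\<phi> k) v = \<nu> k * L2_inner M (\<phi> k) v" if "v \<in> H1 M" for k v
    using op[of k] that by (auto simp: neumann_operator_def L2_inner_def mult.assoc)
  have \<nu>_ge: "\<nu> 1 \<le> \<nu> k" if "1 \<le> k" for k using \<nu>(1) that by (auto simp: incseq_def)
  let ?one = "\<lambda>_::real^2. 1 :: real"
  have one: "?one \<in> H1 M" "?one \<in> L2 M" using const_H1 H1_L2 by blast+
  have one_\<phi>: "L2_inner M ?one (\<phi> k) = 0" if "1 \<le> k" for k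
    using E[OF one(1), of k] dirichlet_form_const[OF \<phi>, of k 1] \<nu>_ge[OF that] \<nu>(3)
    by (simp add: L2_inner_commute)
  have one_one: "L2_inner M ?one ?one = 1" by (simp add: L2_inner_def prob_UNIV)
  define a where "a = L2_inner M ?one (\<phi> 0)"
  have "AE y in nvol M. 1 - a * \<phi> 0 y = 0"
  proof (rule total)
    show "(\<lambda>y. 1 - a * \<phi> 0 y) \<in> L2 M" using L2_lincomb[OF one(2) \<phi>2[of 0], of 1 "- a"] by simp
    show "L2_inner M (\<lambda>y. 1 - a * \<phi> 0 y) (\<phi> k) = 0" for k
      using L2_inner_lincomb[OF one(2) \<phi>2[of 0] \<phi>2[of k], of 1 "- a"] one_\<phi>[of k]
      by (cases "k = 0") (auto simp: orth a_def)
  qed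
  then have const: "AE y in nvol M. 1 = a * \<phi> 0 y" by eventually_elim simp
  have mean: "L2_inner M f ?one = a * L2_inner M f (\<phi> 0)" if "f \<in> L2 M" for f
  proof -
    have "L2_inner M f ?one = (\<integral>y. a * (f y * \<phi> 0 y) \<partial>(nvol M))"
      unfolding L2_inner_def
      by (rule integral_cong_AE)
        (use const L2_measurable[OF that] L2_measurable[OF \<phi>2[of 0]] in \<open>auto elim!: eventually_mono simp: ac_simps\<close>)
    then show ?thesis by (simp add: L2_inner_def)
  qed
  have "a\<^sup>2 = 1"
    using mean[OF one(2)] one_one by (simp add: a_def power2_eq_square)
  then have mean2: "(L2_inner M f ?one)\<^sup>2 = (L2_inner M f (\<phi> 0))\<^sup>2" if "f \<in> L2 M" for f
    using mean[OF that] by (simp add: power_mult_distrib)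
  show ?thesis
  proof (rule that[OF \<nu>(3)])
    fix f assume f: "f \<in> H1 M"
    define c where "c k = L2_inner M f (\<phi> k)" for k
    \<comment> \<open>The analogue of Bessel's inequality for the form: \<open>f\<close> minus the partial sum has nonnegative energy.\<close>
    have E_le: "(\<Sum>k<n. \<nu> k * (c k)\<^sup>2) \<le> dirichlet_form M f f" for n
    proof -
      define S where "S = (\<lambda>y. \<Sum>k<n. c k * \<phi> k y)"
      have S: "S \<in> H1 M" unfolding S_def by (rule H1_sum[OF \<phi>])
      have ES: "dirichlet_form M S v = (\<Sum>k<n. c k * (\<nu> k * L2_inner M (\<phi> k) v))" if "v \<in> H1 M" for v
        unfolding S_def using dirichlet_form_sum[OF \<phi> that] E[OF that] by simp
      have Sf: "dirichlet_form M S f = (\<Sum>k<n. \<nu> k * (c k)\<^sup>2)"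
        unfolding ES[OF f] by (intro sum.cong) (auto simp: c_def L2_inner_commute power2_eq_square)
      have "L2_inner M S (\<phi> k) = c k" if "k < n" for k
        unfolding S_def using that by (simp add: L2_inner_sum[OF \<phi>2 \<phi>2] orth if_distrib cong: if_cong)
      then have SS: "dirichlet_form M S S = (\<Sum>k<n. \<nu> k * (c k)\<^sup>2)"
        unfolding ES[OF S] by (intro sum.cong) (auto simp: L2_inner_commute[of "\<phi> _"] power2_eq_square)
      have d: "(\<lambda>y. 1 * f y + (-1) * S y) \<in> H1 M" by (rule H1_lincomb[OF f S])
      have "dirichlet_form M (\<lambda>y. 1 * f y + (-1) * S y) (\<lambda>y. 1 * f y + (-1) * S y) =
          dirichlet_form M f f - 2 * dirichlet_form M S f + dirichlet_form M S S"
        unfolding dirichlet_form_lincomb[OF f S d]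
        using dirichlet_form_lincomb[OF f S f, of 1 "-1"] dirichlet_form_lincomb[OF f S S, of 1 "-1"]
        by (simp add: dirichlet_form_commute)
      then show ?thesis
        using dirichlet_form_nonneg[of "\<lambda>y. 1 * f y + (-1) * S y"] Sf SS by simp
    qed
    have "(\<lambda>n. \<nu> 1 * ((\<Sum>k<n. (c k)\<^sup>2) - (c 0)\<^sup>2)) \<longlonglongrightarrow> \<nu> 1 * (L2_inner M f f - (c 0)\<^sup>2)"
      using Parseval[OF \<phi>2 orth total H1_L2[OF f]] unfolding sums_def c_def by (intro tendsto_intros) auto
    moreover have "\<forall>\<^sub>F n in sequentially. \<nu> 1 * ((\<Sum>k<n. (c k)\<^sup>2) - (c 0)\<^sup>2) \<le> dirichlet_form M f f"
    proof (rule eventually_sequentiallyI[of 1])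
      fix n :: nat assume "1 \<le> n"
      then have "(\<Sum>k<n. (c k)\<^sup>2) - (c 0)\<^sup>2 = (\<Sum>k\<in>{1..<n}. (c k)\<^sup>2)"
        by (simp add: sum.atLeast_Suc_lessThan lessThan_atLeast0)
      then have "\<nu> 1 * ((\<Sum>k<n. (c k)\<^sup>2) - (c 0)\<^sup>2) = (\<Sum>k\<in>{1..<n}. \<nu> 1 * (c k)\<^sup>2)"
        by (simp add: sum_distrib_left)
      also have "\<dots> \<le> (\<Sum>k\<in>{1..<n}. \<nu> k * (c k)\<^sup>2)"
        by (intro sum_mono mult_right_mono \<nu>_ge) auto
      also have "\<dots> \<le> (\<Sum>k<n. \<nu> k * (c k)\<^sup>2)"
        by (rule sum_mono2) (use \<nu> in \<open>auto simp: incseq_def intro!: mult_nonneg_nonneg\<close>, metis \<nu>(2) zero_le)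
      also have "\<dots> \<le> dirichlet_form M f f" by (rule E_le)
      finally show "\<nu> 1 * ((\<Sum>k<n. (c k)\<^sup>2) - (c 0)\<^sup>2) \<le> dirichlet_form M f f" .
    qed
    ultimately show "\<nu> 1 * (L2_inner M f f - (L2_inner M f ?one)\<^sup>2) \<le> dirichlet_form M f f"
      unfolding mean2[OF H1_L2[OF f]] c_def by (intro tendsto_upperbound) auto
  qed
qed

end

section \<open>Capacity\<close>

context plane_domain
begin

lemma capacity_candidates_nonneg:
  "r \<in> {dirichlet_form M u u + L2_inner M u u | u. P u} \<Longrightarrow> 0 \<le> r"
  using dirichlet_form_nonneg L2_inner_nonneg by (auto intro: add_nonneg_nonneg)

lemma form_capacity_empty: "form_capacity M {} = 0"
proof (rule antisym)
  let ?S = "{dirichlet_form M u u + L2_inner M u u | u. u \<in> H1 M \<and>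
      (\<exists>G. openin (top_of_set M) G \<and> {} \<inter> M \<subseteq> G \<and> (AE y in nvol M. y \<in> G \<longrightarrow> 1 \<le> u y))}"
  have "dirichlet_form M (\<lambda>_. 0) (\<lambda>_. 0) + L2_inner M (\<lambda>_. 0) (\<lambda>_. 0) \<in> ?S"
  proof (rule CollectI, rule exI[of _ "\<lambda>_. 0"], intro conjI refl const_H1)
    show "\<exists>G. openin (top_of_set M) G \<and> {} \<inter> M \<subseteq> G \<and> (AE y in nvol M. y \<in> G \<longrightarrow> (1::real) \<le> 0)"
      by (rule exI[of _ "{}"]) simp
  qed
  moreover have "dirichlet_form M (\<lambda>_. 0) (\<lambda>_. 0) + L2_inner M (\<lambda>_. 0) (\<lambda>_. 0) = 0"
    using dirichlet_form_const[OF const_H1] by (simp add: L2_inner_def)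
  ultimately have mem: "0 \<in> ?S" by simp
  have bdd: "bdd_below ?S" by (rule bdd_belowI[of _ 0]) (rule capacity_candidates_nonneg)
  show "form_capacity M {} \<le> 0" unfolding form_capacity_def by (rule cInf_lower[OF mem bdd])
  show "0 \<le> form_capacity M {}"
    unfolding form_capacity_def by (rule cInf_greatest) (use mem in blast, rule capacity_candidates_nonneg)
qed

text \<open>A continuous function is its own quasi-continuous version, with empty exceptional sets; this
  admits the test functions of the upper bound.\<close>

lemma continuous_zero_qe:
  assumes "continuous_on UNIV f" "\<And>y. y \<in> A \<Longrightarrow> f y = 0"
  shows "zero_qe_on M A f"
  unfolding zero_qe_on_def
proof (intro exI[of _ f] conjI)
  show "quasi_continuous M f"
    unfolding quasi_continuous_def
    by (intro allI impI exI[of _ "{}"]) (use assms(1) in \<open>auto simp: form_capacity_empty intro: continuous_on_subset\<close>)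
  have "{y \<in> A. f y \<noteq> 0} = {}" using assms(2) by auto
  then show "form_capacity M {y \<in> A. f y \<noteq> 0} = 0" by (simp only: form_capacity_empty)
qed simp

text \<open>A set of capacity zero is covered by relatively open sets of arbitrarily small volume,
  because the volume of such a set is at most the squared \<open>L\<^sup>2\<close> norm of its competitor.\<close>

lemma capacity_zero_null:
  assumes "form_capacity M B = 0"
  shows "AE y in nvol M. y \<notin> B"
proof -
  interpret P: prob_space "nvol M" by (rule prob_space_nvol)
  let ?S = "{dirichlet_form M u u + L2_inner M u u | u. u \<in> H1 M \<and>
      (\<exists>G. openin (top_of_set M) G \<and> B \<inter> M \<subseteq> G \<and> (AE y in nvol M. y \<in> G \<longrightarrow> 1 \<le> u y))}"
  have "dirichlet_form M (\<lambda>_. 1) (\<lambda>_. 1) + L2_inner M (\<lambda>_. 1) (\<lambda>_. 1) \<in> ?S"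
  proof (rule CollectI, rule exI[of _ "\<lambda>_. 1"], intro conjI refl const_H1)
    show "\<exists>G. openin (top_of_set M) G \<and> B \<inter> M \<subseteq> G \<and> (AE y in nvol M. y \<in> G \<longrightarrow> (1::real) \<le> 1)"
      by (rule exI[of _ M]) simp
  qed
  then have ne: "?S \<noteq> {}" by (intro ex_in_conv[THEN iffD1] exI)
  have "\<exists>G. G \<in> sets lebesgue \<and> B \<inter> M \<subseteq> G \<and> measure (nvol M) G < 1 / real (Suc n)" for n
  proof -
    have "Inf ?S = 0" using assms unfolding form_capacity_def .
    moreover have "0 < 1 / real (Suc n)" by simp
    ultimately have "Inf ?S < 1 / real (Suc n)" by (rule ord_eq_less_trans)
    from cInf_lessD[OF ne this] obtain z where z: "z \<in> ?S" "z < 1 / real (Suc n)"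
      by (elim bexE) (rule that)
    from z(1) obtain u G where u1: "z = dirichlet_form M u u + L2_inner M u u" "u \<in> H1 M"
      and G: "openin (top_of_set M) G" "B \<inter> M \<subseteq> G" "AE y in nvol M. y \<in> G \<longrightarrow> 1 \<le> u y"
      by (elim CollectE exE conjE) (rule that)
    have u: "u \<in> H1 M" "dirichlet_form M u u + L2_inner M u u < 1 / real (Suc n)"
      using u1 z(2) by simp_all
    have "G \<in> sets lebesgue"
    proof -
      obtain T where "open T" "G = M \<inter> T" using G(1) by (auto simp: openin_open)
      then show ?thesis using M_lebesgue by auto
    qed
    moreover have "measure (nvol M) G \<le> L2_inner M u u"
    proof -
      have "measure (nvol M) G = (\<integral>y. indicator G y \<partial>(nvol M))" by simp
      also have "\<dots> \<le> (\<integral>y. u y * u y \<partial>(nvol M))"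
      proof (rule integral_mono_AE)
        show "integrable (nvol M) (indicator G :: _ \<Rightarrow> real)"
          using \<open>G \<in> sets lebesgue\<close> by (simp add: P.emeasure_eq_measure)
        show "integrable (nvol M) (\<lambda>y. u y * u y)"
          by (rule L2_mult_integrable[OF H1_L2[OF u(1)] H1_L2[OF u(1)]])
        show "AE y in nvol M. indicator G y \<le> u y * u y"
          using G(3)
        proof eventually_elim
          case (elim y)
          show ?case
          proof (cases "y \<in> G")
            case True
            then show ?thesis using elim mult_mono[of 1 "u y" 1 "u y"] by simp
          qed simp
        qed
      qed
      finally show ?thesis by (simp add: L2_inner_def)
    qed
    ultimately show ?thesis using u(2) G(2) dirichlet_form_nonneg[of u] by force
  qed
  then obtain G where G: "\<And>n. G n \<in> sets lebesgue" "\<And>n. B \<inter> M \<subseteq> G n"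
      "\<And>n. measure (nvol M) (G n) < 1 / real (Suc n)" by metis
  define N where "N = (\<Inter>n. G n)"
  have N: "N \<in> sets (nvol M)" using G(1) by (auto simp: N_def)
  have "measure (nvol M) N \<le> 1 / real (Suc n)" for n
  proof -
    have "measure (nvol M) N \<le> measure (nvol M) (G n)"
      using G(1)[of n] by (intro P.finite_measure_mono) (auto simp: N_def)
    then show ?thesis using G(3)[of n] by simp
  qed
  then have "measure (nvol M) N \<le> 0"
    by (intro tendsto_lowerbound[OF LIMSEQ_Suc[OF lim_1_over_n]]) auto
  then have "measure (nvol M) N = 0" by (simp add: antisym)
  then have "N \<in> null_sets (nvol M)" using N by (simp add: P.emeasure_eq_measure null_setsI)
  then have "AE y in nvol M. y \<notin> N" by (rule AE_not_in)
  moreover have "AE y in nvol M. y \<in> M" by (simp add: AE_nvol)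
  ultimately show ?thesis
    by eventually_elim (use G(2) in \<open>auto simp: N_def\<close>)
qed

lemma zero_qe_AE:
  assumes "zero_qe_on M A f"
  shows "AE y in nvol M. y \<in> A \<longrightarrow> f y = 0"
proof -
  obtain g where g: "AE y in nvol M. g y = f y" "form_capacity M {y \<in> A. g y \<noteq> 0} = 0"
    using assms by (auto simp: zero_qe_on_def)
  from capacity_zero_null[OF g(2)] g(1) show ?thesis by eventually_elim auto
qed

end

section \<open>Geometry near the boundary\<close>

text \<open>A function with Lipschitz derivative differs from its tangent at \<open>0\<close> by at most \<open>K t\<^sup>2\<close>, so with \<open>n\<close>
  the inner unit normal of the graph at \<open>p\<close> a parabola above the tangent line belongs to \<open>M\<close> and one
  below it contains \<open>M\<close>, both near \<open>p\<close> and of a size that does not depend on \<open>p\<close>.\<close>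

lemma tangent_parabolas:
  assumes "uniformly_C11_boundary M"
  obtains C r where "0 < C" "0 < r" "\<forall>p\<in>frontier M. \<exists>n. norm n = 1 \<and>
    (\<forall>y\<in>ball p r. (y \<in> M \<longrightarrow> - C * (norm (y - p))\<^sup>2 \<le> (y - p) \<bullet> n) \<and>
                  (C * (norm (y - p))\<^sup>2 \<le> (y - p) \<bullet> n \<longrightarrow> y \<in> M))"
proof -
  obtain r K where r: "0 < r" "0 \<le> K" and chart: "\<forall>p\<in>frontier M. \<exists>T :: real^2 \<Rightarrow> real^2. \<exists>h h' :: real \<Rightarrow> real.
        orthogonal_transformation T \<and> h 0 = 0 \<and>
        (\<forall>s. (h has_real_derivative h' s) (at s) \<and> \<bar>h' s\<bar> \<le> K) \<and>
        K-lipschitz_on UNIV h' \<and>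
        M \<inter> ball p r = (\<lambda>y. p + T y) ` {y. h (y $ 1) \<le> y $ 2} \<inter> ball p r"
    using assms unfolding uniformly_C11_boundary_def by (elim exE conjE) (rule that)
  show ?thesis
  proof (rule that[of "K + 1" r], goal_cases)
    case 3
    show ?case
    proof
    fix p assume "p \<in> frontier M"
    from bspec[OF chart this] obtain T :: "real^2 \<Rightarrow> real^2" and h h' :: "real \<Rightarrow> real"
      where T: "orthogonal_transformation T" and h0: "h 0 = 0"
      and hd: "\<forall>s. (h has_real_derivative h' s) (at s) \<and> \<bar>h' s\<bar> \<le> K" and hl: "K-lipschitz_on UNIV h'"
      and M: "M \<inter> ball p r = (\<lambda>y. p + T y) ` {y. h (y $ 1) \<le> y $ 2} \<inter> ball p r"
      by (elim exE conjE) (rule that)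
    have h: "h 0 = 0" "\<And>s. (h has_real_derivative h' s) (at s)" "K-lipschitz_on UNIV h'"
      using h0 hd hl by auto
    define b where "b = h' 0"
    have taylor: "\<bar>h t - b * t\<bar> \<le> K * t\<^sup>2" for t
    proof (cases "t = 0")
      case False
      then consider "0 < t" | "t < 0" by linarith
      then obtain s where s: "\<bar>s\<bar> \<le> \<bar>t\<bar>" "h t = t * h' s"
      proof cases
        case 1
        from MVT2[OF 1 h(2)] obtain z where "0 < z" "z < t" "h t - h 0 = (t - 0) * h' z" by blast
        then show ?thesis using that[of z] h(1) by simp
      next
        case 2
        from MVT2[OF 2 h(2)] obtain z where "t < z" "z < 0" "h 0 - h t = (0 - t) * h' z" by blast
        then show ?thesis using that[of z] h(1) by simp
      qed
      have "\<bar>h' s - b\<bar> \<le> K * \<bar>s\<bar>"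
        using lipschitz_onD[OF h(3), of s 0] by (simp add: b_def dist_real_def)
      also have "\<dots> \<le> K * \<bar>t\<bar>" using s(1) r(2) by (rule mult_left_mono)
      finally have "\<bar>t\<bar> * \<bar>h' s - b\<bar> \<le> \<bar>t\<bar> * (K * \<bar>t\<bar>)" by (rule mult_left_mono) simp
      moreover have "h t - b * t = t * (h' s - b)" using s(2) by (simp add: algebra_simps)
      ultimately show ?thesis by (simp add: abs_mult power2_eq_square mult.left_commute)
    qed (simp add: h)
    \<comment> \<open>The unit normal \<open>v\<close> of the graph at the origin; \<open>w \<ge> 1\<close> only makes the parabolas wider.\<close>
    define w where "w = sqrt (1 + b\<^sup>2)"
    have w: "1 \<le> w" by (simp add: w_def)
    define v :: "real^2" where "v = vector [- b / w, 1 / w]"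
    have "(norm v)\<^sup>2 = 1"
    proof -
      have "(norm v)\<^sup>2 = (1 + b\<^sup>2) / w\<^sup>2"
        by (simp add: norm_square_2 v_def power_divide add_divide_distrib)
      moreover have "0 < 1 + b\<^sup>2" by (simp add: add_pos_nonneg)
      ultimately show ?thesis by (simp add: w_def)
    qed
    then have v: "norm v = 1" using norm_ge_zero[of v] by (simp add: power2_eq_1_iff)
    show "\<exists>n. norm n = 1 \<and> (\<forall>y\<in>ball p r.
        (y \<in> M \<longrightarrow> - (K + 1) * (norm (y - p))\<^sup>2 \<le> (y - p) \<bullet> n) \<and>
        ((K + 1) * (norm (y - p))\<^sup>2 \<le> (y - p) \<bullet> n \<longrightarrow> y \<in> M))"
    proof (intro exI[of _ "T v"] conjI ballI)
      show "norm (T v) = 1" using T v by (simp add: orthogonal_transformation_norm)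
      fix y assume y: "y \<in> ball p r"
      obtain z where z: "y - p = T z"
        using orthogonal_transformation_surj[OF T] by (metis surjD)
      have "y \<in> M \<longleftrightarrow> y \<in> (\<lambda>y. p + T y) ` {y. h (y $ 1) \<le> y $ 2}"
        using M y by blast
      also have "\<dots> \<longleftrightarrow> h (z $ 1) \<le> z $ 2"
      proof -
        have yz: "y = p + T z" using z by (simp add: algebra_simps)
        have "z' = z" if "p + T z = p + T z'" for z'
          using that orthogonal_transformation_inj[OF T] by (simp add: inj_eq)
        then show ?thesis unfolding yz by blast
      qed
      finally have yM: "y \<in> M \<longleftrightarrow> h (z $ 1) \<le> z $ 2" .
      have nz: "norm (y - p) = norm z" using z T by (simp add: orthogonal_transformation_norm)
      have ip: "(y - p) \<bullet> T v = (z $ 2 - b * z $ 1) / w"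
      proof -
        have "(y - p) \<bullet> T v = z \<bullet> v" using z T by (simp add: orthogonal_transformation_def)
        then show ?thesis by (simp add: v_def inner_vec_def sum_2 diff_divide_distrib)
      qed
      have z1: "(z $ 1)\<^sup>2 \<le> (norm z)\<^sup>2" by (simp add: norm_square_2)
      have Kz: "K * (z $ 1)\<^sup>2 \<le> (K + 1) * (norm z)\<^sup>2"
        using r(2) z1 by (intro mult_mono) auto
      show "y \<in> M \<longrightarrow> - (K + 1) * (norm (y - p))\<^sup>2 \<le> (y - p) \<bullet> T v"
      proof
        assume "y \<in> M"
        then have "b * z $ 1 - K * (z $ 1)\<^sup>2 \<le> z $ 2" using yM taylor[of "z $ 1"] by linarith
        then have "- ((K + 1) * (norm z)\<^sup>2) \<le> z $ 2 - b * z $ 1" using Kz by linarith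
        moreover have "- ((K + 1) * (norm z)\<^sup>2) * w \<le> - ((K + 1) * (norm z)\<^sup>2) * 1"
          using w r(2) by (intro mult_left_mono_neg) auto
        ultimately have "- ((K + 1) * (norm z)\<^sup>2) * w \<le> z $ 2 - b * z $ 1" by linarith
        then show "- (K + 1) * (norm (y - p))\<^sup>2 \<le> (y - p) \<bullet> T v"
          unfolding ip nz minus_mult_left[symmetric] using w
          by (subst pos_le_divide_eq) (linarith, simp only: minus_mult_left)
      qed
      show "(K + 1) * (norm (y - p))\<^sup>2 \<le> (y - p) \<bullet> T v \<longrightarrow> y \<in> M"
      proof
        assume "(K + 1) * (norm (y - p))\<^sup>2 \<le> (y - p) \<bullet> T v"
        then have "((K + 1) * (norm z)\<^sup>2) * w \<le> z $ 2 - b * z $ 1"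
          unfolding ip nz using w by (subst (asm) pos_le_divide_eq) linarith+
        moreover have "((K + 1) * (norm z)\<^sup>2) * 1 \<le> ((K + 1) * (norm z)\<^sup>2) * w"
          using w r(2) by (intro mult_left_mono) auto
        ultimately have "K * (z $ 1)\<^sup>2 \<le> z $ 2 - b * z $ 1" using Kz by linarith
        then show "y \<in> M" unfolding yM using taylor[of "z $ 1"] by linarith
      qed
    qed
    qed
  qed (use r in auto)
qed

lemma unit_vector_angle:
  assumes "norm n = 1" obtains \<tau> where "n = pol 0 \<tau>"
  using pol_exists[of n 0] assms by (metis add_0 diff_zero ln_one norm_zero zero_neq_one)

lemma inner_pol: "pol s t \<bullet> pol 0 \<tau> = exp s * cos (t - \<tau>)"
  by (simp add: inner_vec_def sum_2 cos_diff algebra_simps)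

context plane_domain
begin

lemma frontier_nonempty: "frontier M \<noteq> {}"
proof -
  have "M \<noteq> {}" using interior_M interior_subset by blast
  moreover have "M \<noteq> UNIV" using compact_M not_compact_UNIV[where 'a = "real^2"] by auto
  ultimately show ?thesis by (rule frontier_not_empty)
qed

lemma nearest_boundary_point:
  obtains p where "p \<in> frontier M" "norm (x - p) = infdist x (frontier M)"
  using infdist_attains_inf[OF frontier_closed frontier_nonempty, of x] by (metis dist_norm)

lemma ball_interior: "x \<in> M \<Longrightarrow> ball x (infdist x (frontier M)) \<subseteq> interior M"
proof (rule ccontr)
  assume x: "x \<in> M" and n: "\<not> ball x (infdist x (frontier M)) \<subseteq> interior M"
  let ?B = "ball x (infdist x (frontier M))"
  obtain y where y: "y \<in> ?B" "y \<notin> interior M" using n by blast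
  have d: "?B \<inter> frontier M = {}"
    using infdist_le[of _ "frontier M" x] by (force simp: dist_commute)
  have "y \<notin> M" using d y compact_imp_closed[OF compact_M] by (auto simp: frontier_def)
  moreover have "x \<in> ?B" using y by (auto simp: dist_commute) (metis le_less_trans zero_le_dist)
  ultimately have "?B \<inter> frontier M \<noteq> {}"
    using x y(1) by (intro connected_Int_frontier[OF connected_ball]) blast+
  with d show False by blast
qed

text \<open>Let \<open>p\<close> be the boundary point nearest to \<open>x\<close>. A step of length \<open>\<rho>\<close> from \<open>x\<close> in a direction whose
  cosine with the inner normal at \<open>p\<close> is at least \<open>\<gamma>\<close> gains the height \<open>\<gamma> \<rho>\<close> over the tangent line at
  \<open>p\<close>. If \<open>\<rho>\<close> is not small compared to the distance of \<open>x\<close> from \<open>p\<close>, then both parabolas at \<open>p\<close> are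
  within \<open>O(\<rho>\<^sup>2)\<close> of the tangent line, and the gain wins for small \<open>\<rho>\<close>.\<close>

lemma sector_in_interior:
  assumes "uniformly_C11_boundary M" "0 < \<beta>" "0 < \<gamma>"
  obtains R where "0 < R" "\<And>x. x \<in> M \<Longrightarrow> \<exists>\<tau>. \<forall>s t. \<beta> * infdist x (frontier M) \<le> exp s \<and>
    exp s \<le> R \<and> \<gamma> \<le> cos (t - \<tau>) \<longrightarrow> x + pol s t \<in> interior M"
proof -
  obtain C r where C: "0 < C" "0 < r" and par: "\<forall>p\<in>frontier M. \<exists>n. norm n = 1 \<and>
    (\<forall>y\<in>ball p r. (y \<in> M \<longrightarrow> - C * (norm (y - p))\<^sup>2 \<le> (y - p) \<bullet> n) \<and>
                  (C * (norm (y - p))\<^sup>2 \<le> (y - p) \<bullet> n \<longrightarrow> y \<in> M))"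
    by (rule tangent_parabolas[OF assms(1)])
  \<comment> \<open>The distances of \<open>x\<close> and of the end point from \<open>p\<close> are both at most \<open>a\<close> times the length of the step.\<close>
  define a where "a = 1 + 1 / \<beta>"
  have a: "1 < a" using assms(2) by (simp add: a_def)
  define R where "R = min (r / (2 * a)) (\<gamma> / (4 * C * a\<^sup>2))"
  show ?thesis
  proof (rule that[of R])
    show "0 < R" using C a assms by (simp add: R_def)
    fix x assume x: "x \<in> M"
    obtain p where p: "p \<in> frontier M" "norm (x - p) = infdist x (frontier M)"
      by (rule nearest_boundary_point)
    obtain n where n: "norm n = 1" and in_M: "\<And>y. y \<in> ball p r \<Longrightarrow> y \<in> M \<Longrightarrow> - C * (norm (y - p))\<^sup>2 \<le> (y - p) \<bullet> n"
      "\<And>y. y \<in> ball p r \<Longrightarrow> C * (norm (y - p))\<^sup>2 \<le> (y - p) \<bullet> n \<Longrightarrow> y \<in> M"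
      using bspec[OF par p(1)] by blast
    obtain \<tau> where \<tau>: "n = pol 0 \<tau>" by (rule unit_vector_angle[OF n])
    show "\<exists>\<tau>. \<forall>s t. \<beta> * infdist x (frontier M) \<le> exp s \<and> exp s \<le> R \<and> \<gamma> \<le> cos (t - \<tau>) \<longrightarrow>
        x + pol s t \<in> interior M"
    proof (intro exI[of _ \<tau>] allI impI)
      fix s t assume st: "\<beta> * infdist x (frontier M) \<le> exp s \<and> exp s \<le> R \<and> \<gamma> \<le> cos (t - \<tau>)"
      define \<rho> where "\<rho> = exp s"
      define y where "y = x + pol s t"
      have \<rho>: "0 < \<rho>" "\<rho> * a * 2 \<le> r" "4 * C * a\<^sup>2 * \<rho> \<le> \<gamma>"
        using st C a by (simp_all add: \<rho>_def R_def field_simps)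
      have a\<rho>: "a * \<rho> < r"
      proof -
        have "0 < a * \<rho>" using \<rho>(1) a by simp
        then show ?thesis using \<rho>(2) by (simp add: mult.commute)
      qed
      have xp: "norm (x - p) \<le> \<rho> / \<beta>"
        using st assms(2) p(2) by (simp add: \<rho>_def field_simps)
      have "norm (y - p) \<le> norm (pol s t) + norm (x - p)"
        using norm_triangle_ineq[of "pol s t" "x - p"] by (simp add: y_def algebra_simps)
      then have yp: "norm (y - p) \<le> a * \<rho>"
        using xp by (simp add: \<rho>_def a_def algebra_simps)
      then have y_ball: "y \<in> ball p r" using a\<rho> by (simp add: dist_norm norm_minus_commute)
      have xp': "norm (x - p) \<le> a * \<rho>"
      proof -
        have "\<rho> / \<beta> \<le> a * \<rho>" using \<rho>(1) by (simp add: a_def algebra_simps)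
        then show ?thesis using xp by linarith
      qed
      then have x_ball: "x \<in> ball p r" using a\<rho> by (simp add: dist_norm norm_minus_commute)
      have sq: "C * (norm (y - p))\<^sup>2 \<le> C * (a * \<rho>)\<^sup>2" "C * (norm (x - p))\<^sup>2 \<le> C * (a * \<rho>)\<^sup>2"
        by (rule mult_left_mono[OF power_mono[OF yp norm_ge_zero]]
            mult_left_mono[OF power_mono[OF xp' norm_ge_zero]], use C in simp)+
      have "(y - p) \<bullet> n = pol s t \<bullet> n + (x - p) \<bullet> n"
        unfolding y_def inner_add_left[symmetric] by (rule arg_cong2[where f = inner]) simp_all
      moreover have "pol s t \<bullet> n \<ge> \<rho> * \<gamma>"
        using st unfolding \<tau> inner_pol \<rho>_def by (intro mult_left_mono) auto
      moreover have "(x - p) \<bullet> n \<ge> - C * (norm (x - p))\<^sup>2" by (rule in_M(1)[OF x_ball x])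
      moreover have "2 * (C * (a * \<rho>)\<^sup>2) < \<rho> * \<gamma>"
      proof -
        have "2 * (C * (a * \<rho>)\<^sup>2) < 4 * (C * (a * \<rho>)\<^sup>2)" using C a \<rho> by simp
        also have "\<dots> = \<rho> * (4 * C * a\<^sup>2 * \<rho>)" by (simp add: power2_eq_square algebra_simps)
        also have "\<dots> \<le> \<rho> * \<gamma>" using \<rho> by (intro mult_left_mono) auto
        finally show ?thesis .
      qed
      ultimately have strict: "C * (norm (y - p))\<^sup>2 < (y - p) \<bullet> n" using sq by simp
      let ?O = "ball p r \<inter> {y. C * (norm (y - p))\<^sup>2 < (y - p) \<bullet> n}"
      have "open ?O" by (intro open_Int open_ball open_Collect_less continuous_intros)
      moreover have "?O \<subseteq> M" using in_M(2) by auto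
      ultimately have "y \<in> interior M" using strict y_ball by (intro interiorI[of ?O]) auto
      then show "x + pol s t \<in> interior M" by (simp add: y_def)
    qed
  qed
qed

text \<open>The counterpart from outside: a point of \<open>M\<close> lies above the lower parabola at \<open>p\<close>, and the height of
  \<open>x\<close> is at most its distance from \<open>p\<close>, which is a small multiple of the step if the step is \<open>k\<close>
  times longer.\<close>

lemma domain_in_halfplane:
  assumes "uniformly_C11_boundary M" "0 < \<gamma>" "\<gamma> \<le> 1"
  obtains R k where "0 < R" "1 \<le> k" "\<And>x. x \<in> M \<Longrightarrow> \<exists>\<tau>. \<forall>s t. k * infdist x (frontier M) \<le> exp s \<and>
    exp s \<le> R \<and> x + pol s t \<in> M \<longrightarrow> - \<gamma> \<le> cos (t - \<tau>)"
proof -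
  obtain C r where C: "0 < C" "0 < r" and par: "\<forall>p\<in>frontier M. \<exists>n. norm n = 1 \<and>
    (\<forall>y\<in>ball p r. (y \<in> M \<longrightarrow> - C * (norm (y - p))\<^sup>2 \<le> (y - p) \<bullet> n) \<and>
                  (C * (norm (y - p))\<^sup>2 \<le> (y - p) \<bullet> n \<longrightarrow> y \<in> M))"
    by (rule tangent_parabolas[OF assms(1)])
  define R where "R = min (r / 4) (\<gamma> / (8 * C))"
  define k where "k = 2 / \<gamma>"
  show ?thesis
  proof (rule that[of R k])
    show "0 < R" "1 \<le> k" using C assms by (simp_all add: R_def k_def)
    fix x assume x: "x \<in> M"
    obtain p where p: "p \<in> frontier M" "norm (x - p) = infdist x (frontier M)"
      by (rule nearest_boundary_point)
    obtain n where n: "norm n = 1" and in_M: "\<And>y. y \<in> ball p r \<Longrightarrow> y \<in> M \<Longrightarrow> - C * (norm (y - p))\<^sup>2 \<le> (y - p) \<bullet> n"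
      using bspec[OF par p(1)] by blast
    obtain \<tau> where \<tau>: "n = pol 0 \<tau>" by (rule unit_vector_angle[OF n])
    show "\<exists>\<tau>. \<forall>s t. k * infdist x (frontier M) \<le> exp s \<and> exp s \<le> R \<and> x + pol s t \<in> M \<longrightarrow>
        - \<gamma> \<le> cos (t - \<tau>)"
    proof (intro exI[of _ \<tau>] allI impI)
      fix s t assume st: "k * infdist x (frontier M) \<le> exp s \<and> exp s \<le> R \<and> x + pol s t \<in> M"
      define \<rho> where "\<rho> = exp s"
      define y where "y = x + pol s t"
      have \<rho>: "0 < \<rho>" "\<rho> * 4 \<le> r" "8 * C * \<rho> \<le> \<gamma>"
        using st C by (simp_all add: \<rho>_def R_def field_simps)
      have xp: "norm (x - p) \<le> \<rho> * \<gamma> / 2"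
        using st assms(2) p(2) by (simp add: \<rho>_def k_def field_simps)
      then have xp': "norm (x - p) \<le> \<rho>" using assms(3) \<rho>(1) mult_left_le[of \<gamma> \<rho>] by linarith
      have "norm (y - p) \<le> norm (pol s t) + norm (x - p)"
        using norm_triangle_ineq[of "pol s t" "x - p"] by (simp add: y_def algebra_simps)
      then have yp: "norm (y - p) \<le> 2 * \<rho>" using xp' by (simp add: \<rho>_def)
      then have y_ball: "y \<in> ball p r" using \<rho> by (simp add: dist_norm norm_minus_commute)
      have "- C * (norm (y - p))\<^sup>2 \<le> (y - p) \<bullet> n" using in_M[OF y_ball] st by (simp add: y_def)
      moreover have "C * (norm (y - p))\<^sup>2 \<le> C * (2 * \<rho>)\<^sup>2"
        using yp C by (intro mult_left_mono power_mono) auto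
      moreover have "C * (2 * \<rho>)\<^sup>2 \<le> \<rho> * \<gamma> / 2"
      proof -
        have "C * (2 * \<rho>)\<^sup>2 = \<rho> * (8 * C * \<rho>) / 2" by (simp add: power2_eq_square)
        also have "\<dots> \<le> \<rho> * \<gamma> / 2" using \<rho> by (intro divide_right_mono mult_left_mono) auto
        finally show ?thesis .
      qed
      moreover have "(x - p) \<bullet> n \<le> norm (x - p)"
        using Cauchy_Schwarz_ineq2[of "x - p" n] n by simp
      moreover have "(y - p) \<bullet> n = pol s t \<bullet> n + (x - p) \<bullet> n"
        unfolding y_def inner_add_left[symmetric] by (rule arg_cong2[where f = inner]) simp_all
      ultimately have "- (\<rho> * \<gamma>) \<le> pol s t \<bullet> n" using xp by linarith
      then have "\<rho> * (- \<gamma>) \<le> \<rho> * cos (t - \<tau>)" unfolding \<tau> inner_pol \<rho>_def by simp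
      then show "- \<gamma> \<le> cos (t - \<tau>)" using \<rho>(1) by (simp only: mult_le_cancel_left_pos)
    qed
  qed
qed

end

section \<open>Intrinsic balls\<close>

lemma intrinsic_dist_ge:
  "ennreal (dist x y) \<le> intrinsic_dist M x y"
  unfolding intrinsic_dist_def
proof (rule INF_greatest)
  fix \<gamma> assume "\<gamma> \<in> {\<gamma>. path \<gamma> \<and> path_image \<gamma> \<subseteq> M \<and> pathstart \<gamma> = x \<and> pathfinish \<gamma> = y \<and> curve_length \<gamma> < \<infinity>}"
  then have "\<gamma> 0 = x" "\<gamma> 1 = y" by (auto simp: pathstart_def pathfinish_def)
  then have "ennreal (dist x y) = (\<Sum>i<1. ennreal (dist (\<gamma> (real i)) (\<gamma> (real (Suc i)))))" by simp
  also have "\<dots> \<le> curve_length \<gamma>"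
    unfolding curve_length_def
    by (rule SUP_upper2[where i = "(1, real)"]) (auto simp: mono_on_def)
  finally show "ennreal (dist x y) \<le> curve_length \<gamma>" .
qed

lemma intrinsic_ball_subset: "intrinsic_ball M x \<epsilon> \<subseteq> M \<inter> ball x \<epsilon>"
proof
  fix y assume "y \<in> intrinsic_ball M x \<epsilon>"
  then have y: "y \<in> M" "intrinsic_dist M x y < ennreal \<epsilon>" by (auto simp: intrinsic_ball_def)
  then have "ennreal (dist x y) < ennreal \<epsilon>" using intrinsic_dist_ge le_less_trans by blast
  then show "y \<in> M \<inter> ball x \<epsilon>" using y by (simp add: ennreal_less_iff)
qed

lemma ball_subset_intrinsic_ball:
  assumes "intrinsic_euclidean_comparable M"
  obtains c \<rho> where "1 \<le> c" "0 < \<rho>" "\<And>x \<epsilon>. x \<in> M \<Longrightarrow> 0 < \<epsilon> \<Longrightarrow> \<epsilon> < \<rho> \<Longrightarrow> M \<inter> ball x (\<epsilon> / c) \<subseteq> intrinsic_ball M x \<epsilon>"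
proof -
  obtain c \<rho> where c: "1 \<le> c" "0 < \<rho>" "\<And>x y. x \<in> M \<Longrightarrow> y \<in> M \<Longrightarrow> dist x y < \<rho> \<Longrightarrow> intrinsic_dist M x y \<le> ennreal (c * dist x y)"
    using assms unfolding intrinsic_euclidean_comparable_def by metis
  show ?thesis
  proof (rule that[OF c(1,2)], rule subsetI)
    fix x \<epsilon> y assume x: "x \<in> M" and \<epsilon>: "0 < \<epsilon>" "\<epsilon> < \<rho>" and y: "y \<in> M \<inter> ball x (\<epsilon> / c)"
    have lt: "c * dist x y < \<epsilon>" using y c(1) by (simp add: field_simps)
    have "dist x y \<le> c * dist x y" using c(1) mult_right_mono[of 1 c "dist x y"] by simp
    then have "intrinsic_dist M x y \<le> ennreal (c * dist x y)" using lt \<epsilon> x y by (intro c(3)) auto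
    also have "\<dots> < ennreal \<epsilon>" using lt \<epsilon> by (simp add: ennreal_lessI)
    finally show "y \<in> intrinsic_ball M x \<epsilon>" using y by (simp add: intrinsic_ball_def)
  qed
qed

section \<open>Cutoffs in the radius and in the angle\<close>

lemma flat_mono: "s \<le> t \<Longrightarrow> flat s \<le> flat t"
proof -
  assume st: "s \<le> t"
  show ?thesis
  proof (cases "0 < s")
    case True
    then have "1 / t \<le> 1 / s" using st by (intro divide_left_mono) auto
    then show ?thesis using True st by (simp add: flat_def flat_poly_def)
  qed (simp add: flat_nonpos flat_nonneg)
qed

lemma smooth_step_mono: "s \<le> t \<Longrightarrow> smooth_step s \<le> smooth_step t"
proof -
  assume st: "s \<le> t"
  have "flat s * flat (1 - t) \<le> flat t * flat (1 - s)"
    using st by (intro mult_mono flat_mono flat_nonneg) auto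
  then show ?thesis
    using flat_denominator_pos[of s] flat_denominator_pos[of t]
    unfolding smooth_step_def by (simp add: divide_le_eq le_divide_eq field_simps)
qed

lemma deriv_smooth_step_nonneg: "0 \<le> deriv smooth_step t"
  by (rule mono_on_imp_deriv_nonneg[OF _ smooth_has_derivative[OF smooth_smooth_step], where A = UNIV])
    (auto simp: mono_on_def intro: smooth_step_mono)

definition step_slope :: real where
  "step_slope = (SOME B. \<forall>t. deriv smooth_step t \<le> B)"

lemma deriv_smooth_step_le: "deriv smooth_step t \<le> step_slope"
proof -
  have "compact (deriv smooth_step ` {0..1})"
    by (intro compact_continuous_image smooth_continuous_on smooth_deriv smooth_smooth_step) simp
  from compact_imp_bounded[OF this] obtain B where B: "\<And>t. t \<in> {0..1} \<Longrightarrow> \<bar>deriv smooth_step t\<bar> \<le> B"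
    unfolding bounded_real by blast
  have "deriv smooth_step t \<le> B" for t
  proof (cases "t \<in> {0..1}")
    case False
    then have "deriv smooth_step t = 0" by (intro deriv_smooth_step_0) auto
    then show ?thesis using B[of 0] by simp
  qed (use B[of t] in simp)
  then have "\<forall>t. deriv smooth_step t \<le> step_slope"
    unfolding step_slope_def by (intro someI[of "\<lambda>B. \<forall>t. deriv smooth_step t \<le> B" B]) blast
  then show ?thesis by blast
qed

lemma step_slope_nonneg: "0 \<le> step_slope"
  using deriv_smooth_step_le deriv_smooth_step_nonneg order_trans by blast

lemma nn_integral_deriv_smooth_step:
  "(\<integral>\<^sup>+ s. ennreal (deriv smooth_step (s - a)) \<partial>lborel) = 1"
proof -
  have "(\<integral>\<^sup>+ s. ennreal (deriv smooth_step (s - a)) * indicator {a..a + 1} s \<partial>lborel) =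
      ennreal (smooth_step (a + 1 - a) - smooth_step (a - a))"
  proof (rule nn_integral_FTC_Icc)
    show "(\<lambda>s. deriv smooth_step (s - a)) \<in> borel_measurable borel"
      by (intro borel_measurable_continuous_onI smooth_continuous_on smooth_shift smooth_deriv smooth_smooth_step)
    show "((\<lambda>s. smooth_step (s - a)) has_real_derivative deriv smooth_step (s - a)) (at s)" for s
      using DERIV_shift[of smooth_step "deriv smooth_step (s - a)" s "- a"]
        smooth_has_derivative[OF smooth_smooth_step, of "s - a"] by simp
  qed (auto simp: deriv_smooth_step_nonneg)
  moreover have "(\<integral>\<^sup>+ s. ennreal (deriv smooth_step (s - a)) * indicator {a..a + 1} s \<partial>lborel) =
      (\<integral>\<^sup>+ s. ennreal (deriv smooth_step (s - a)) \<partial>lborel)"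
    by (intro nn_integral_cong) (auto split: split_indicator simp: deriv_smooth_step_0)
  ultimately show ?thesis by (simp add: smooth_step_0 smooth_step_1)
qed

text \<open>The angular profile of the flux: a smooth version of the indicator of the angles whose
  cosine exceeds \<open>\<gamma>\<close>.\<close>

definition profile :: "real \<Rightarrow> real \<Rightarrow> real" where
  "profile \<gamma> t = smooth_step ((cos t - \<gamma>) / \<gamma>)"

lemma continuous_antiderivative:
  fixes g :: "real \<Rightarrow> real"
  assumes "continuous_on UNIV g"
  obtains F where "\<And>t. (F has_real_derivative g t) (at t)"
proof -
  have "\<exists>F. \<forall>t. -\<infinity> < ereal t \<longrightarrow> ereal t < \<infinity> \<longrightarrow> (F has_vector_derivative g t) (at t)"
    by (rule einterval_antiderivative) (use assms in \<open>auto simp: continuous_on_eq_continuous_at\<close>)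
  then show ?thesis using that by (auto simp: has_real_derivative_iff_has_vector_derivative)
qed

locale angular_cutoff =
  fixes \<gamma> :: real
  assumes \<gamma>: "0 < \<gamma>" "2 * \<gamma> < 1"
begin

lemma smooth_profile: "smooth (profile \<gamma>)"
proof -
  have "smooth (\<lambda>t. (1 / \<gamma>) * (cos t - \<gamma>))" by (intro smooth_intros)
  then show ?thesis
    using smooth_compose[OF smooth_smooth_step] by (simp add: profile_def[abs_def])
qed

lemma profile_bounds: "0 \<le> profile \<gamma> t" "profile \<gamma> t \<le> 1"
  by (simp_all add: profile_def smooth_step_nonneg smooth_step_le_1)

lemma profile_0: "cos t \<le> \<gamma> \<Longrightarrow> profile \<gamma> t = 0"
  using \<gamma> by (simp add: profile_def smooth_step_0 divide_le_0_iff)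

lemma profile_1: "2 * \<gamma> \<le> cos t \<Longrightarrow> profile \<gamma> t = 1"
  using \<gamma> by (simp add: profile_def smooth_step_1 le_divide_eq)

lemma profile_nonzero:
  assumes "profile \<gamma> t \<noteq> 0" shows "\<gamma> \<le> cos t" and "\<bar>t\<bar> < pi \<Longrightarrow> \<bar>t\<bar> \<le> arccos \<gamma>"
proof -
  show c: "\<gamma> \<le> cos t" using assms profile_0 by force
  assume t: "\<bar>t\<bar> < pi"
  show "\<bar>t\<bar> \<le> arccos \<gamma>"
  proof (rule ccontr)
    assume "\<not> \<bar>t\<bar> \<le> arccos \<gamma>"
    then have "cos \<bar>t\<bar> < cos (arccos \<gamma>)"
      using t \<gamma> arccos_lbound[of \<gamma>] by (intro cos_monotone_0_pi) auto
    then show False using c \<gamma> by (simp add: cos_abs_real)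
  qed
qed

definition primitive :: "real \<Rightarrow> real" where
  "primitive = (SOME F. \<forall>t. (F has_real_derivative profile \<gamma> t) (at t))"

lemma primitive: "(primitive has_real_derivative profile \<gamma> t) (at t)"
proof -
  obtain F where "\<And>t. (F has_real_derivative profile \<gamma> t) (at t)"
    using continuous_antiderivative[OF smooth_continuous_on[OF smooth_profile]] by metis
  then have "\<forall>t. (primitive has_real_derivative profile \<gamma> t) (at t)"
    unfolding primitive_def by (intro someI[of "\<lambda>F. \<forall>t. (F has_real_derivative profile \<gamma> t) (at t)" F]) blast
  then show ?thesis by blast
qed

definition mass :: real where "mass = primitive pi - primitive (- pi)"

lemma mass_ge: "2 * arccos (2 * \<gamma>) \<le> mass"
proof -
  define a where "a = arccos (2 * \<gamma>)"
  have a: "0 < a" "a \<le> pi" using \<gamma> by (auto simp: a_def arccos_lt_bounded arccos_ubound)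
  have mono: "primitive s \<le> primitive t" if "s \<le> t" for s t
    by (rule DERIV_nonneg_imp_nondecreasing[OF that]) (use primitive profile_bounds in blast)
  have "primitive a - a = primitive (- a) - (- a)"
  proof (rule DERIV_isconst2[of "- a" a "\<lambda>t. primitive t - t"])
    show "- a < a" "- a \<le> a" "a \<le> a" using a by auto
    show "continuous_on {- a..a} (\<lambda>t. primitive t - t)"
      by (intro continuous_intros DERIV_continuous_on[OF has_field_derivative_at_within[OF primitive]])
    fix t assume t: "- a < t" "t < a"
    have "cos a \<le> cos \<bar>t\<bar>" using t a by (intro cos_monotone_0_pi_le) auto
    then have "profile \<gamma> t = 1" using \<gamma> by (intro profile_1) (simp add: a_def cos_abs_real)
    then show "((\<lambda>t. primitive t - t) has_real_derivative 0) (at t)"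
      using DERIV_diff[OF primitive[of t] DERIV_ident] by simp
  qed
  moreover have "primitive a \<le> primitive pi" "primitive (- pi) \<le> primitive (- a)" using mono a by auto
  ultimately show ?thesis unfolding mass_def a_def[symmetric] by linarith
qed

lemma mass_pos: "0 < mass"
  using mass_ge arccos_lt_bounded[of "2 * \<gamma>"] \<gamma> by force

lemma primitive_shift: "primitive (t + 2 * pi) = primitive t + mass"
proof -
  have "((\<lambda>t. primitive (t + 2 * pi) - primitive t) has_real_derivative 0) (at t)" for t
  proof -
    have "((\<lambda>t. primitive (t + 2 * pi)) has_real_derivative profile \<gamma> (t + 2 * pi)) (at t)"
      by (rule DERIV_shift[THEN iffD1, OF primitive])
    then have "((\<lambda>t. primitive (t + 2 * pi)) has_real_derivative profile \<gamma> t) (at t)"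
      by (simp add: profile_def)
    from DERIV_diff[OF this primitive] show ?thesis by simp
  qed
  from DERIV_isconst_all[OF allI[OF this], of t "- pi"] show ?thesis by (simp add: mass_def)
qed

text \<open>The derivative of \<open>stream \<tau>\<close> is the uniform density on the circle minus \<open>angular_density \<tau>\<close>; it is
  periodic because both densities have integral \<open>1\<close> over a period. As the angular component of a
  field it therefore turns one density into the other.\<close>

definition angular_density :: "real \<Rightarrow> real \<Rightarrow> real" where
  "angular_density \<tau> t = profile \<gamma> (t - \<tau>) / mass"

definition stream :: "real \<Rightarrow> real \<Rightarrow> real" where
  "stream \<tau> t = (t - \<tau>) / (2 * pi) - (primitive (t - \<tau>) - primitive 0) / mass"

lemma smooth_density: "smooth (angular_density \<tau>)"
proof -
  have "smooth (\<lambda>t. (1 / mass) * profile \<gamma> (t - \<tau>))"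
    by (intro smooth_intros smooth_shift smooth_profile)
  then show ?thesis by (simp add: angular_density_def[abs_def])
qed

lemma periodic_density: "periodic (angular_density \<tau>)"
  using periodic_compose_cos[of "\<lambda>c. smooth_step ((c - \<gamma>) / \<gamma>) / mass" \<tau>]
  by (simp add: angular_density_def[abs_def] profile_def)

lemma stream_has_derivative: "(stream \<tau> has_real_derivative 1 / (2 * pi) - angular_density \<tau> t) (at t)"
proof -
  have p: "((\<lambda>t. primitive (t - \<tau>)) has_real_derivative profile \<gamma> (t - \<tau>)) (at t)"
    using DERIV_shift[of primitive "profile \<gamma> (t - \<tau>)" t "- \<tau>"] primitive[of "t - \<tau>"] by simp
  show ?thesis
    unfolding stream_def[abs_def] angular_density_def
    using mass_pos by (auto intro!: derivative_eq_intros p simp: field_simps)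
qed

lemma deriv_stream: "deriv (stream \<tau>) = (\<lambda>t. 1 / (2 * pi) - angular_density \<tau> t)"
  using DERIV_imp_deriv[OF stream_has_derivative] by auto

lemma smooth_stream: "smooth (stream \<tau>)"
  by (rule smooth_antiderivative[OF stream_has_derivative]) (intro smooth_intros smooth_density)

lemma periodic_stream: "periodic (stream \<tau>)"
  unfolding periodic_def
proof
  fix t
  have "primitive (t + 2 * pi - \<tau>) = primitive (t - \<tau>) + mass"
    using primitive_shift[of "t - \<tau>"] by (simp add: algebra_simps)
  then show "stream \<tau> (t + 2 * pi) = stream \<tau> t"
    using mass_pos by (simp add: stream_def field_simps)
qed

lemma density_bounds: "0 \<le> angular_density \<tau> t" "angular_density \<tau> t \<le> 1 / mass"
  using profile_bounds[of "t - \<tau>"] mass_pos by (auto simp: angular_density_def divide_right_mono)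

lemma density_nonzero:
  assumes "angular_density \<tau> t \<noteq> 0" shows "\<gamma> \<le> cos (t - \<tau>)" and "\<bar>t - \<tau>\<bar> < pi \<Longrightarrow> \<bar>t - \<tau>\<bar> \<le> arccos \<gamma>"
  using assms profile_nonzero[of "t - \<tau>"] by (auto simp: angular_density_def)

lemma stream_bound:
  assumes "\<bar>t - \<tau>\<bar> < pi" shows "\<bar>stream \<tau> t\<bar> \<le> 1 / 2 + pi / mass"
proof -
  have "\<bar>primitive (t - \<tau>) - primitive 0\<bar> \<le> 1 * \<bar>t - \<tau> - 0\<bar>"
    using field_differentiable_bound[of UNIV primitive "profile \<gamma>" 1 "t - \<tau>" 0] primitive profile_bounds
    by (auto intro: has_field_derivative_at_within)
  then have "\<bar>primitive (t - \<tau>) - primitive 0\<bar> \<le> pi" using assms by simp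
  then have "\<bar>(primitive (t - \<tau>) - primitive 0) / mass\<bar> \<le> pi / mass"
    using mass_pos by (simp add: abs_divide divide_right_mono)
  moreover have "\<bar>(t - \<tau>) / (2 * pi)\<bar> \<le> 1 / 2" using assms by (simp add: abs_divide)
  ultimately show ?thesis unfolding stream_def by linarith
qed

lemma nn_integral_density:
  "(\<integral>\<^sup>+ t. ennreal (angular_density \<tau> t) * indicator {\<tau> - pi<..<\<tau> + pi} t \<partial>lborel) = 1"
proof -
  have "(\<integral>\<^sup>+ t. ennreal (angular_density \<tau> t) * indicator {\<tau> - pi..\<tau> + pi} t \<partial>lborel) =
      ennreal (primitive (\<tau> + pi - \<tau>) / mass - primitive (\<tau> - pi - \<tau>) / mass)"
  proof (rule nn_integral_FTC_Icc)
    show "angular_density \<tau> \<in> borel_measurable borel"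
      by (intro borel_measurable_continuous_onI smooth_continuous_on smooth_density)
    fix t
    have p: "((\<lambda>t. primitive (t - \<tau>)) has_real_derivative profile \<gamma> (t - \<tau>)) (at t)"
      using DERIV_shift[of primitive "profile \<gamma> (t - \<tau>)" t "- \<tau>"] primitive[of "t - \<tau>"] by simp
    show "((\<lambda>t. primitive (t - \<tau>) / mass) has_real_derivative angular_density \<tau> t) (at t)"
      unfolding angular_density_def by (rule DERIV_cdivide[OF p])
  qed (auto simp: density_bounds)
  also have "primitive (\<tau> + pi - \<tau>) / mass - primitive (\<tau> - pi - \<tau>) / mass = 1"
    using mass_pos by (simp add: mass_def flip: diff_divide_distrib)
  also have "(\<integral>\<^sup>+ t. ennreal (angular_density \<tau> t) * indicator {\<tau> - pi..\<tau> + pi} t \<partial>lborel) =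
      (\<integral>\<^sup>+ t. ennreal (angular_density \<tau> t) * indicator {\<tau> - pi<..<\<tau> + pi} t \<partial>lborel)"
    by (rule nn_integral_cong_AE, use AE_lborel_singleton[of "\<tau> - pi"] AE_lborel_singleton[of "\<tau> + pi"] in eventually_elim)
      (auto split: split_indicator)
  finally show ?thesis by simp
qed

end

section \<open>The flux inequality\<close>

lemma test_functions_add:
  assumes "f \<in> test_functions U" "g \<in> test_functions U"
  shows "(\<lambda>y. f y + g y) \<in> test_functions U"
proof (rule test_functionsI)
  let ?K = "closure {y. f y \<noteq> 0} \<union> closure {y. g y \<noteq> 0}"
  show "(\<lambda>y. f y + g y) \<in> C_k k" for k
    using assms by (intro C_k_add) (auto simp: test_functions_def)
  show "compact ?K" "?K \<subseteq> U" using assms by (auto simp: test_functions_def)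
  fix y assume "y \<notin> ?K"
  then have "y \<notin> {y. f y \<noteq> 0}" "y \<notin> {y. g y \<noteq> 0}"
    using closure_subset[of "{y. f y \<noteq> 0}"] closure_subset[of "{y. g y \<noteq> 0}"] by blast+
  then show "f y + g y = 0" by simp
qed

context plane_domain
begin

definition test_field :: "(real^2 \<Rightarrow> real^2) \<Rightarrow> bool" where
  "test_field V \<longleftrightarrow> (\<forall>i. (\<lambda>y. V y $ i) \<in> test_functions (interior M))"

lemma test_field_add: "test_field V \<Longrightarrow> test_field W \<Longrightarrow> test_field (\<lambda>y. V y + W y)"
  using test_functions_add by (simp add: test_field_def)

lemma divergence_add:
  assumes "test_field V" "test_field W"
  shows "divergence (\<lambda>y. V y + W y) y = divergence V y + divergence W y"
proof -
  have "frechet_derivative (\<lambda>y. V y $ i + W y $ i) (at y) (axis i 1) =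
      frechet_derivative (\<lambda>y. V y $ i) (at y) (axis i 1) + frechet_derivative (\<lambda>y. W y $ i) (at y) (axis i 1)" for i
  proof -
    have "((\<lambda>y. V y $ i) has_derivative frechet_derivative (\<lambda>y. V y $ i) (at y)) (at y)"
      "((\<lambda>y. W y $ i) has_derivative frechet_derivative (\<lambda>y. W y $ i) (at y)) (at y)"
      using assms test_function_derivative(1) unfolding test_field_def by blast+
    from frechet_derivative_at[OF has_derivative_add[OF this], symmetric] show ?thesis by simp
  qed
  then show ?thesis by (simp add: divergence_def sum.distrib)
qed

lemma divergence_identity:
  assumes f: "f \<in> H1 M" and V: "test_field V"
  shows "L2_inner M f (divergence V) = - (\<Sum>i\<in>UNIV. L2_inner M (\<lambda>y. weak_gradient M f y $ i) (\<lambda>y. V y $ i))"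
proof -
  have T: "(\<lambda>y. V y $ i) \<in> test_functions (interior M)" for i using V by (simp add: test_field_def)
  have p: "partial i (\<lambda>y. V y $ i) \<in> L2 M" for i by (rule test_function_L2(2)[OF T])
  have e: "L2_inner M f (partial i (\<lambda>y. V y $ i)) = - L2_inner M (\<lambda>y. weak_gradient M f y $ i) (\<lambda>y. V y $ i)" for i
    using weak_gradient[OF f] T unfolding has_weak_gradient_iff[OF H1_L2[OF f]] by blast
  have "divergence V = (\<lambda>y. 1 * partial 1 (\<lambda>y. V y $ 1) y + 1 * partial 2 (\<lambda>y. V y $ 2) y)"
    by (auto simp: divergence_def partial_def sum_2)
  then have "L2_inner M (divergence V) f = 1 * L2_inner M (partial 1 (\<lambda>y. V y $ 1)) f + 1 * L2_inner M (partial 2 (\<lambda>y. V y $ 2)) f"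
    by (simp only: L2_inner_lincomb[OF p p H1_L2[OF f]])
  then show ?thesis using e[of 1] e[of 2] by (simp add: sum_2 L2_inner_commute)
qed

text \<open>Pairing the gradient of \<open>f\<close> with the field gives the inner product of \<open>f\<close> with the sink, since \<open>f\<close>
  vanishes on the source; by Cauchy--Schwarz it is bounded by the two energies. It differs from
  \<open>1/|M|\<close> times the mean of \<open>f\<close> by the pairing of the sink with \<open>f\<close> minus its mean, which the Poincare
  inequality controls, and so does the difference between the mean and the norm of \<open>f\<close>. Only the
  term with \<open>W\<close> grows as the hole shrinks.\<close>

lemma flux_inequality:
  assumes \<nu>: "0 < \<nu>" and poincare: "\<nu> * (L2_inner M f f - (L2_inner M f (\<lambda>_. 1))\<^sup>2) \<le> dirichlet_form M f f"
    and f: "f \<in> H1 M" and V: "test_field V"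
    and div: "\<And>y. divergence V y = source y - sink y"
    and source: "AE y in nvol M. f y * source y = 0" and sink: "sink \<in> L2 M"
    and mean: "L2_inner M sink (\<lambda>_. 1) = 1 / vol"
    and W: "(\<Sum>i\<in>UNIV. L2_inner M (\<lambda>y. V y $ i) (\<lambda>y. V y $ i)) \<le> W / vol"
    and B: "L2_inner M sink sink \<le> B\<^sup>2" "0 \<le> B"
  shows "sqrt (L2_inner M f f) \<le> sqrt (dirichlet_form M f f) * (sqrt (2 * vol * W) + (vol * B + 1) / sqrt \<nu>)"
proof -
  let ?E = "dirichlet_form M f f" and ?m = "L2_inner M f (\<lambda>_. 1)"
  let ?G = "\<lambda>i y. weak_gradient M f y $ i"
  have E: "0 \<le> ?E" by (rule dirichlet_form_nonneg)
  have f2: "f \<in> L2 M" by (rule H1_L2[OF f])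
  have one: "(\<lambda>_. 1) \<in> L2 M" by (rule H1_L2[OF const_H1])
  have G2: "?G i \<in> L2 M" and V2: "(\<lambda>y. V y $ i) \<in> L2 M" for i
    using weak_gradient[OF f] V test_function_L2(1) by (auto simp: has_weak_gradient_def test_field_def)
  have "L2_inner M f (divergence V) = - L2_inner M f sink"
  proof -
    have div': "divergence V = (\<lambda>y. source y - sink y)" using div by auto
    have "L2_inner M f (divergence V) = (\<integral>y. - (f y * sink y) \<partial>(nvol M))"
      unfolding L2_inner_def
    proof (rule integral_cong_AE)
      have "divergence V \<in> L2 M"
      proof -
        have "divergence V = (\<lambda>y. 1 * partial 1 (\<lambda>y. V y $ 1) y + 1 * partial 2 (\<lambda>y. V y $ 2) y)"
          by (auto simp: divergence_def partial_def sum_2)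
        moreover have "partial i (\<lambda>y. V y $ i) \<in> L2 M" for i
          using V test_function_L2(2) unfolding test_field_def by blast
        ultimately show ?thesis by (simp only: L2_lincomb)
      qed
      then show "(\<lambda>y. f y * divergence V y) \<in> borel_measurable (nvol M)"
        unfolding measurable_nvol by (intro borel_measurable_times L2_measurable f2)
      show "(\<lambda>y. - (f y * sink y)) \<in> borel_measurable (nvol M)"
        unfolding measurable_nvol
        by (intro borel_measurable_uminus borel_measurable_times L2_measurable f2 sink)
      show "AE y in nvol M. f y * divergence V y = - (f y * sink y)"
        using source by eventually_elim (simp add: div algebra_simps)
    qed
    then show ?thesis by (simp add: L2_inner_def)
  qed
  then have flux: "L2_inner M f sink = (\<Sum>i\<in>UNIV. L2_inner M (?G i) (\<lambda>y. V y $ i))"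
    using divergence_identity[OF f V] by simp
  have energy: "(\<Sum>i\<in>UNIV. L2_inner M (?G i) (?G i)) = 2 * ?E"
    using dirichlet_form_eq[OF f2 weak_gradient[OF f] f2 weak_gradient[OF f]] by simp
  have "\<bar>L2_inner M f sink\<bar> \<le> sqrt (2 * ?E) * sqrt (W / vol)"
  proof -
    have cs: "\<bar>L2_inner M (?G i) (\<lambda>y. V y $ i)\<bar> \<le> sqrt (L2_inner M (?G i) (?G i)) * sqrt (L2_inner M (\<lambda>y. V y $ i) (\<lambda>y. V y $ i))" for i
      using real_sqrt_le_mono[OF L2_Cauchy_Schwarz[OF G2[of i] V2[of i]]] by (simp add: real_sqrt_mult)
    have "\<bar>L2_inner M f sink\<bar> \<le> (\<Sum>i\<in>UNIV. \<bar>L2_inner M (?G i) (\<lambda>y. V y $ i)\<bar>)"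
      unfolding flux by (rule sum_abs)
    also have "\<dots> \<le> (\<Sum>i\<in>UNIV. \<bar>sqrt (L2_inner M (?G i) (?G i))\<bar> * \<bar>sqrt (L2_inner M (\<lambda>y. V y $ i) (\<lambda>y. V y $ i))\<bar>)"
      using cs by (intro sum_mono) (simp add: L2_inner_nonneg)
    also have "\<dots> \<le> L2_set (\<lambda>i. sqrt (L2_inner M (?G i) (?G i))) UNIV * L2_set (\<lambda>i. sqrt (L2_inner M (\<lambda>y. V y $ i) (\<lambda>y. V y $ i))) UNIV"
      by (rule L2_set_mult_ineq)
    also have "\<dots> = sqrt (2 * ?E) * sqrt (\<Sum>i\<in>UNIV. L2_inner M (\<lambda>y. V y $ i) (\<lambda>y. V y $ i))"
      unfolding L2_set_def by (simp add: L2_inner_nonneg energy)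
    also have "\<dots> \<le> sqrt (2 * ?E) * sqrt (W / vol)"
      using W E by (intro mult_left_mono real_sqrt_le_mono) auto
    finally show ?thesis .
  qed
  define g where "g y = f y - ?m" for y
  have g: "g \<in> L2 M" unfolding g_def[abs_def] using L2_lincomb[OF f2 one, of 1 "- ?m"] by simp
  have gh: "L2_inner M g h = L2_inner M f h - ?m * L2_inner M (\<lambda>_. 1) h" if "h \<in> L2 M" for h
    unfolding g_def[abs_def] using L2_inner_lincomb[OF f2 one that, of 1 "- ?m"] by simp
  have one1: "L2_inner M (\<lambda>_. 1) (\<lambda>_. 1) = 1" by (simp add: L2_inner_def prob_UNIV)
  have gg: "L2_inner M g g = L2_inner M f f - ?m\<^sup>2"
    using gh[OF g] gh[OF f2] gh[OF one] one1 by (simp add: L2_inner_commute power2_eq_square)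
  have gE: "sqrt (L2_inner M g g) \<le> sqrt (?E) / sqrt \<nu>"
  proof -
    have "L2_inner M g g \<le> ?E / \<nu>" using poincare \<nu> unfolding gg by (simp add: field_simps)
    then show ?thesis by (metis real_sqrt_divide real_sqrt_le_mono)
  qed
  have "L2_inner M f sink = L2_inner M g sink + ?m / vol"
    using gh[OF sink] mean by (simp add: L2_inner_commute)
  moreover have "\<bar>L2_inner M g sink\<bar> \<le> sqrt ?E / sqrt \<nu> * B"
  proof -
    have "\<bar>L2_inner M g sink\<bar> \<le> sqrt (L2_inner M g g) * sqrt (L2_inner M sink sink)"
      using real_sqrt_le_mono[OF L2_Cauchy_Schwarz[OF g sink]] by (simp add: real_sqrt_mult)
    also have "\<dots> \<le> sqrt ?E / sqrt \<nu> * B"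
    proof (rule mult_mono[OF gE])
      show "sqrt (L2_inner M sink sink) \<le> B" using real_sqrt_le_mono[OF B(1)] B(2) by simp
    qed (use E \<nu> L2_inner_nonneg in auto)
    finally show ?thesis .
  qed
  moreover have "\<bar>L2_inner M f sink\<bar> \<le> sqrt (2 * ?E) * sqrt (W / vol)" by fact
  ultimately have "\<bar>?m / vol\<bar> \<le> sqrt (2 * ?E) * sqrt (W / vol) + sqrt ?E / sqrt \<nu> * B" by linarith
  then have "\<bar>?m\<bar> \<le> vol * (sqrt (2 * ?E) * sqrt (W / vol) + sqrt ?E / sqrt \<nu> * B)"
    using vol_pos by (simp add: abs_divide pos_divide_le_eq mult.commute)
  also have "vol * (sqrt (2 * ?E) * sqrt (W / vol) + sqrt ?E / sqrt \<nu> * B) =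
      sqrt ?E * (sqrt (2 * vol * W) + vol * B / sqrt \<nu>)"
  proof -
    have "vol * (sqrt (2 * ?E) * sqrt (W / vol)) = sqrt ?E * sqrt (2 * vol * W)"
    proof -
      have "vol * sqrt (W / vol) = sqrt (vol * W)"
      proof -
        have "sqrt (vol\<^sup>2) = vol" using vol_pos by simp
        then have "vol * sqrt (W / vol) = sqrt (vol\<^sup>2 * (W / vol))" by (simp only: real_sqrt_mult)
        also have "vol\<^sup>2 * (W / vol) = vol * W" using vol_pos by (simp add: power2_eq_square)
        finally show ?thesis .
      qed
      then show ?thesis by (simp add: real_sqrt_mult)
    qed
    then show ?thesis by (simp add: algebra_simps)
  qed
  finally have m: "\<bar>?m\<bar> \<le> sqrt ?E * (sqrt (2 * vol * W) + vol * B / sqrt \<nu>)" .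
  have "sqrt (L2_inner M f f) = sqrt (?m\<^sup>2 + L2_inner M g g)" by (simp add: gg)
  also have "\<dots> \<le> sqrt (?m\<^sup>2) + sqrt (L2_inner M g g)"
    by (rule sqrt_add_le_add_sqrt) (simp_all add: L2_inner_nonneg)
  also have "\<dots> \<le> sqrt ?E * (sqrt (2 * vol * W) + vol * B / sqrt \<nu>) + sqrt ?E / sqrt \<nu>"
    using m gE by simp
  finally show ?thesis by (simp add: algebra_simps add_divide_distrib)
qed

end

section \<open>Construction of the flux\<close>

lemma polar_diff: "polar x (\<lambda>s. A s - B s) h y = polar x A h y - polar x B h y"
  and polar_diff_angle: "polar x A (\<lambda>t. h t - g t) y = polar x A h y - polar x A g y"
  by (auto simp: polar_def algebra_simps)

text \<open>In the coordinate \<open>s\<close> a flux is switched on over \<open>[a, a + 1]\<close> and off over \<open>[b, b + 1]\<close>.\<close>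

definition ramp :: "real \<Rightarrow> real \<Rightarrow> real \<Rightarrow> real" where
  "ramp a b s = smooth_step (s - a) - smooth_step (s - b)"

lemma smooth_ramp: "smooth (ramp a b)"
  unfolding ramp_def[abs_def] by (intro smooth_diff smooth_shift smooth_smooth_step)

lemma deriv_ramp: "deriv (ramp a b) s = deriv smooth_step (s - a) - deriv smooth_step (s - b)"
proof (rule DERIV_imp_deriv)
  have "((\<lambda>s. smooth_step (s - c)) has_real_derivative deriv smooth_step (s - c)) (at s)" for c
    using DERIV_shift[of smooth_step "deriv smooth_step (s - c)" s "- c"]
      smooth_has_derivative[OF smooth_smooth_step, of "s - c"] by simp
  then show "(ramp a b has_real_derivative deriv smooth_step (s - a) - deriv smooth_step (s - b)) (at s)"
    unfolding ramp_def[abs_def] by (intro DERIV_diff)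
qed

lemma ramp_bounds: "a \<le> b \<Longrightarrow> 0 \<le> ramp a b s" "ramp a b s \<le> 1"
  using smooth_step_mono[of "s - b" "s - a"] smooth_step_le_1[of "s - a"] smooth_step_nonneg[of "s - b"]
  by (auto simp: ramp_def)

lemma ramp_0: "a \<le> b \<Longrightarrow> s \<le> a \<or> b + 1 \<le> s \<Longrightarrow> ramp a b s = 0"
  by (auto simp: ramp_def smooth_step_0 smooth_step_1)

text \<open>The divergence that a radial field with angular factor \<open>h\<close> has while it is switched on over
  \<open>[a, a + 1]\<close>.\<close>

definition shell :: "real^2 \<Rightarrow> real \<Rightarrow> (real \<Rightarrow> real) \<Rightarrow> real^2 \<Rightarrow> real" where
  "shell x a h = polar x (\<lambda>s. exp (- 2 * s) * deriv smooth_step (s - a)) h"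

lemma polar_pair_shell:
  assumes "smooth h" "periodic h"
  shows "polar_pair (\<lambda>s. exp (- 2 * s) * deriv smooth_step (s - a)) h a"
proof
  have "smooth (\<lambda>s. exp ((- 2) * s))" by (intro smooth_intros)
  then show "smooth (\<lambda>s. exp (- 2 * s) * deriv smooth_step (s - a))"
    by (intro smooth_mult smooth_shift smooth_deriv smooth_smooth_step) simp
qed (use assms deriv_smooth_step_0 in auto)

context plane_domain
begin

text \<open>The majorant \<open>H\<close> allows integration in polar coordinates also for gradients that are cut off at the
  boundary.\<close>

lemma energy_le_majorant:
  fixes V :: "real^2 \<Rightarrow> real^2"
  assumes V2: "\<And>i. (\<lambda>y. V y $ i) \<in> L2 M" and H: "\<And>y. y \<in> M \<Longrightarrow> (norm (V y))\<^sup>2 \<le> H y"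
    and W: "(\<integral>\<^sup>+ y. ennreal (H y) \<partial>lborel) \<le> ennreal W" "0 \<le> W"
  shows "(\<Sum>i\<in>UNIV. L2_inner M (\<lambda>y. V y $ i) (\<lambda>y. V y $ i)) \<le> W / vol"
proof -
  have "(\<Sum>i\<in>UNIV. L2_inner M (\<lambda>y. V y $ i) (\<lambda>y. V y $ i)) = (\<integral>y. (norm (V y))\<^sup>2 \<partial>(nvol M))"
  proof -
    have "(norm (V y))\<^sup>2 = V y $ 1 * V y $ 1 + V y $ 2 * V y $ 2" for y
      using norm_square_2[of "V y"] by (simp add: power2_eq_square)
    then show ?thesis
      unfolding L2_inner_def sum_2 using L2_mult_integrable[OF V2 V2] by simp
  qed
  also have "\<dots> = (LINT y:M|lebesgue. (norm (V y))\<^sup>2) / vol"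
    unfolding norm_square_2
    by (intro integral_nvol borel_measurable_add borel_measurable_power L2_measurable V2)
  also have "(LINT y:M|lebesgue. (norm (V y))\<^sup>2) \<le> W"
  proof -
    have "(LINT y:M|lebesgue. (norm (V y))\<^sup>2) \<le> enn2real (\<integral>\<^sup>+ y. ennreal (indicator M y *\<^sub>R (norm (V y))\<^sup>2) \<partial>lebesgue)"
      unfolding set_lebesgue_integral_def
    proof (cases "integrable lebesgue (\<lambda>y. indicator M y *\<^sub>R (norm (V y))\<^sup>2)")
      case True
      then show "(LINT y|lebesgue. indicator M y *\<^sub>R (norm (V y))\<^sup>2) \<le> enn2real (\<integral>\<^sup>+ y. ennreal (indicator M y *\<^sub>R (norm (V y))\<^sup>2) \<partial>lebesgue)"
        by (subst integral_eq_nn_integral) auto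
    qed (simp add: not_integrable_integral_eq)
    also have "\<dots> \<le> enn2real (ennreal W)"
    proof (rule enn2real_mono)
      have "(\<integral>\<^sup>+ y. ennreal (indicator M y *\<^sub>R (norm (V y))\<^sup>2) \<partial>lebesgue) \<le> (\<integral>\<^sup>+ y. ennreal (H y) \<partial>lebesgue)"
        by (intro nn_integral_mono) (auto split: split_indicator intro: ennreal_leI H)
      also have "\<dots> = (\<integral>\<^sup>+ y. ennreal (H y) \<partial>lborel)" by (rule nn_integral_completion)
      finally show "(\<integral>\<^sup>+ y. ennreal (indicator M y *\<^sub>R (norm (V y))\<^sup>2) \<partial>lebesgue) \<le> ennreal W" using W(1) by simp
    qed simp
    finally show ?thesis using W(2) by simp
  qed
  finally show ?thesis using vol_pos by (simp add: divide_right_mono)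
qed

lemma energy_le:
  assumes V: "test_field V" and W: "(\<integral>\<^sup>+ y. ennreal ((norm (V y))\<^sup>2) \<partial>lborel) \<le> ennreal W" "0 \<le> W"
  shows "(\<Sum>i\<in>UNIV. L2_inner M (\<lambda>y. V y $ i) (\<lambda>y. V y $ i)) \<le> W / vol"
proof (rule energy_le_majorant[OF _ order_refl W])
  show "(\<lambda>y. V y $ i) \<in> L2 M" for i
    using V test_function_L2(1) by (auto simp: test_field_def)
qed

lemma mean_eq:
  assumes g: "continuous_on UNIV g" "\<And>y. 0 \<le> g y" "\<And>y. y \<notin> M \<Longrightarrow> g y = 0"
    and 1: "(\<integral>\<^sup>+ y. ennreal (g y) \<partial>lborel) = 1"
  shows "L2_inner M g (\<lambda>_. 1) = 1 / vol"
proof -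
  have m: "g \<in> borel_measurable lebesgue"
    using borel_measurable_continuous_onI[OF g(1)] by (simp add: measurable_completion)
  have "L2_inner M g (\<lambda>_. 1) = (LINT y:M|lebesgue. g y) / vol"
    using integral_nvol[OF m] by (simp add: L2_inner_def)
  also have "(LINT y:M|lebesgue. g y) = (LINT y|lebesgue. g y)"
    unfolding set_lebesgue_integral_def
    by (rule Bochner_Integration.integral_cong) (use g(3) in \<open>auto split: split_indicator\<close>)
  also have "\<dots> = enn2real (\<integral>\<^sup>+ y. ennreal (g y) \<partial>lebesgue)"
    by (rule integral_eq_nn_integral[OF m]) (use g(2) in simp)
  also have "\<dots> = 1" using 1 by (simp add: nn_integral_completion)
  finally show ?thesis by simp
qed

end

text \<open>The region available to the fields is a ball around the center together with a sector. Inside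
  the ball all angles are available, and thus the sector condition has no lower bound on the radius.\<close>

locale sector_domain = plane_domain M + angular_cutoff \<gamma> for M \<gamma> +
  fixes x :: "real^2" and \<tau> R :: real
  assumes ball: "ball x (infdist x (frontier M)) \<subseteq> interior M"
    and sector: "\<And>s t. exp s \<le> R \<Longrightarrow> \<gamma> \<le> cos (t - \<tau>) \<Longrightarrow> x + pol s t \<in> interior M"
begin

abbreviation \<delta> :: real where "\<delta> \<equiv> infdist x (frontier M)"

lemma sector_support:
  assumes "\<And>s t. A s * h t \<noteq> 0 \<Longrightarrow> s \<in> {a..b} \<and> \<gamma> \<le> cos (t - \<tau>)" and "exp b \<le> R"
  obtains K where "compact K" "K \<subseteq> interior M" "\<And>s t. A s * h t \<noteq> 0 \<Longrightarrow> x + pol s t \<in> K"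
proof (rule that)
  let ?K = "cball x (exp b) \<inter> {y. exp a \<le> norm (y - x) \<and> \<gamma> * norm (y - x) \<le> (y - x) \<bullet> pol 0 \<tau>}"
  have "closed {y. exp a \<le> norm (y - x) \<and> \<gamma> * norm (y - x) \<le> (y - x) \<bullet> pol 0 \<tau>}"
    by (intro closed_Collect_conj closed_Collect_le continuous_intros)
  then show "compact ?K" by (intro compact_Int_closed compact_cball)
  show "?K \<subseteq> interior M"
  proof
    fix y assume y: "y \<in> ?K"
    then have "y \<noteq> x" using exp_gt_zero[of a] by (auto simp del: exp_gt_zero)
    then obtain s t where st: "y = x + pol s t" using pol_exists by blast
    with y have "norm (pol s t) \<le> exp b" and c: "\<gamma> * norm (pol s t) \<le> exp s * cos (t - \<tau>)"
      by (auto simp: dist_norm norm_minus_commute inner_pol simp del: norm_pol)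
    then have "exp s \<le> R" using assms(2) unfolding norm_pol by linarith
    moreover have "\<gamma> \<le> cos (t - \<tau>)" using c by (simp add: mult.commute)
    ultimately show "y \<in> interior M" unfolding st by (rule sector)
  qed
  show "x + pol s t \<in> ?K" if "A s * h t \<noteq> 0" for s t
    using assms(1)[OF that] by (auto simp: dist_norm inner_pol)
qed

lemma disc_support:
  assumes "\<And>s t. A s * h t \<noteq> 0 \<Longrightarrow> s \<in> {a..b}" and "exp b < \<delta>"
  obtains K where "compact K" "K \<subseteq> interior M" "\<And>s t. A s * h t \<noteq> 0 \<Longrightarrow> x + pol s t \<in> K"
proof (rule that[of "cball x (exp b)"])
  show "cball x (exp b) \<subseteq> interior M"
    using ball assms(2) by (force simp: subset_iff)
  show "x + pol s t \<in> cball x (exp b)" if "A s * h t \<noteq> 0" for s t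
    using assms(1)[OF that] by (simp add: dist_norm)
qed simp

text \<open>Between two scales a radial field transports a density with fixed angular profile without loss;
  at a fixed scale the angular field of \<open>stream\<close> exchanges the profile. Adding such fields cancels the
  intermediate shells.\<close>

lemma sector_flux:
  assumes ab: "a \<le> b" and R: "exp (b + 1) \<le> R"
  shows "test_field (radial_field x (ramp a b) (angular_density \<tau>))"
    and "divergence (radial_field x (ramp a b) (angular_density \<tau>)) y =
      shell x a (angular_density \<tau>) y - shell x b (angular_density \<tau>) y"
proof -
  interpret P: polar_pair "ramp a b" "angular_density \<tau>" a
    by unfold_locales (use ab ramp_0 smooth_ramp smooth_density periodic_density in auto)
  have sup: "s \<in> {a..b + 1} \<and> \<gamma> \<le> cos (t - \<tau>)" if "ramp a b s * angular_density \<tau> t \<noteq> 0" for s t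
    using that ramp_0[OF ab, of s] density_nonzero(1)[of \<tau> t] by force
  obtain K where K: "compact K" "K \<subseteq> interior M"
    "\<And>s t. ramp a b s * angular_density \<tau> t \<noteq> 0 \<Longrightarrow> x + pol s t \<in> K"
    by (rule sector_support[of "ramp a b" "angular_density \<tau>", OF sup R])
      (assumption, rule that, assumption, assumption, blast)
  then show "test_field (radial_field x (ramp a b) (angular_density \<tau>))"
    using P.test_radial_field(1)[OF K(3,1,2)] unfolding test_field_def by blast
  show "divergence (radial_field x (ramp a b) (angular_density \<tau>)) y =
      shell x a (angular_density \<tau>) y - shell x b (angular_density \<tau>) y"
    unfolding P.divergence_radial_field deriv_ramp shell_def polar_diff[symmetric]
    by (simp only: right_diff_distrib)
qed

lemma disc_flux:
  assumes ab: "a \<le> b" and \<delta>: "exp (b + 1) < \<delta>"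
  shows "test_field (radial_field x (ramp a b) (\<lambda>_. 1 / (2 * pi)))"
    and "divergence (radial_field x (ramp a b) (\<lambda>_. 1 / (2 * pi))) y =
      shell x a (\<lambda>_. 1 / (2 * pi)) y - shell x b (\<lambda>_. 1 / (2 * pi)) y"
proof -
  interpret P: polar_pair "ramp a b" "\<lambda>_. 1 / (2 * pi)" a
    by unfold_locales (use ab ramp_0 smooth_ramp in \<open>auto simp: periodic_def\<close>)
  have sup: "s \<in> {a..b + 1}" if "ramp a b s * (1 / (2 * pi)) \<noteq> 0" for s
    using that ramp_0[OF ab, of s] by force
  obtain K where K: "compact K" "K \<subseteq> interior M"
    "\<And>s (t::real). ramp a b s * (1 / (2 * pi)) \<noteq> 0 \<Longrightarrow> x + pol s t \<in> K"
    by (rule disc_support[of "ramp a b" "\<lambda>_. 1 / (2 * pi)", OF sup \<delta>])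
      (assumption, rule that, assumption, assumption, blast)
  then show "test_field (radial_field x (ramp a b) (\<lambda>_. 1 / (2 * pi)))"
    using P.test_radial_field(1)[OF K(3,1,2)] unfolding test_field_def by blast
  show "divergence (radial_field x (ramp a b) (\<lambda>_. 1 / (2 * pi))) y =
      shell x a (\<lambda>_. 1 / (2 * pi)) y - shell x b (\<lambda>_. 1 / (2 * pi)) y"
    unfolding P.divergence_radial_field deriv_ramp shell_def polar_diff[symmetric]
    by (simp only: right_diff_distrib)
qed

lemma turning_flux:
  assumes \<delta>: "exp (a + 1) < \<delta>"
  shows "test_field (angular_field x (\<lambda>s. deriv smooth_step (s - a)) (stream \<tau>))"
    and "divergence (angular_field x (\<lambda>s. deriv smooth_step (s - a)) (stream \<tau>)) y =
      shell x a (\<lambda>_. 1 / (2 * pi)) y - shell x a (angular_density \<tau>) y"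
proof -
  interpret P: polar_pair "\<lambda>s. deriv smooth_step (s - a)" "stream \<tau>" a
    by unfold_locales (use smooth_stream periodic_stream deriv_smooth_step_0 smooth_shift[OF smooth_deriv[OF smooth_smooth_step]] in auto)
  have sup: "s \<in> {a..a + 1}" if "deriv smooth_step (s - a) * stream \<tau> t \<noteq> 0" for s t
    using that deriv_smooth_step_0[of "s - a"] by force
  obtain K where K: "compact K" "K \<subseteq> interior M"
    "\<And>s t. deriv smooth_step (s - a) * stream \<tau> t \<noteq> 0 \<Longrightarrow> x + pol s t \<in> K"
    by (rule disc_support[of "\<lambda>s. deriv smooth_step (s - a)" "stream \<tau>", OF sup \<delta>])
      (assumption, rule that, assumption, assumption, blast)
  then show "test_field (angular_field x (\<lambda>s. deriv smooth_step (s - a)) (stream \<tau>))"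
    using P.test_radial_field(2)[OF K(3,1,2)] unfolding test_field_def by blast
  show "divergence (angular_field x (\<lambda>s. deriv smooth_step (s - a)) (stream \<tau>)) y =
      shell x a (\<lambda>_. 1 / (2 * pi)) y - shell x a (angular_density \<tau>) y"
    unfolding P.divergence_angular_field deriv_stream shell_def polar_diff_angle ..
qed

text \<open>The full flux: radial in a disc up to scale \<open>b\<close>, then turned into the sector, then radial
  in the sector up to scale \<open>c\<close>.\<close>

definition flux :: "real \<Rightarrow> real \<Rightarrow> real \<Rightarrow> real^2 \<Rightarrow> real^2" where
  "flux a b c y = radial_field x (ramp a b) (\<lambda>_. 1 / (2 * pi)) y +
     (angular_field x (\<lambda>s. deriv smooth_step (s - b)) (stream \<tau>) y +
      radial_field x (ramp b c) (angular_density \<tau>) y)"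

lemma flux_test_field:
  assumes "a \<le> b" "b \<le> c" "exp (b + 1) < \<delta>" "exp (c + 1) \<le> R"
  shows "test_field (flux a b c)"
    and "divergence (flux a b c) y = shell x a (\<lambda>_. 1 / (2 * pi)) y - shell x c (angular_density \<tau>) y"
  unfolding flux_def[abs_def]
  using disc_flux[OF assms(1,3)] turning_flux[OF assms(3)] sector_flux[OF assms(2,4)]
  by (simp_all add: test_field_add divergence_add)

lemma radial_field_pol:
  assumes "periodic h"
  shows "radial_field x A h (x + pol s t) = (exp (- s) * (A s * h t)) *\<^sub>R pol 0 t"
  using assms by (simp add: radial_field_def vec_eq_iff forall_2 periodic_intros)

lemma angular_field_pol:
  assumes "periodic h"
  shows "angular_field x A h (x + pol s t) = (exp (- s) * (A s * h t)) *\<^sub>R vector [- sin t, cos t]"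
  using assms by (simp add: angular_field_def vec_eq_iff forall_2 periodic_intros)

lemma test_field_measurable:
  assumes "test_field V" shows "(\<lambda>y. (norm (V y))\<^sup>2) \<in> borel_measurable borel"
proof -
  have "continuous_on UNIV (\<lambda>y. V y $ i)" for i
    using assms test_function_derivative(3) by (auto simp: test_field_def)
  then have "continuous_on UNIV (\<lambda>y. (norm (V y))\<^sup>2)"
    unfolding norm_square_2 by (intro continuous_on_add continuous_on_power)
  then show ?thesis by (rule borel_measurable_continuous_onI)
qed

text \<open>A bound for \<open>r\<^sup>2\<close> times the squared field on \<open>[b, b + 1]\<close>, where all three pieces overlap.\<close>

definition turning_energy :: real where
  "turning_energy = (1 / (2 * pi) + 1 / mass)\<^sup>2 + (step_slope * (1 / 2 + pi / mass))\<^sup>2"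

text \<open>Per unit of \<open>s\<close> the energy is \<open>1/(2\<pi>)\<close> in the disc, and in the sector it is at most
  \<open>2 arccos \<gamma> / mass\<^sup>2\<close>, which is close to \<open>1/\<pi>\<close> for small \<open>\<gamma>\<close>. The three rectangles are the disc, the
  sector and the overlap.\<close>

lemma flux_energy:
  assumes "a \<le> b" "b \<le> c" "exp (b + 1) < \<delta>" "exp (c + 1) \<le> R"
  shows "(\<integral>\<^sup>+ y. ennreal ((norm (flux a b c y))\<^sup>2) \<partial>lborel) \<le>
    ennreal ((b - a + 1) / (2 * pi) + 2 * arccos \<gamma> / mass\<^sup>2 * (c - b + 1) + 2 * pi * turning_energy)"
proof -
  define co where "co j = (if j = 0 then (1 / (2 * pi))\<^sup>2 else if j = 1 then (1 / mass)\<^sup>2 else turning_energy)" for j :: nat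
  define lo where "lo j = (if j = 0 then a else b)" for j :: nat
  define hi where "hi j = (if j = 1 then c + 1 else b + 1)" for j :: nat
  define wi where "wi j = (if j = 1 then arccos \<gamma> else pi)" for j :: nat
  have three: "(\<Sum>j\<in>{0,1,2::nat}. g j) = g 0 + (g 1 + g 2)" for g :: "nat \<Rightarrow> real" by simp
  have ac: "0 \<le> arccos \<gamma>" using \<gamma> by (intro arccos_lbound) auto
  have te: "0 \<le> turning_energy" by (simp add: turning_energy_def)
  have "(\<integral>\<^sup>+ y. ennreal ((norm (flux a b c y))\<^sup>2) \<partial>lborel) \<le>
      ennreal (\<Sum>j\<in>{0,1,2::nat}. co j * max 0 (hi j - lo j) * (2 * wi j))"
  proof (rule nn_integral_log_polar_le[where x = x and \<tau> = \<tau>])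
    show "(\<lambda>y. (norm (flux a b c y))\<^sup>2) \<in> borel_measurable borel"
      by (rule test_field_measurable[OF flux_test_field(1)[OF assms]])
    show "0 \<le> co j" "0 \<le> wi j" for j using ac te by (auto simp: co_def wi_def)
    fix s t assume t: "\<bar>t - \<tau>\<bar> < pi"
    define u where "u = ramp a b s / (2 * pi)"
    define v where "v = ramp b c s * angular_density \<tau> t"
    define w where "w = deriv smooth_step (s - b) * stream \<tau> t"
    have flux: "flux a b c (x + pol s t) = (exp (- s)) *\<^sub>R ((u + v) *\<^sub>R pol 0 t + w *\<^sub>R vector [- sin t, cos t])"
      unfolding flux_def u_def v_def w_def
      by (simp add: radial_field_pol angular_field_pol periodic_stream periodic_density periodic_intros algebra_simps)
    have "(norm ((u + v) *\<^sub>R pol 0 t + w *\<^sub>R vector [- sin t, cos t]))\<^sup>2 = ((u + v)\<^sup>2 + w\<^sup>2) * ((cos t)\<^sup>2 + (sin t)\<^sup>2)"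
    proof -
      have "((u + v) *\<^sub>R pol 0 t + w *\<^sub>R vector [- sin t, cos t]) $ 1 = (u + v) * cos t - w * sin t"
        "((u + v) *\<^sub>R pol 0 t + w *\<^sub>R vector [- sin t, cos t]) $ 2 = (u + v) * sin t + w * cos t"
        by simp_all
      then show ?thesis unfolding norm_square_2 by algebra
    qed
    then have "(norm (flux a b c (x + pol s t)))\<^sup>2 = (exp (- s))\<^sup>2 * ((u + v)\<^sup>2 + w\<^sup>2)"
      unfolding flux by (simp add: power_mult_distrib)
    moreover have "(exp (- s))\<^sup>2 * exp (2 * s) = (1::real)"
      by (simp add: power2_eq_square flip: exp_add)
    ultimately have eq: "(norm (flux a b c (x + pol s t)))\<^sup>2 * exp (2 * s) = (u + v)\<^sup>2 + w\<^sup>2"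
      by (metis mult.assoc mult.commute mult.left_neutral)
    have u: "0 \<le> u" "u \<le> 1 / (2 * pi)" "s \<notin> {a..b + 1} \<Longrightarrow> u = 0"
      using ramp_bounds[of a b s] ramp_0[of a b s] assms(1) by (auto simp: u_def divide_right_mono)
    have v: "0 \<le> v" "v \<le> 1 / mass"
      using mult_mono[of "ramp b c s" 1 "angular_density \<tau> t" "1 / mass"]
        ramp_bounds[of b c s] density_bounds[of \<tau> t] assms(2) mass_pos by (auto simp: v_def)
    have v0: "v = 0" if "\<not> (s \<in> {b..c + 1} \<and> t \<in> {\<tau> - arccos \<gamma>..\<tau> + arccos \<gamma>})"
    proof (cases "s \<in> {b..c + 1}")
      case True
      then have "\<not> \<bar>t - \<tau>\<bar> \<le> arccos \<gamma>" using that by auto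
      then have "angular_density \<tau> t = 0" using density_nonzero(2) t by blast
      then show ?thesis by (simp add: v_def)
    qed (use ramp_0[of b c s] assms(2) in \<open>auto simp: v_def\<close>)
    have w: "w = 0" if "s \<notin> {b..b + 1}" using that deriv_smooth_step_0[of "s - b"] by (auto simp: w_def)
    have "\<bar>w\<bar> \<le> step_slope * (1 / 2 + pi / mass)"
      unfolding w_def abs_mult
      using deriv_smooth_step_le[of "s - b"] deriv_smooth_step_nonneg[of "s - b"] stream_bound[OF t] step_slope_nonneg
      by (intro mult_mono) auto
    then have w2: "w\<^sup>2 \<le> (step_slope * (1 / 2 + pi / mass))\<^sup>2"
      by (metis abs_ge_zero power2_abs power_mono)
    have expand: "(\<Sum>j\<in>{0,1,2::nat}. co j * indicator {lo j..hi j} s * indicator {\<tau> - wi j..\<tau> + wi j} t) =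
        (1 / (2 * pi))\<^sup>2 * indicator {a..b + 1} s * indicator {\<tau> - pi..\<tau> + pi} t +
        ((1 / mass)\<^sup>2 * indicator {b..c + 1} s * indicator {\<tau> - arccos \<gamma>..\<tau> + arccos \<gamma>} t +
         turning_energy * indicator {b..b + 1} s * indicator {\<tau> - pi..\<tau> + pi} t)"
      unfolding three by (simp add: co_def lo_def hi_def wi_def)
    have tpi: "indicator {\<tau> - pi..\<tau> + pi} t = (1::real)" using t by (auto simp: indicator_def)
    have n0: "0 \<le> (1 / (2 * pi))\<^sup>2 * indicator {a..b + 1} s * (1::real)"
      and n1: "0 \<le> (1 / mass)\<^sup>2 * indicator {b..c + 1} s * (indicator {\<tau> - arccos \<gamma>..\<tau> + arccos \<gamma>} t :: real)"
      and n2: "0 \<le> turning_energy * indicator {b..b + 1} s * (1::real)"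
      using te by simp_all
    show "(norm (flux a b c (x + pol s t)))\<^sup>2 * exp (2 * s) \<le>
        (\<Sum>j\<in>{0,1,2::nat}. co j * indicator {lo j..hi j} s * indicator {\<tau> - wi j..\<tau> + wi j} t)"
      unfolding eq expand tpi
    proof -
      consider "s \<in> {b..b + 1}" | "s < b" | "b + 1 < s" by force
      then show "(u + v)\<^sup>2 + w\<^sup>2 \<le> (1 / (2 * pi))\<^sup>2 * indicator {a..b + 1} s * 1 +
        ((1 / mass)\<^sup>2 * indicator {b..c + 1} s * indicator {\<tau> - arccos \<gamma>..\<tau> + arccos \<gamma>} t +
         turning_energy * indicator {b..b + 1} s * 1)"
      proof cases
        case 1
        have "(u + v)\<^sup>2 \<le> (1 / (2 * pi) + 1 / mass)\<^sup>2" using u v by (intro power_mono add_mono) auto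
        then have "(u + v)\<^sup>2 + w\<^sup>2 \<le> turning_energy * indicator {b..b + 1} s * 1"
          using w2 1 by (simp add: turning_energy_def)
        then show ?thesis using n0 n1 by linarith
      next
        case 2
        then have "v = 0" "w = 0" using v0 w by auto
        then have "(u + v)\<^sup>2 + w\<^sup>2 \<le> (1 / (2 * pi))\<^sup>2 * indicator {a..b + 1} s * 1"
          using u by (cases "s \<in> {a..b + 1}") (auto intro: power_mono)
        then show ?thesis using n1 n2 by linarith
      next
        case 3
        then have "u = 0" "w = 0" using u(3) w by auto
        then have "(u + v)\<^sup>2 + w\<^sup>2 \<le> (1 / mass)\<^sup>2 * indicator {b..c + 1} s * indicator {\<tau> - arccos \<gamma>..\<tau> + arccos \<gamma>} t"
          using v v0 by (cases "s \<in> {b..c + 1} \<and> t \<in> {\<tau> - arccos \<gamma>..\<tau> + arccos \<gamma>}") (auto intro: power_mono)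
        then show ?thesis using n0 n2 by linarith
      qed
    qed
  qed simp
  also have "(\<Sum>j\<in>{0,1,2::nat}. co j * max 0 (hi j - lo j) * (2 * wi j)) =
      (b - a + 1) / (2 * pi) + 2 * arccos \<gamma> / mass\<^sup>2 * (c - b + 1) + 2 * pi * turning_energy"
    unfolding three using assms(1,2) by (simp add: co_def lo_def hi_def wi_def power2_eq_square field_simps)
  finally show ?thesis .
qed

lemma sector_flux_energy:
  assumes "a \<le> c" "exp (c + 1) \<le> R"
  shows "(\<integral>\<^sup>+ y. ennreal ((norm (radial_field x (ramp a c) (angular_density \<tau>) y))\<^sup>2) \<partial>lborel) \<le>
    ennreal (2 * arccos \<gamma> / mass\<^sup>2 * (c - a + 1))"
proof -
  have ac: "0 \<le> arccos \<gamma>" using \<gamma> by (intro arccos_lbound) auto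
  have "(\<integral>\<^sup>+ y. ennreal ((norm (radial_field x (ramp a c) (angular_density \<tau>) y))\<^sup>2) \<partial>lborel) \<le>
      ennreal (\<Sum>j\<in>{0::nat}. (1 / mass)\<^sup>2 * max 0 (c + 1 - a) * (2 * arccos \<gamma>))"
  proof (rule nn_integral_log_polar_le[where x = x and \<tau> = \<tau>])
    show "(\<lambda>y. (norm (radial_field x (ramp a c) (angular_density \<tau>) y))\<^sup>2) \<in> borel_measurable borel"
      by (rule test_field_measurable[OF sector_flux(1)[OF assms]])
    fix s t assume t: "\<bar>t - \<tau>\<bar> < pi"
    define v where "v = ramp a c s * angular_density \<tau> t"
    have "(norm (radial_field x (ramp a c) (angular_density \<tau>) (x + pol s t)))\<^sup>2 = (exp (- s))\<^sup>2 * v\<^sup>2"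
      by (simp add: radial_field_pol periodic_density v_def power_mult_distrib)
    moreover have "(exp (- s))\<^sup>2 * exp (2 * s) = (1::real)"
      by (simp add: power2_eq_square flip: exp_add)
    ultimately have eq: "(norm (radial_field x (ramp a c) (angular_density \<tau>) (x + pol s t)))\<^sup>2 * exp (2 * s) = v\<^sup>2"
      by (metis mult.assoc mult.commute mult.left_neutral)
    have v: "0 \<le> v" "v \<le> 1 / mass"
      using mult_mono[of "ramp a c s" 1 "angular_density \<tau> t" "1 / mass"]
        ramp_bounds[of a c s] density_bounds[of \<tau> t] assms(1) mass_pos by (auto simp: v_def)
    have v0: "v = 0" if "\<not> (s \<in> {a..c + 1} \<and> t \<in> {\<tau> - arccos \<gamma>..\<tau> + arccos \<gamma>})"
    proof (cases "s \<in> {a..c + 1}")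
      case True
      then have "\<not> \<bar>t - \<tau>\<bar> \<le> arccos \<gamma>" using that by auto
      then have "angular_density \<tau> t = 0" using density_nonzero(2) t by blast
      then show ?thesis by (simp add: v_def)
    qed (use ramp_0[of a c s] assms(1) in \<open>auto simp: v_def\<close>)
    show "(norm (radial_field x (ramp a c) (angular_density \<tau>) (x + pol s t)))\<^sup>2 * exp (2 * s) \<le>
        (\<Sum>j\<in>{0::nat}. (1 / mass)\<^sup>2 * indicator {a..c + 1} s * indicator {\<tau> - arccos \<gamma>..\<tau> + arccos \<gamma>} t)"
      unfolding eq using v v0
      by (cases "s \<in> {a..c + 1} \<and> t \<in> {\<tau> - arccos \<gamma>..\<tau> + arccos \<gamma>}") (auto intro: power_mono)
  qed (use ac in auto)
  also have "(\<Sum>j\<in>{0::nat}. (1 / mass)\<^sup>2 * max 0 (c + 1 - a) * (2 * arccos \<gamma>)) = 2 * arccos \<gamma> / mass\<^sup>2 * (c - a + 1)"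
    using assms(1) by (simp add: power2_eq_square field_simps)
  finally show ?thesis .
qed

lemma sink:
  assumes R: "exp (c + 1) \<le> R"
  shows "shell x c (angular_density \<tau>) \<in> L2 M"
    and "L2_inner M (shell x c (angular_density \<tau>)) (\<lambda>_. 1) = 1 / vol"
    and "L2_inner M (shell x c (angular_density \<tau>)) (shell x c (angular_density \<tau>)) \<le> (exp (- 2 * c) * step_slope / mass)\<^sup>2"
proof -
  interpret P: polar_pair "\<lambda>s. exp (- 2 * s) * deriv smooth_step (s - c)" "angular_density \<tau>" c
    by (rule polar_pair_shell[OF smooth_density periodic_density])
  have cont: "continuous_on UNIV (shell x c (angular_density \<tau>))"
    unfolding shell_def by (rule P.continuous)
  show L: "shell x c (angular_density \<tau>) \<in> L2 M" by (rule continuous_L2[OF cont])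
  have val: "shell x c (angular_density \<tau>) (x + pol s t) = exp (- 2 * s) * deriv smooth_step (s - c) * angular_density \<tau> t" for s t
    unfolding shell_def by (rule polar_pol[OF periodic_density])
  have center: "shell x c (angular_density \<tau>) x = 0" by (simp add: shell_def polar_def)
  have bounds: "0 \<le> shell x c (angular_density \<tau>) y \<and>
      shell x c (angular_density \<tau>) y \<le> exp (- 2 * c) * step_slope / mass \<and>
      (y \<notin> M \<longrightarrow> shell x c (angular_density \<tau>) y = 0)" for y
  proof (cases "y = x")
    case True
    then show ?thesis using center step_slope_nonneg mass_pos by simp
  next
    case False
    then obtain s t where y: "y = x + pol s t" using pol_exists by blast
    note nn = deriv_smooth_step_nonneg[of "s - c"] density_bounds[of \<tau> t]
    show ?thesis
    proof (cases "deriv smooth_step (s - c) * angular_density \<tau> t = 0")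
      case True
      then show ?thesis using step_slope_nonneg mass_pos by (auto simp: y val)
    next
      case False
      then have s: "c \<le> s" "s \<le> c + 1" using deriv_smooth_step_0[of "s - c"] by force+
      have "\<gamma> \<le> cos (t - \<tau>)" using False density_nonzero(1)[of \<tau> t] by force
      moreover have "exp s \<le> R" using s R by (meson exp_le_cancel_iff order_trans)
      ultimately have "y \<in> M" unfolding y using sector interior_subset by blast
      moreover have "exp (- 2 * s) * deriv smooth_step (s - c) * angular_density \<tau> t \<le> exp (- 2 * c) * step_slope * (1 / mass)"
        using nn deriv_smooth_step_le[of "s - c"] s step_slope_nonneg by (intro mult_mono) auto
      ultimately show ?thesis using nn by (simp add: y val)
    qed
  qed
  have one: "(\<integral>\<^sup>+ y. ennreal (shell x c (angular_density \<tau>) y) \<partial>lborel) = 1"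
  proof -
    have "(\<integral>\<^sup>+ y. ennreal (shell x c (angular_density \<tau>) y) \<partial>lborel) =
        (\<integral>\<^sup>+ s. ennreal (deriv smooth_step (s - c)) \<partial>lborel) *
        (\<integral>\<^sup>+ t. ennreal (angular_density \<tau> t) * indicator {\<tau> - pi<..<\<tau> + pi} t \<partial>lborel)"
      unfolding shell_def
    proof (rule nn_integral_polar[OF periodic_density])
      show "(\<lambda>s. deriv smooth_step (s - c)) \<in> borel_measurable borel"
        by (intro borel_measurable_continuous_onI smooth_continuous_on smooth_shift smooth_deriv smooth_smooth_step)
      show "angular_density \<tau> \<in> borel_measurable borel"
        by (intro borel_measurable_continuous_onI smooth_continuous_on smooth_density)
      show "polar x (\<lambda>s. exp (- 2 * s) * deriv smooth_step (s - c)) (angular_density \<tau>) \<in> borel_measurable borel"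
        by (rule borel_measurable_continuous_onI[OF P.continuous])
    qed (use deriv_smooth_step_nonneg density_bounds in auto)
    then show ?thesis by (simp add: nn_integral_deriv_smooth_step nn_integral_density)
  qed
  show "L2_inner M (shell x c (angular_density \<tau>)) (\<lambda>_. 1) = 1 / vol"
    by (rule mean_eq[OF cont _ _ one]) (use bounds in auto)
  show "L2_inner M (shell x c (angular_density \<tau>)) (shell x c (angular_density \<tau>)) \<le> (exp (- 2 * c) * step_slope / mass)\<^sup>2"
  proof -
    have "L2_inner M (shell x c (angular_density \<tau>)) (shell x c (angular_density \<tau>)) \<le>
        (\<integral>y. (exp (- 2 * c) * step_slope / mass)\<^sup>2 \<partial>(nvol M))"
      unfolding L2_inner_def
    proof (rule integral_mono_AE)
      show "integrable (nvol M) (\<lambda>y. shell x c (angular_density \<tau>) y * shell x c (angular_density \<tau>) y)"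
        by (rule L2_mult_integrable[OF L L])
      show "integrable (nvol M) (\<lambda>y. (exp (- 2 * c) * step_slope / mass)\<^sup>2)"
        by (rule L2_integrable[OF H1_L2[OF const_H1]])
      show "AE y in nvol M. shell x c (angular_density \<tau>) y * shell x c (angular_density \<tau>) y \<le> (exp (- 2 * c) * step_slope / mass)\<^sup>2"
        unfolding power2_eq_square using bounds by (intro AE_I2 mult_mono) (auto intro: order_trans)
    qed
    then show ?thesis by (simp add: prob_UNIV)
  qed
qed

lemma shell_source:
  assumes "periodic h" "AE y in nvol M. y \<in> cball x (exp (a + 1)) \<longrightarrow> f y = 0"
  shows "AE y in nvol M. f y * shell x a h y = 0"
  using assms(2)
proof eventually_elim
  case (elim y)
  show ?case
  proof (cases "y \<in> cball x (exp (a + 1))")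
    case False
    then have "y \<noteq> x" by auto
    then obtain s t where y: "y = x + pol s t" using pol_exists by blast
    then have "\<not> s \<le> a + 1" using False by (simp add: dist_norm)
    then show ?thesis
      unfolding y shell_def polar_pol[OF assms(1)] by (simp add: deriv_smooth_step_0)
  qed (use elim in simp)
qed

text \<open>In the first alternative for \<open>W\<close> the flux starts in a disc inside the domain; in the second, made for
  centers at boundary scale, it runs in the sector from the start.\<close>

lemma rayleigh_bound:
  assumes \<nu>: "0 < \<nu>" and poincare: "\<nu> * (L2_inner M f f - (L2_inner M f (\<lambda>_. 1))\<^sup>2) \<le> dirichlet_form M f f"
    and f: "f \<in> H1 M" and zero: "AE y in nvol M. y \<in> cball x (exp (a + 1)) \<longrightarrow> f y = 0"
    and ab: "a \<le> b" "b \<le> c" and R: "exp (c + 1) \<le> R"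
    and W: "0 \<le> W" "exp (b + 1) < \<delta> \<and>
      (b - a + 1) / (2 * pi) + 2 * arccos \<gamma> / mass\<^sup>2 * (c - b + 1) + 2 * pi * turning_energy \<le> W \<or>
      2 * arccos \<gamma> / mass\<^sup>2 * (c - a + 1) \<le> W"
  shows "sqrt (L2_inner M f f) \<le> sqrt (dirichlet_form M f f) *
    (sqrt (2 * vol * W) + (vol * (exp (- 2 * c) * step_slope / mass) + 1) / sqrt \<nu>)"
proof -
  have B: "0 \<le> exp (- 2 * c) * step_slope / mass"
    using step_slope_nonneg mass_pos by simp
  from W(2) show ?thesis
  proof
    assume *: "exp (b + 1) < \<delta> \<and>
      (b - a + 1) / (2 * pi) + 2 * arccos \<gamma> / mass\<^sup>2 * (c - b + 1) + 2 * pi * turning_energy \<le> W"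
    then have "(\<integral>\<^sup>+ y. ennreal ((norm (flux a b c y))\<^sup>2) \<partial>lborel) \<le> ennreal W"
      using flux_energy[OF ab _ R] ennreal_leI order_trans by blast
    then show ?thesis
      using * W(1) ab R
      by (intro flux_inequality[OF \<nu> poincare f flux_test_field(1) flux_test_field(2) shell_source[OF _ zero] sink(1,2)[OF R] energy_le sink(3)[OF R] B])
        (auto simp: periodic_intros flux_test_field)
  next
    assume *: "2 * arccos \<gamma> / mass\<^sup>2 * (c - a + 1) \<le> W"
    have ac: "a \<le> c" using ab by simp
    have "(\<integral>\<^sup>+ y. ennreal ((norm (radial_field x (ramp a c) (angular_density \<tau>) y))\<^sup>2) \<partial>lborel) \<le> ennreal W"
      using sector_flux_energy[OF ac R] ennreal_leI[OF *] by (rule order_trans)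
    then show ?thesis
      using W(1) by (intro flux_inequality[OF \<nu> poincare f sector_flux[OF ac R] shell_source[OF periodic_density zero]
            sink(1,2)[OF R] energy_le[OF sector_flux(1)[OF ac R]] sink(3)[OF R] B])
  qed
qed

end

section \<open>The lower bound\<close>

text \<open>For \<open>\<gamma> = 0\<close> the opening would be \<open>\<pi>\<close> and the quotient \<open>1/\<pi>\<close>; it depends continuously on \<open>\<gamma>\<close>.\<close>

lemma opening_near_half_plane:
  assumes "0 < \<eta>"
  obtains \<gamma> where "angular_cutoff \<gamma>" "2 * arccos \<gamma> / (angular_cutoff.mass \<gamma>)\<^sup>2 \<le> (1 + \<eta>) / pi"
proof -
  have "isCont (\<lambda>\<gamma>. pi / (4 * (arccos (2 * \<gamma>))\<^sup>2)) 0"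
    by (intro continuous_intros isCont_o2[OF _ isCont_arccos]) auto
  then have "((\<lambda>\<gamma>. pi / (4 * (arccos (2 * \<gamma>))\<^sup>2)) \<longlongrightarrow> pi / (4 * (arccos (2 * 0))\<^sup>2)) (at_right 0)"
    unfolding continuous_within by (rule filterlim_mono) (auto simp: at_within_le_at)
  moreover have "pi / (4 * (arccos (2 * 0))\<^sup>2) = 1 / pi"
    by (simp add: power2_eq_square field_simps)
  ultimately have "((\<lambda>\<gamma>. pi / (4 * (arccos (2 * \<gamma>))\<^sup>2)) \<longlongrightarrow> 1 / pi) (at_right 0)" by simp
  moreover have "1 / pi < (1 + \<eta>) / pi" using assms by (simp add: divide_strict_right_mono)
  ultimately have "\<forall>\<^sub>F \<gamma> in at_right 0. pi / (4 * (arccos (2 * \<gamma>))\<^sup>2) < (1 + \<eta>) / pi"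
    by (rule order_tendstoD(2))
  moreover have "\<forall>\<^sub>F \<gamma> in at_right (0::real). \<gamma> \<in> {0<..<1/2}"
    by (rule eventually_at_right_real) simp
  ultimately have "\<forall>\<^sub>F \<gamma> in at_right 0. pi / (4 * (arccos (2 * \<gamma>))\<^sup>2) < (1 + \<eta>) / pi \<and> \<gamma> \<in> {0<..<1/2}"
    by (rule eventually_conj)
  then obtain \<gamma> where g: "pi / (4 * (arccos (2 * \<gamma>))\<^sup>2) < (1 + \<eta>) / pi" "0 < \<gamma>" "\<gamma> < 1/2"
    using eventually_happens'[OF trivial_limit_at_right_real] by force
  interpret angular_cutoff \<gamma> using g by unfold_locales auto
  have a: "0 < arccos (2 * \<gamma>)" using arccos_lt_bounded[of "2 * \<gamma>"] g by auto
  have "2 * arccos \<gamma> \<le> pi" using arccos_le_pi2[of \<gamma>] g by simp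
  moreover have "4 * (arccos (2 * \<gamma>))\<^sup>2 \<le> mass\<^sup>2"
    using power_mono[OF mass_ge, of 2] a by (simp add: power_mult_distrib)
  ultimately have "2 * arccos \<gamma> / mass\<^sup>2 \<le> pi / (4 * (arccos (2 * \<gamma>))\<^sup>2)"
    using a by (intro frac_le) auto
  then show ?thesis using g(1) by (intro that[of \<gamma>]) (unfold_locales, linarith)
qed

context plane_domain
begin

text \<open>With \<open>\<delta>\<close> the distance from the boundary this is \<open>log (\<delta>/\<epsilon>) + 2 log (1/\<delta>)\<close> if \<open>\<epsilon> \<le> \<delta>\<close>: up to a bounded
  term, \<open>2\<pi>\<close> times the resistance between the ball and unit distance.\<close>

definition scale :: "real^2 \<Rightarrow> real \<Rightarrow> real" where
  "scale x \<epsilon> = - ln \<epsilon> - ln (max \<epsilon> (infdist x (frontier M)))"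

lemma infdist_frontier_bound:
  obtains \<Delta> where "1 \<le> \<Delta>" "\<And>x. x \<in> M \<Longrightarrow> infdist x (frontier M) \<le> \<Delta>"
proof -
  obtain p where p: "p \<in> frontier M" using frontier_nonempty by blast
  then have "p \<in> M" using frontier_subset_closed compact_imp_closed[OF compact_M] by blast
  show ?thesis
  proof (rule that[of "max 1 (diameter M)"])
    fix x assume "x \<in> M"
    have "infdist x (frontier M) \<le> dist x p" using p by (rule infdist_le)
    also have "\<dots> \<le> diameter M"
      using diameter_bounded_bound[OF compact_imp_bounded[OF compact_M] \<open>x \<in> M\<close> \<open>p \<in> M\<close>] .
    finally show "infdist x (frontier M) \<le> max 1 (diameter M)" by simp
  qed simp
qed

text \<open>The flux starts at a fixed fraction of \<open>\<epsilon>\<close>, is turned at a fixed fraction of \<open>\<delta>\<close>, and ends at a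
  fixed radius; if \<open>\<delta> < \<epsilon>\<close>, then it runs in the sector only. Its energy is \<open>(1 + \<eta>) / (2\<pi>)\<close> times the scale, up to a constant that depends
  neither on the center nor on \<open>\<epsilon>\<close>.\<close>

lemma eigenvalue_lower_bound:
  assumes C11: "uniformly_C11_boundary M" and comparable: "intrinsic_euclidean_comparable M"
    and spectrum: "discrete_neumann_spectrum_with_gap M" and \<eta>: "0 < \<eta>"
  obtains C \<epsilon>0 where "0 < \<epsilon>0" "\<epsilon>0 \<le> 1" "0 \<le> C"
    "\<And>x \<epsilon> f. x \<in> M \<Longrightarrow> 0 < \<epsilon> \<Longrightarrow> \<epsilon> < \<epsilon>0 \<Longrightarrow> f \<in> H1 M \<Longrightarrow> zero_qe_on M (intrinsic_ball M x \<epsilon>) f \<Longrightarrow>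
      sqrt (L2_inner M f f) \<le> sqrt (dirichlet_form M f f) *
        (sqrt (vol / pi * ((1 + \<eta>) * scale x \<epsilon> + C)) + C)"
proof -
  obtain \<nu> where \<nu>: "0 < \<nu>" and poincare: "\<And>f. f \<in> H1 M \<Longrightarrow>
      \<nu> * (L2_inner M f f - (L2_inner M f (\<lambda>_. 1))\<^sup>2) \<le> dirichlet_form M f f"
    by (rule Poincare[OF spectrum]) (rule that, assumption, blast)
  obtain \<gamma> where cut: "angular_cutoff \<gamma>" and \<kappa>_le: "2 * arccos \<gamma> / (angular_cutoff.mass \<gamma>)\<^sup>2 \<le> (1 + \<eta>) / pi"
    by (rule opening_near_half_plane[OF \<eta>])
  interpret angular_cutoff \<gamma> by (rule cut)
  have \<gamma>1: "0 < \<gamma>" by (rule \<gamma>)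
  obtain R where R: "0 < R" and sec: "\<And>x. x \<in> M \<Longrightarrow> \<exists>\<tau>. \<forall>s t. 1 * infdist x (frontier M) \<le> exp s \<and>
      exp s \<le> R \<and> \<gamma> \<le> cos (t - \<tau>) \<longrightarrow> x + pol s t \<in> interior M"
    by (rule sector_in_interior[OF C11 zero_less_one \<gamma>1]) (rule that, assumption, blast)
  obtain k \<rho> where k: "1 \<le> k" "0 < \<rho>" and balls: "\<And>x \<epsilon>. x \<in> M \<Longrightarrow> 0 < \<epsilon> \<Longrightarrow> \<epsilon> < \<rho> \<Longrightarrow> M \<inter> ball x (\<epsilon> / k) \<subseteq> intrinsic_ball M x \<epsilon>"
    by (rule ball_subset_intrinsic_ball[OF comparable]) (rule that, assumption, assumption, blast)
  obtain \<Delta> where \<Delta>: "1 \<le> \<Delta>" "\<And>x. x \<in> M \<Longrightarrow> infdist x (frontier M) \<le> \<Delta>"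
    by (rule infdist_frontier_bound) (rule that, assumption, blast)
  define \<kappa> where "\<kappa> = 2 * arccos \<gamma> / mass\<^sup>2"
  have \<kappa>: "0 \<le> \<kappa>" "\<kappa> \<le> (1 + \<eta>) / pi"
    using \<kappa>_le arccos_lbound[of \<gamma>] \<gamma> by (auto simp: \<kappa>_def)
  \<comment> \<open>The subtracted units in \<open>a\<close>, \<open>b\<close> and \<open>c\<close> leave room for the ramps, which extend by one unit of \<open>s\<close>.\<close>
  define c where "c = ln R - 1"
  define te where "te = 2 * pi * sector_domain.turning_energy \<gamma>"
  \<comment> \<open>\<open>K\<close> collects all bounded terms of the energy of the flux, in both cases below.\<close>
  define K where "K = \<bar>ln k\<bar> * 2 + \<bar>ln R\<bar> * 2 + 5 + \<bar>ln (max \<Delta> R / R)\<bar> + 2 * pi * \<bar>te\<bar>"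
  define C where "C = (1 + \<eta>) * K + (vol * (exp (- 2 * c) * step_slope / mass) + 1) / sqrt \<nu>"
  have tail: "0 \<le> (vol * (exp (- 2 * c) * step_slope / mass) + 1) / sqrt \<nu>"
    using vol_pos step_slope_nonneg mass_pos \<nu> by simp
  have te_nonneg: "0 \<le> 2 * pi * \<bar>te\<bar>" by simp
  have K: "0 \<le> K" "2 * ln R + 2 * ln k + 4 \<le> K"
    "ln (max \<Delta> R / R) + (ln k + 2 * ln R + 5 + 2 * pi * \<bar>te\<bar>) \<le> K"
    using te_nonneg unfolding K_def by linarith+
  have C: "0 \<le> C" "(1 + \<eta>) * K \<le> C" "(vol * (exp (- 2 * c) * step_slope / mass) + 1) / sqrt \<nu> \<le> C"
    using tail K \<eta> by (auto simp: C_def)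
  define \<epsilon>0 where "\<epsilon>0 = min 1 (min R \<rho>)"
  show ?thesis
  proof (rule that[of \<epsilon>0 C])
    show "0 < \<epsilon>0" "\<epsilon>0 \<le> 1" "0 \<le> C" using R k C by (auto simp: \<epsilon>0_def)
    fix x \<epsilon> f
    assume x: "x \<in> M" and \<epsilon>: "0 < \<epsilon>" "\<epsilon> < \<epsilon>0" and f: "f \<in> H1 M" "zero_qe_on M (intrinsic_ball M x \<epsilon>) f"
    have \<epsilon>': "\<epsilon> < 1" "\<epsilon> < R" "\<epsilon> < \<rho>" using \<epsilon> by (auto simp: \<epsilon>0_def)
    define \<delta> where "\<delta> = infdist x (frontier M)"
    obtain \<tau> where \<tau>: "\<And>s t. \<delta> \<le> exp s \<Longrightarrow> exp s \<le> R \<Longrightarrow> \<gamma> \<le> cos (t - \<tau>) \<Longrightarrow> x + pol s t \<in> interior M"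
      using sec[OF x] unfolding \<delta>_def by auto
    interpret S: sector_domain M \<gamma> x \<tau> R
    proof
      show b: "ball x (infdist x (frontier M)) \<subseteq> interior M" by (rule ball_interior[OF x])
      fix s t assume "exp s \<le> R" "\<gamma> \<le> cos (t - \<tau>)"
      then show "x + pol s t \<in> interior M"
        using \<tau>[of s t] b by (cases "\<delta> \<le> exp s") (auto simp: \<delta>_def dist_norm subset_iff)
    qed
    \<comment> \<open>The source lies within \<open>\<epsilon>/k\<close> of the center, hence in the intrinsic ball.\<close>
    define a where "a = ln \<epsilon> - ln k - 2"
    have exp_a: "exp (a + 1) < \<epsilon> / k"
    proof -
      have "exp (a + 1) = \<epsilon> / k * exp (- 1)"
        using \<epsilon> k by (simp add: a_def exp_diff exp_add exp_minus field_simps)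
      also have "\<dots> < \<epsilon> / k * 1" using \<epsilon> k by (intro mult_strict_left_mono) auto
      finally show ?thesis by simp
    qed
    have zero: "AE y in nvol M. y \<in> cball x (exp (a + 1)) \<longrightarrow> f y = 0"
    proof -
      have "AE y in nvol M. y \<in> M" by (simp add: AE_nvol)
      with zero_qe_AE[OF f(2)] show ?thesis
      proof eventually_elim
        case (elim y)
        show ?case
        proof
          assume "y \<in> cball x (exp (a + 1))"
          then have "y \<in> M \<inter> ball x (\<epsilon> / k)" using exp_a elim by auto
          then show "f y = 0" using balls[OF x \<epsilon>(1) \<epsilon>'(3)] elim by blast
        qed
      qed
    qed
    have lnk: "0 \<le> ln k" using k by simp
    have exp_c: "exp (c + 1) \<le> R" using R by (simp add: c_def)
    have ln_\<epsilon>R: "ln \<epsilon> < ln R" "ln \<epsilon> < 0" using \<epsilon> \<epsilon>' R by simp_all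
    define W where "W = (1 + \<eta>) / (2 * pi) * (scale x \<epsilon> + K)"
    have "sqrt (L2_inner M f f) \<le> sqrt (dirichlet_form M f f) *
      (sqrt (2 * vol * W) + (vol * (exp (- 2 * c) * step_slope / mass) + 1) / sqrt \<nu>)"
    proof (cases "\<delta> < \<epsilon>")
      case True
      then have scale: "scale x \<epsilon> = - 2 * ln \<epsilon>" by (simp add: scale_def \<delta>_def max_def)
      have a_le: "a \<le> c" using ln_\<epsilon>R lnk by (simp add: a_def c_def)
      have "\<kappa> * (c - a + 1) \<le> (1 + \<eta>) / pi * (c - a + 1)" using \<kappa> a_le by (intro mult_right_mono) auto
      also have "\<dots> = (1 + \<eta>) / (2 * pi) * (- 2 * ln \<epsilon> + (2 * ln R + 2 * ln k + 4))"
        by (simp add: a_def c_def field_simps)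
      also have "\<dots> \<le> W"
        unfolding W_def scale using \<eta> K by (intro mult_left_mono) auto
      finally have le: "2 * arccos \<gamma> / mass\<^sup>2 * (c - a + 1) \<le> W" by (simp add: \<kappa>_def)
      have "0 \<le> \<kappa> * (c - a + 1)" using \<kappa> a_le by simp
      then have "0 \<le> W" using le by (simp add: \<kappa>_def)
      then show ?thesis
        using S.rayleigh_bound[OF \<nu> poincare[OF f(1)] f(1) zero order_refl a_le exp_c] le by blast
    next
      case False
      then have \<delta>: "0 < \<delta>" "\<epsilon> \<le> \<delta>" using \<epsilon> by auto
      \<comment> \<open>A distance \<open>\<delta>\<close> that exceeds \<open>R\<close> changes the scale only by a bounded amount.\<close>
      define D where "D = min \<delta> R"
      have D: "0 < D" "\<epsilon> \<le> D" "D \<le> R" "D \<le> \<delta>" using \<delta> R \<epsilon>' by (auto simp: D_def)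
      define b where "b = ln D - 2"
      have ab: "a \<le> b" "b \<le> c"
        using D \<epsilon> lnk by (auto simp: a_def b_def c_def) (smt (verit) ln_le_cancel_iff)+
      have exp_b: "exp (b + 1) < \<delta>"
      proof -
        have "exp (b + 1) = D * exp (- 1)" using D by (simp add: b_def flip: exp_add) (simp add: exp_diff exp_minus field_simps)
        also have "\<dots> < D * 1" using D by (intro mult_strict_left_mono) auto
        finally show ?thesis using D by simp
      qed
      have lnD: "- ln D \<le> - ln \<delta> + ln (max \<Delta> R / R)"
      proof (cases "\<delta> \<le> R")
        case True
        have "1 \<le> max \<Delta> R / R" using R by simp
        then have "0 \<le> ln (max \<Delta> R / R)" by simp
        then show ?thesis using True by (simp add: D_def)
      next
        case False
        have "ln \<delta> \<le> ln (max \<Delta> R)" using \<delta> \<Delta>(2)[OF x] by (simp add: \<delta>_def le_max_iff_disj)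
        moreover have "ln (max \<Delta> R / R) = ln (max \<Delta> R) - ln R" using R by (intro ln_divide_pos) auto
        ultimately show ?thesis using False by (simp add: D_def)
      qed
      have scale: "scale x \<epsilon> = - ln \<epsilon> - ln \<delta>" using \<delta> by (simp add: scale_def \<delta>_def max_def)
      have "(b - a + 1) / (2 * pi) \<le> (1 + \<eta>) * ((b - a + 1) / (2 * pi))"
        using ab \<eta> mult_right_mono[of 1 "1 + \<eta>" "(b - a + 1) / (2 * pi)"] by simp
      moreover have "\<kappa> * (c - b + 1) \<le> (1 + \<eta>) / pi * (c - b + 1)" using \<kappa> ab by (intro mult_right_mono) auto
      moreover have "te \<le> (1 + \<eta>) / (2 * pi) * (2 * pi * \<bar>te\<bar>)"
        using \<eta> mult_right_mono[of 1 "1 + \<eta>" "\<bar>te\<bar>"] by simp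
      ultimately have "(b - a + 1) / (2 * pi) + \<kappa> * (c - b + 1) + te \<le>
          (1 + \<eta>) * ((b - a + 1) / (2 * pi)) + (1 + \<eta>) / pi * (c - b + 1) + (1 + \<eta>) / (2 * pi) * (2 * pi * \<bar>te\<bar>)"
        by linarith
      also have "\<dots> = (1 + \<eta>) / (2 * pi) * (- ln \<epsilon> - ln D + (ln k + 2 * ln R + 5 + 2 * pi * \<bar>te\<bar>))"
        by (simp add: a_def b_def c_def field_simps)
      also have "\<dots> \<le> W"
      proof -
        have "- ln \<epsilon> - ln D + (ln k + 2 * ln R + 5 + 2 * pi * \<bar>te\<bar>) \<le> - ln \<epsilon> - ln \<delta> + K"
          using lnD K(3) by linarith
        then show ?thesis unfolding W_def scale using \<eta> by (intro mult_left_mono) auto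
      qed
      finally have le: "(b - a + 1) / (2 * pi) + \<kappa> * (c - b + 1) + te \<le> W" .
      have "0 \<le> te" by (simp add: te_def S.turning_energy_def)
      then have "0 \<le> (b - a + 1) / (2 * pi) + \<kappa> * (c - b + 1) + te" using \<kappa> ab by simp
      then have "0 \<le> W" using le by linarith
      then show ?thesis
        using S.rayleigh_bound[OF \<nu> poincare[OF f(1)] f(1) zero ab exp_c, of W] le exp_b
        by (simp add: \<kappa>_def te_def \<delta>_def)
    qed
    also have "\<dots> \<le> sqrt (dirichlet_form M f f) * (sqrt (vol / pi * ((1 + \<eta>) * scale x \<epsilon> + C)) + C)"
    proof (intro mult_left_mono add_mono real_sqrt_le_mono C(3))
      have "2 * vol * W = vol / pi * ((1 + \<eta>) * scale x \<epsilon> + (1 + \<eta>) * K)"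
        by (simp add: W_def field_simps)
      also have "\<dots> \<le> vol / pi * ((1 + \<eta>) * scale x \<epsilon> + C)"
        using C(2) vol_pos by (intro mult_left_mono) auto
      finally show "2 * vol * W \<le> vol / pi * ((1 + \<eta>) * scale x \<epsilon> + C)" .
    qed (simp add: dirichlet_form_nonneg)
    finally show "sqrt (L2_inner M f f) \<le> sqrt (dirichlet_form M f f) *
        (sqrt (vol / pi * ((1 + \<eta>) * scale x \<epsilon> + C)) + C)" .
  qed
qed

end

section \<open>The upper bound\<close>

text \<open>A continuous indicator of \<open>[a, b]\<close>; it is \<open>0\<close> everywhere if the interval is empty.\<close>

definition trap :: "real \<Rightarrow> real \<Rightarrow> real \<Rightarrow> real" where
  "trap a b s = max 0 (min 1 (min (s - a) (b - s)))"

lemma trap_bounds: "0 \<le> trap a b s" "trap a b s \<le> 1"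
  by (auto simp: trap_def)

lemma trap_0: "s \<le> a \<or> b \<le> s \<Longrightarrow> trap a b s = 0"
  by (auto simp: trap_def)

lemma trap_1: "a + 1 \<le> s \<Longrightarrow> s \<le> b - 1 \<Longrightarrow> trap a b s = 1"
  by (auto simp: trap_def)

lemma continuous_trap: "continuous_on UNIV (trap a b)"
  unfolding trap_def[abs_def] by (intro continuous_intros)

text \<open>The slope in \<open>s = log r\<close> of the test function. Conservation of the flux \<open>\<integral> slope dt\<close> over the part of the
  circle in the domain asks for twice the slope where only half of the circle is available. Between
  \<open>b\<close> and \<open>c\<close> the shape of the domain is not controlled, so the function is constant there.\<close>

definition slope :: "real \<Rightarrow> real \<Rightarrow> real \<Rightarrow> real \<Rightarrow> real \<Rightarrow> real" where
  "slope a b c d s = trap a b s + 2 * trap c d s"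

lemma slope_nonneg: "0 \<le> slope a b c d s"
  using trap_bounds[of a b s] trap_bounds[of c d s] by (simp add: slope_def)

text \<open>The constant \<open>6\<close> bounds the loss at the four flanks of the two trapezoids.\<close>

lemma potential_exists:
  assumes "a \<le> b" "b \<le> c" "c \<le> d"
  obtains \<Psi> where "\<forall>s. (\<Psi> has_real_derivative slope a b c d s) (at s)"
    "\<forall>s\<le>a. \<Psi> s = 0" "\<forall>s\<ge>d. b - a + 2 * (d - c) - 6 \<le> \<Psi> s"
proof -
  have "continuous_on UNIV (slope a b c d)"
    unfolding slope_def[abs_def] by (intro continuous_intros continuous_trap)
  then obtain F where F: "\<And>s. (F has_real_derivative slope a b c d s) (at s)"
    using continuous_antiderivative by metis
  have mono: "F s \<le> F t" if "s \<le> t" for s t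
    by (rule DERIV_nonneg_imp_nondecreasing[OF that]) (use F slope_nonneg in blast)
  have low: "F s = F a" if "s \<le> a" for s
  proof (cases "s = a")
    case False
    then have "s < a" using that by simp
    have "F a - F s = (a - s) * 0"
    proof -
      obtain z where z: "s < z" "z < a" "F a - F s = (a - s) * slope a b c d z"
        using MVT2[OF \<open>s < a\<close>, of F "slope a b c d"] F by blast
      then have "slope a b c d z = 0" using assms by (simp add: slope_def trap_0)
      then show ?thesis using z by simp
    qed
    then show ?thesis by simp
  qed simp
  have incr: "m * (v - u) \<le> F v - F u" if "u \<le> v" "\<And>s. u \<le> s \<Longrightarrow> s \<le> v \<Longrightarrow> m \<le> slope a b c d s" for u v m
  proof (cases "u = v")
    case False
    then have "u < v" using that by simp
    then obtain z where z: "u < z" "z < v" "F v - F u = (v - u) * slope a b c d z"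
      using MVT2[of u v F "slope a b c d"] F by blast
    have "(v - u) * m \<le> (v - u) * slope a b c d z" using z that(2)[of z] by (intro mult_left_mono) auto
    then show ?thesis using z by (simp add: mult.commute)
  qed simp
  have 1: "b - a - 2 \<le> F b - F a"
  proof (cases "a + 1 \<le> b - 1")
    case True
    have "1 * ((b - 1) - (a + 1)) \<le> F (b - 1) - F (a + 1)"
      by (rule incr[OF True]) (use trap_1[of a _ b] trap_bounds(1)[of c d] in \<open>simp add: slope_def\<close>)
    then show ?thesis using mono[of "b - 1" b] mono[of a "a + 1"] by simp
  next
    case False
    then show ?thesis using mono[of a b] assms by simp
  qed
  have 2: "2 * (d - c) - 4 \<le> F d - F c"
  proof (cases "c + 1 \<le> d - 1")
    case True
    have "2 * ((d - 1) - (c + 1)) \<le> F (d - 1) - F (c + 1)"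
      by (rule incr[OF True]) (use trap_1[of c _ d] trap_bounds(1)[of a b] in \<open>simp add: slope_def\<close>)
    then show ?thesis using mono[of "d - 1" d] mono[of c "c + 1"] by simp
  next
    case False
    then show ?thesis using mono[of c d] assms by simp
  qed
  show ?thesis
  proof (rule that[of "\<lambda>s. F s - F a"])
    show "\<forall>s. ((\<lambda>s. F s - F a) has_real_derivative slope a b c d s) (at s)"
    proof
      fix s show "((\<lambda>s. F s - F a) has_real_derivative slope a b c d s) (at s)"
        using DERIV_diff[OF F[of s] DERIV_const[of "F a"]] by simp
    qed
    show "\<forall>s\<le>a. F s - F a = 0"
    proof (intro allI impI)
      fix s assume "s \<le> a"
      from low[OF this] show "F s - F a = 0" by simp
    qed
    show "\<forall>s\<ge>d. b - a + 2 * (d - c) - 6 \<le> F s - F a"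
    proof (intro allI impI)
      fix s assume "d \<le> s"
      show "b - a + 2 * (d - c) - 6 \<le> F s - F a"
        using 1 2 mono[OF \<open>d \<le> s\<close>] mono[OF assms(2)] by linarith
    qed
  qed
qed

lemma radial_gradient:
  fixes x :: "real^2"
  assumes A: "\<And>s. (A has_real_derivative A' s) (at s)" "continuous_on UNIV A'"
    and zero: "\<forall>s\<le>a. A s = 0" "\<forall>s\<le>a. A' s = 0"
  defines "F \<equiv> \<lambda>y. if y = x then 0 else (A' (ln (norm (y - x))) / (norm (y - x))\<^sup>2) *\<^sub>R (y - x)"
  shows "(polar x A (\<lambda>_. 1) has_derivative (\<lambda>v. v \<bullet> F y)) (at y)" and "continuous_on UNIV F"
    and "F (x + pol s t) = (exp (- s) * A' s) *\<^sub>R pol 0 t"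
proof -
  have F_pol: "F (x + pol s t) = (exp (- s) * A' s) *\<^sub>R pol 0 t" for s t
  proof -
    have "pol s t = exp s *\<^sub>R pol 0 t" by (simp add: vec_eq_iff forall_2)
    then have "F (x + pol s t) = (A' s / (exp s)\<^sup>2 * exp s) *\<^sub>R pol 0 t" by (simp add: F_def)
    also have "A' s / (exp s)\<^sup>2 * exp s = exp (- s) * A' s"
      by (simp add: exp_minus power2_eq_square field_simps)
    finally show ?thesis .
  qed
  then show "F (x + pol s t) = (exp (- s) * A' s) *\<^sub>R pol 0 t" .
  have near: "ln (norm (y - x)) \<le> a" if "y \<in> ball x (exp a)" "y \<noteq> x" for y
  proof -
    have "norm (y - x) < exp a" "0 < norm (y - x)"
      using that by (auto simp: dist_norm norm_minus_commute)
    then have "ln (norm (y - x)) < ln (exp a)" by (subst ln_less_cancel_iff) auto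
    then show ?thesis by simp
  qed
  have F0: "F y = 0" if "y \<in> ball x (exp a)" for y
    using zero(2) near[OF that] by (simp add: F_def)
  show "(polar x A (\<lambda>_. 1) has_derivative (\<lambda>v. v \<bullet> F y)) (at y)"
  proof (cases "y = x")
    case True
    have "((\<lambda>y. 0) has_derivative (\<lambda>v::real^2. 0::real)) (at x)" by simp
    then have "(polar x A (\<lambda>_. 1) has_derivative (\<lambda>v. 0)) (at x)"
      by (rule has_derivative_transform_within_open[OF _ open_ball[of x "exp a"]])
        (use zero(1) near in \<open>auto simp: polar_def\<close>)
    then show ?thesis by (simp add: True F_def)
  next
    case False
    then obtain s t where y: "y = x + pol s t" using pol_exists by blast
    have "periodic (\<lambda>_. 1)" by (simp add: periodic_def)
    from polar_has_derivative[OF this DERIV_const A(1)]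
    have "(polar x A (\<lambda>_. 1) has_derivative
        (\<lambda>v. exp (- s) * ((A' s * 1) * (v $ 1 * cos t + v $ 2 * sin t) + (A s * 0) * (v $ 2 * cos t - v $ 1 * sin t)))) (at y)"
      unfolding y .
    moreover have "exp (- s) * ((A' s * 1) * (v $ 1 * cos t + v $ 2 * sin t) + (A s * 0) * (v $ 2 * cos t - v $ 1 * sin t)) = v \<bullet> F y" for v
      unfolding y F_pol by (simp add: inner_vec_def sum_2 algebra_simps)
    ultimately show ?thesis by simp
  qed
  show "continuous_on UNIV F"
  proof (rule continuous_at_imp_continuous_on, rule ballI)
    fix y
    show "isCont F y"
    proof (cases "y = x")
      case True
      have "continuous_on (ball x (exp a)) F"
        using continuous_on_const by (rule continuous_on_eq) (simp add: F0)
      then show ?thesis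
        unfolding True by (rule continuous_on_interior) (simp add: interior_open)
    next
      case False
      have A': "continuous_on UNIV A'" by fact
      have "continuous_on (- {x}) (\<lambda>y. (A' (ln (norm (y - x))) / (norm (y - x))\<^sup>2) *\<^sub>R (y - x))"
        by (intro continuous_intros continuous_on_compose2[OF A']) auto
      then have "continuous_on (- {x}) F"
        by (rule continuous_on_eq) (simp add: F_def)
      then show ?thesis
        by (rule continuous_on_interior) (use False in \<open>simp add: interior_open open_Compl\<close>)
    qed
  qed
qed

context plane_domain
begin

text \<open>The test function is the radial function with slope \<open>1\<close> from \<open>\<epsilon>\<close> to about \<open>\<delta>\<close> and slope \<open>2\<close> from there to
  a fixed radius \<open>R0\<close>. In the outer range the domain covers an angle of at most about \<open>\<pi>\<close>, so its
  squared slope \<open>4\<close> contributes at most \<open>4 \<pi> = 2 \<cdot> 2\<pi>\<close> per unit of \<open>s\<close>: energy and final value are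
  both governed by the same scale.\<close>

lemma eigenvalue_upper_bound:
  assumes C11: "uniformly_C11_boundary M" and \<eta>: "0 < \<eta>"
  obtains C \<epsilon>0 where "0 < \<epsilon>0" "\<epsilon>0 \<le> 1" "0 \<le> C"
    "\<And>x \<epsilon>. x \<in> M \<Longrightarrow> 0 < \<epsilon> \<Longrightarrow> \<epsilon> < \<epsilon>0 \<Longrightarrow> C < scale x \<epsilon> \<Longrightarrow>
      \<exists>f\<in>H1 M. zero_qe_on M (intrinsic_ball M x \<epsilon>) f \<and> (1 - \<eta>) * (scale x \<epsilon> - C)\<^sup>2 \<le> L2_inner M f f \<and>
        dirichlet_form M f f \<le> pi / vol * ((1 + \<eta>) * (scale x \<epsilon> + C))"
proof -
  obtain \<gamma> where \<gamma>: "0 < \<gamma>" "\<gamma> < 1" "arccos (- \<gamma>) \<le> pi / 2 * (1 + \<eta>)"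
  proof -
    have "isCont (\<lambda>\<gamma>. arccos (- \<gamma>)) 0"
      by (intro continuous_intros isCont_o2[OF _ isCont_arccos]) auto
    then have "((\<lambda>\<gamma>. arccos (- \<gamma>)) \<longlongrightarrow> arccos (- 0)) (at 0)" by (rule isContD)
    then have "((\<lambda>\<gamma>. arccos (- \<gamma>)) \<longlongrightarrow> pi / 2) (at_right 0)"
      by (simp add: filterlim_at_split)
    moreover have "pi / 2 < pi / 2 * (1 + \<eta>)" using \<eta> by simp
    ultimately have "\<forall>\<^sub>F \<gamma> in at_right 0. arccos (- \<gamma>) < pi / 2 * (1 + \<eta>)" by (rule order_tendstoD(2))
    moreover have "\<forall>\<^sub>F \<gamma> in at_right (0::real). \<gamma> \<in> {0<..<1}" by (rule eventually_at_right_real) simp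
    ultimately have "\<forall>\<^sub>F \<gamma> in at_right 0. arccos (- \<gamma>) < pi / 2 * (1 + \<eta>) \<and> \<gamma> \<in> {0<..<1}"
      by (rule eventually_conj)
    then obtain \<gamma> where "arccos (- \<gamma>) < pi / 2 * (1 + \<eta>) \<and> \<gamma> \<in> {0<..<1}"
      using eventually_happens'[OF trivial_limit_at_right_real] by blast
    then show ?thesis by (intro that[of \<gamma>]) auto
  qed
  obtain R k where R: "0 < R" and k: "1 \<le> k" and half: "\<And>x. x \<in> M \<Longrightarrow> \<exists>\<tau>. \<forall>s t. k * infdist x (frontier M) \<le> exp s \<and>
    exp s \<le> R \<and> x + pol s t \<in> M \<longrightarrow> - \<gamma> \<le> cos (t - \<tau>)"
    by (rule domain_in_halfplane[OF C11 \<gamma>(1) less_imp_le[OF \<gamma>(2)]]) (rule that, assumption, assumption, blast)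
  \<comment> \<open>Outside the ball of radius \<open>R0\<close>, that is, on all but the fraction \<open>\<eta>\<close> of \<open>M\<close>, the test function has its final value.\<close>
  define R0 where "R0 = min R (sqrt (\<eta> * vol / pi))"
  have R0: "0 < R0" "R0 \<le> R" "pi * R0\<^sup>2 \<le> \<eta> * vol"
  proof -
    show "0 < R0" "R0 \<le> R" using R \<eta> vol_pos by (auto simp: R0_def)
    have "R0\<^sup>2 \<le> (sqrt (\<eta> * vol / pi))\<^sup>2" using \<open>0 < R0\<close> by (intro power_mono) (auto simp: R0_def)
    also have "\<dots> = \<eta> * vol / pi" using \<eta> vol_pos by simp
    finally show "pi * R0\<^sup>2 \<le> \<eta> * vol" by (simp add: field_simps)
  qed
  obtain \<Delta> where \<Delta>: "1 \<le> \<Delta>" "\<And>x. x \<in> M \<Longrightarrow> infdist x (frontier M) \<le> \<Delta>"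
    by (rule infdist_frontier_bound) (rule that, assumption, blast)
  define R1 where "R1 = R0 / k"
  have R1: "0 < R1" "R1 \<le> R0" using R0 k by (auto simp: R1_def divide_le_eq)
  define C where "C = 2 * \<bar>ln R0\<bar> + 2 * \<bar>ln k\<bar> + 6 + \<bar>ln (max \<Delta> R1 / R1)\<bar>"
  define \<epsilon>0 where "\<epsilon>0 = min 1 R1"
  show ?thesis
  proof (rule that[of \<epsilon>0 C])
    show "0 < \<epsilon>0" "\<epsilon>0 \<le> 1" "0 \<le> C" using R1 by (auto simp: \<epsilon>0_def C_def)
    fix x \<epsilon> assume x: "x \<in> M" and \<epsilon>: "0 < \<epsilon>" "\<epsilon> < \<epsilon>0" and T: "C < scale x \<epsilon>"
    have \<epsilon>': "\<epsilon> < 1" "\<epsilon> < R1" using \<epsilon> by (auto simp: \<epsilon>0_def)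
    define \<delta> where "\<delta> = infdist x (frontier M)"
    have \<delta>0: "0 \<le> \<delta>" by (simp add: \<delta>_def infdist_nonneg)
    obtain \<tau> where \<tau>: "\<And>s t. k * \<delta> \<le> exp s \<Longrightarrow> exp s \<le> R \<Longrightarrow> x + pol s t \<in> M \<Longrightarrow> - \<gamma> \<le> cos (t - \<tau>)"
      using half[OF x] unfolding \<delta>_def by auto
    \<comment> \<open>The radius where the first range ends: \<open>\<delta>\<close>, but at least \<open>\<epsilon>\<close>, and so small that \<open>k D \<le> R0\<close>.
      If \<open>\<delta> > R1\<close>, then \<open>k D = R0\<close> and the second range is empty.\<close>
    define D where "D = max \<epsilon> (min \<delta> R1)"
    have D: "0 < D" "\<epsilon> \<le> D" "D \<le> R1" "D \<le> max \<epsilon> \<delta>" using \<epsilon> \<epsilon>' by (auto simp: D_def)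
    define a where "a = ln \<epsilon>"
    define b where "b = ln D"
    define c where "c = ln k + ln D"
    define d where "d = ln R0"
    have lnk: "0 \<le> ln k" using k by simp
    have ord: "a \<le> b" "b \<le> c" "c \<le> d"
    proof -
      show "a \<le> b" "b \<le> c" using D \<epsilon> lnk by (auto simp: a_def b_def c_def)
      have "c = ln (k * D)" using k D by (simp add: c_def ln_mult_pos)
      also have "k * D \<le> R0" using D(3) k by (simp add: R1_def field_simps)
      then have "ln (k * D) \<le> ln R0" using k D R0 by simp
      finally show "c \<le> d" by (simp add: d_def)
    qed
    have scale_le: "scale x \<epsilon> \<le> - ln \<epsilon> - ln D"
      using D by (simp add: scale_def \<delta>_def)
    have scale_ge: "- ln \<epsilon> - ln D \<le> scale x \<epsilon> + \<bar>ln (max \<Delta> R1 / R1)\<bar>"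
    proof (cases "\<delta> \<le> R1")
      case True
      then have "D = max \<epsilon> \<delta>" by (simp add: D_def)
      then show ?thesis by (simp add: scale_def \<delta>_def)
    next
      case False
      then have D1: "D = R1" "max \<epsilon> \<delta> = \<delta>" using \<epsilon>' by (auto simp: D_def)
      have "ln \<delta> \<le> ln (max \<Delta> R1)" using False R1 \<Delta>(2)[OF x] by (simp add: \<delta>_def le_max_iff_disj)
      moreover have "ln (max \<Delta> R1 / R1) = ln (max \<Delta> R1) - ln R1" using R1 by (intro ln_divide_pos) auto
      ultimately show ?thesis using D1 by (simp add: scale_def \<delta>_def)
    qed
    obtain \<Psi> where "\<forall>s. (\<Psi> has_real_derivative slope a b c d s) (at s)"
      "\<forall>s\<le>a. \<Psi> s = 0" "\<forall>s\<ge>d. b - a + 2 * (d - c) - 6 \<le> \<Psi> s"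
      by (rule potential_exists[OF ord])
    note \<Psi> = this[rule_format]
    define f where "f = polar x \<Psi> (\<lambda>_. 1)"
    define F where "F = (\<lambda>y. if y = x then 0 else (slope a b c d (ln (norm (y - x))) / (norm (y - x))\<^sup>2) *\<^sub>R (y - x))"
    have slope_cont: "continuous_on UNIV (slope a b c d)"
      unfolding slope_def[abs_def] by (intro continuous_intros continuous_trap)
    have slope0: "slope a b c d s = 0" if "s \<le> a" for s
      using that ord by (simp add: slope_def trap_0)
    have "\<forall>s\<le>a. \<Psi> s = 0" "\<forall>s\<le>a. slope a b c d s = 0" using \<Psi>(2) slope0 by blast+
    note radial = radial_gradient[OF \<Psi>(1) slope_cont this, where x = x]
    have grad: "(f has_derivative (\<lambda>v. v \<bullet> F y)) (at y)" "continuous_on UNIV F"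
      "F (x + pol s t) = (exp (- s) * slope a b c d s) *\<^sub>R pol 0 t" for y s t
      unfolding f_def F_def by (rule radial)+
    define G where "G = (\<lambda>y. if y \<in> interior M then F y else 0)"
    have fL2: "f \<in> L2 M" and fG: "has_weak_gradient M f G"
      unfolding G_def using has_weak_gradient_classical[OF grad(1,2)] by blast+
    have fH1: "f \<in> H1 M" by (rule H1I[OF fL2 fG])
    have f_cont: "continuous_on UNIV f"
      by (intro continuous_at_imp_continuous_on ballI has_derivative_continuous[OF grad(1)])
    have f_val: "f (x + pol s t) = \<Psi> s" for s t
      unfolding f_def by (subst polar_pol) (auto simp: periodic_def)
    have "zero_qe_on M (intrinsic_ball M x \<epsilon>) f"
    proof (rule continuous_zero_qe[OF f_cont])
      fix y assume "y \<in> intrinsic_ball M x \<epsilon>"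
      then have "dist x y < \<epsilon>" using intrinsic_ball_subset by fastforce
      show "f y = 0"
      proof (cases "y = x")
        case False
        then obtain s t where y: "y = x + pol s t" using pol_exists by blast
        then have "exp s < \<epsilon>" using \<open>dist x y < \<epsilon>\<close> by (simp add: dist_norm)
        then have "s \<le> a" using \<epsilon> by (simp add: a_def) (metis exp_less_cancel_iff exp_ln less_imp_le)
        then show ?thesis unfolding y f_val by (rule \<Psi>(2))
      qed (simp add: f_def polar_def)
    qed
    moreover have "(1 - \<eta>) * (scale x \<epsilon> - C)\<^sup>2 \<le> L2_inner M f f"
    proof -
      interpret P: prob_space "nvol M" by (rule prob_space_nvol)
      have far: "scale x \<epsilon> - C \<le> f y" if "y \<notin> ball x R0" for y
      proof -
        have "y \<noteq> x" using that R0 by auto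
        then obtain s t where y: "y = x + pol s t" using pol_exists by blast
        then have "R0 \<le> exp s" using that by (simp add: dist_norm)
        then have "d \<le> s" using R0 by (metis d_def exp_le_cancel_iff exp_ln)
        then have "b - a + 2 * (d - c) - 6 \<le> f y" unfolding y f_val by (rule \<Psi>(3))
        moreover have "scale x \<epsilon> - C \<le> b - a + 2 * (d - c) - 6"
          using scale_le by (simp add: a_def b_def c_def d_def C_def)
        ultimately show ?thesis by linarith
      qed
      have ball_meas: "ball x R0 \<in> sets lebesgue" by simp
      have ballM: "measure (nvol M) (ball x R0) \<le> \<eta>"
      proof -
        have "measure (nvol M) (ball x R0) = (\<integral>y. indicator (ball x R0) y \<partial>(nvol M))" by simp
        also have "\<dots> = (LINT y:M|lebesgue. indicator (ball x R0) y) / vol"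
          by (rule integral_nvol[OF borel_measurable_indicator[OF ball_meas]])
        also have "(LINT y:M|lebesgue. indicator (ball x R0) y :: real) = measure lebesgue (M \<inter> ball x R0)"
          unfolding set_lebesgue_integral_def using M_lebesgue
          by (simp add: indicator_inter_arith[symmetric])
        also have "\<dots> \<le> measure lebesgue (ball x R0)"
          using M_lebesgue by (intro measure_mono_fmeasurable) auto
        also have "\<dots> = pi * R0\<^sup>2"
          using R0 by (simp add: content_ball unit_ball_vol_2)
        finally have "measure (nvol M) (ball x R0) \<le> pi * R0\<^sup>2 / vol"
          using vol_pos by (simp add: divide_right_mono)
        also have "\<dots> \<le> \<eta>" using R0(3) vol_pos by (simp add: divide_le_eq)
        finally show ?thesis .
      qed
      have "(1 - \<eta>) * (scale x \<epsilon> - C)\<^sup>2 \<le> measure (nvol M) (- ball x R0) * (scale x \<epsilon> - C)\<^sup>2"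
      proof (rule mult_right_mono)
        have "measure (nvol M) (- ball x R0) = 1 - measure (nvol M) (ball x R0)"
          using P.prob_compl[of "ball x R0"] by (simp add: Compl_eq_Diff_UNIV)
        then show "1 - \<eta> \<le> measure (nvol M) (- ball x R0)" using ballM by simp
      qed simp
      also have "\<dots> = (\<integral>y. indicator (- ball x R0) y * (scale x \<epsilon> - C)\<^sup>2 \<partial>(nvol M))" by simp
      also have "\<dots> \<le> (\<integral>y. f y * f y \<partial>(nvol M))"
      proof (rule integral_mono_AE)
        show "integrable (nvol M) (\<lambda>y. indicator (- ball x R0) y * (scale x \<epsilon> - C)\<^sup>2)"
          by (intro integrable_mult_left integrable_real_indicator) (auto simp: P.emeasure_eq_measure)
        show "integrable (nvol M) (\<lambda>y. f y * f y)" by (rule L2_mult_integrable[OF fL2 fL2])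
        show "AE y in nvol M. indicator (- ball x R0) y * (scale x \<epsilon> - C)\<^sup>2 \<le> f y * f y"
        proof (rule AE_I2)
          fix y
          show "indicator (- ball x R0) y * (scale x \<epsilon> - C)\<^sup>2 \<le> f y * f y"
          proof (cases "y \<in> ball x R0")
            case False
            have "(scale x \<epsilon> - C)\<^sup>2 \<le> (f y)\<^sup>2" using far[OF False] T by (intro power_mono) auto
            then show ?thesis using False by (simp add: power2_eq_square)
          qed simp
        qed
      qed
      finally show ?thesis by (simp add: L2_inner_def)
    qed
    moreover have "dirichlet_form M f f \<le> pi / vol * ((1 + \<eta>) * (scale x \<epsilon> + C))"
    proof -
      define W where "W = (b - a) * (2 * pi) + 4 * (d - c) * (2 * arccos (- \<gamma>))"
      have ac: "0 \<le> arccos (- \<gamma>)" using \<gamma> by (intro arccos_lbound) auto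
      have "(\<Sum>i\<in>UNIV. L2_inner M (\<lambda>y. G y $ i) (\<lambda>y. G y $ i)) \<le> W / vol"
      proof (rule energy_le_majorant)
        show "(\<lambda>y. G y $ i) \<in> L2 M" for i using fG by (simp add: has_weak_gradient_def)
        show "(norm (G y))\<^sup>2 \<le> indicator M y * (norm (F y))\<^sup>2" if "y \<in> M" for y
          using that by (simp add: G_def)
        show "0 \<le> W" using ord ac by (simp add: W_def)
        have two: "(\<Sum>j\<in>{0,1::nat}. g j) = g 0 + g 1" for g :: "nat \<Rightarrow> real" by simp
        define co where "co j = (if j = 0 then 1 else 4 :: real)" for j :: nat
        define lo where "lo j = (if j = 0 then a else c)" for j :: nat
        define hi where "hi j = (if j = 0 then b else d)" for j :: nat
        define wi where "wi j = (if j = 0 then pi else arccos (- \<gamma>))" for j :: nat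
        have "(\<integral>\<^sup>+ y. ennreal (indicator M y * (norm (F y))\<^sup>2) \<partial>lborel) \<le>
            ennreal (\<Sum>j\<in>{0,1::nat}. co j * max 0 (hi j - lo j) * (2 * wi j))"
        proof (rule nn_integral_log_polar_le[where x = x and \<tau> = \<tau>])
          show "(\<lambda>y. indicator M y * (norm (F y))\<^sup>2) \<in> borel_measurable borel"
            using M_borel borel_measurable_continuous_onI[OF grad(2)]
            by (intro borel_measurable_times borel_measurable_indicator borel_measurable_power borel_measurable_norm) auto
          show "0 \<le> co j" "0 \<le> wi j" for j using ac by (auto simp: co_def wi_def)
          fix s t assume t: "\<bar>t - \<tau>\<bar> < pi"
          have "(exp (- s))\<^sup>2 * exp (2 * s) = (1::real)"
            by (simp add: power2_eq_square flip: exp_add)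
          moreover have "(norm (F (x + pol s t)))\<^sup>2 = (exp (- s))\<^sup>2 * (slope a b c d s)\<^sup>2"
            unfolding grad(3) by (simp add: power_mult_distrib)
          ultimately have eq: "indicator M (x + pol s t) * (norm (F (x + pol s t)))\<^sup>2 * exp (2 * s) =
              indicator M (x + pol s t) * (slope a b c d s)\<^sup>2"
            by algebra
          have tpi: "indicator {\<tau> - pi..\<tau> + pi} t = (1::real)" using t by (auto simp: indicator_def)
          have expand: "(\<Sum>j\<in>{0,1::nat}. co j * indicator {lo j..hi j} s * indicator {\<tau> - wi j..\<tau> + wi j} t) =
              indicator {a..b} s + 4 * indicator {c..d} s * indicator {\<tau> - arccos (- \<gamma>)..\<tau> + arccos (- \<gamma>)} t"
            unfolding two by (simp add: co_def lo_def hi_def wi_def tpi)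
          show "indicator M (x + pol s t) * (norm (F (x + pol s t)))\<^sup>2 * exp (2 * s) \<le>
              (\<Sum>j\<in>{0,1::nat}. co j * indicator {lo j..hi j} s * indicator {\<tau> - wi j..\<tau> + wi j} t)"
            unfolding eq expand
          proof (cases "x + pol s t \<in> M \<and> slope a b c d s \<noteq> 0")
            case False
            then have "indicator M (x + pol s t) * (slope a b c d s)\<^sup>2 = 0" by auto
            moreover have "0 \<le> (indicator {a..b} s + 4 * indicator {c..d} s *
                indicator {\<tau> - arccos (- \<gamma>)..\<tau> + arccos (- \<gamma>)} t :: real)"
              by (intro add_nonneg_nonneg mult_nonneg_nonneg) auto
            ultimately show "indicator M (x + pol s t) * (slope a b c d s)\<^sup>2 \<le>
              indicator {a..b} s + 4 * indicator {c..d} s * indicator {\<tau> - arccos (- \<gamma>)..\<tau> + arccos (- \<gamma>)} t" by linarith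
          next
            case True
            show "indicator M (x + pol s t) * (slope a b c d s)\<^sup>2 \<le>
              indicator {a..b} s + 4 * indicator {c..d} s * indicator {\<tau> - arccos (- \<gamma>)..\<tau> + arccos (- \<gamma>)} t"
            proof (cases "s \<le> b")
              case s: True
              then have "trap c d s = 0" using ord by (intro trap_0) auto
              then have sl: "slope a b c d s = trap a b s" by (simp add: slope_def)
              then have "s \<in> {a..b}" using True trap_0[of s a b] s by force
              then have "indicator {a..b} s = (1::real)" by simp
              moreover have "(trap a b s)\<^sup>2 \<le> 1" using trap_bounds[of a b s] by (simp add: power_le_one)
              moreover have "indicator M (x + pol s t) * (slope a b c d s)\<^sup>2 = (trap a b s)\<^sup>2"
                using True sl by simp
              moreover have "0 \<le> (4 * indicator {c..d} s *
                  indicator {\<tau> - arccos (- \<gamma>)..\<tau> + arccos (- \<gamma>)} t :: real)"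
                by (intro mult_nonneg_nonneg) auto
              ultimately show ?thesis by linarith
            next
              case s: False
              then have "trap a b s = 0" by (intro trap_0) auto
              then have sl: "slope a b c d s = 2 * trap c d s" by (simp add: slope_def)
              then have cd: "c < s" "s < d" using True trap_0[of s c d] by force+
              then have "c < d" by simp
              have "D < R1"
              proof (rule ccontr)
                assume "\<not> D < R1"
                then have "D = R1" using D by simp
                then have "c = d" using k R0 by (simp add: c_def d_def R1_def ln_divide_pos)
                then show False using \<open>c < d\<close> by simp
              qed
              then have \<delta>D: "\<delta> \<le> D" by (auto simp: D_def max_def min_def split: if_splits)
              have "- \<gamma> \<le> cos (t - \<tau>)"
              proof (rule \<tau>)
                have "exp c = k * D" using k D by (simp add: c_def exp_add)
                then have "k * D \<le> exp s" using cd by (metis exp_le_cancel_iff less_imp_le)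
                moreover have "k * \<delta> \<le> k * D" using \<delta>D k by (intro mult_left_mono) auto
                ultimately show "k * \<delta> \<le> exp s" by linarith
                have "exp s \<le> exp d" using cd by simp
                also have "exp d = R0" using R0 by (simp add: d_def)
                finally show "exp s \<le> R" using R0 by simp
                show "x + pol s t \<in> M" using True by simp
              qed
              then have "\<bar>t - \<tau>\<bar> \<le> arccos (- \<gamma>)"
              proof -
                have "arccos (cos \<bar>t - \<tau>\<bar>) \<le> arccos (- \<gamma>)"
                  using \<open>- \<gamma> \<le> cos (t - \<tau>)\<close> \<gamma> by (intro arccos_le_mono[THEN iffD2]) auto
                moreover have "arccos (cos \<bar>t - \<tau>\<bar>) = \<bar>t - \<tau>\<bar>"
                  using t by (intro arccos_cos) auto
                ultimately show ?thesis by linarith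
              qed
              then have "t \<in> {\<tau> - arccos (- \<gamma>)..\<tau> + arccos (- \<gamma>)}" by auto
              moreover have "(2 * trap c d s)\<^sup>2 \<le> 4"
                using trap_bounds[of c d s] power_le_one[of "trap c d s" 2] by (simp add: power_mult_distrib)
              moreover have "0 \<le> (indicator {a..b} s :: real)" by simp
              ultimately show ?thesis using True sl cd by (simp add: add_increasing)
            qed
          qed
        qed simp
        also have "(\<Sum>j\<in>{0,1::nat}. co j * max 0 (hi j - lo j) * (2 * wi j)) = W"
          unfolding two using ord by (simp add: co_def lo_def hi_def wi_def W_def)
        finally show "(\<integral>\<^sup>+ y. ennreal (indicator M y * (norm (F y))\<^sup>2) \<partial>lborel) \<le> ennreal W" .
      qed
      then have "dirichlet_form M f f \<le> W / vol / 2"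
        unfolding dirichlet_form_eq[OF fL2 fG fL2 fG] by simp
      also have "W / vol / 2 \<le> pi / vol * ((1 + \<eta>) * (scale x \<epsilon> + C))"
      proof -
        have "4 * (d - c) * (2 * arccos (- \<gamma>)) \<le> 4 * (d - c) * (2 * (pi / 2 * (1 + \<eta>)))"
          using \<gamma> ord by (intro mult_left_mono) auto
        moreover have "(b - a) * (2 * pi) \<le> (1 + \<eta>) * ((b - a) * (2 * pi))"
          using ord \<eta> mult_right_mono[of 1 "1 + \<eta>" "(b - a) * (2 * pi)"] by simp
        ultimately have "W \<le> (1 + \<eta>) * ((b - a) * (2 * pi)) + 4 * (d - c) * (2 * (pi / 2 * (1 + \<eta>)))"
          unfolding W_def by linarith
        also have "\<dots> = 2 * pi * ((1 + \<eta>) * (- ln \<epsilon> - ln D + 2 * ln R0 - 2 * ln k))"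
          by (simp add: a_def b_def c_def d_def field_simps)
        also have "\<dots> \<le> 2 * pi * ((1 + \<eta>) * (scale x \<epsilon> + C))"
          using scale_ge lnk \<eta> by (intro mult_left_mono) (auto simp: C_def)
        finally have "W / (2 * vol) \<le> 2 * pi * ((1 + \<eta>) * (scale x \<epsilon> + C)) / (2 * vol)"
          using vol_pos by (intro divide_right_mono) auto
        then show ?thesis by simp
      qed
      finally show ?thesis .
    qed
    ultimately show "\<exists>f\<in>H1 M. zero_qe_on M (intrinsic_ball M x \<epsilon>) f \<and> (1 - \<eta>) * (scale x \<epsilon> - C)\<^sup>2 \<le> L2_inner M f f \<and>
        dirichlet_form M f f \<le> pi / vol * ((1 + \<eta>) * (scale x \<epsilon> + C))"
      using fH1 by blast
  qed
qed

end

section \<open>Asymptotics\<close>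

lemma upper_rate: "((\<lambda>T. (T + C) * T / (T - C)\<^sup>2) \<longlongrightarrow> (1::real)) at_top"
  by real_asymp

lemma lower_rate:
  assumes "0 < p" "0 < q"
  shows "((\<lambda>T. T * p / (sqrt (p * (q * T + C)) + C)\<^sup>2) \<longlongrightarrow> (1::real) / q) at_top"
proof -
  have "((\<lambda>T. T * p / (sqrt (p * (q * T + C)) + C)\<^sup>2) \<longlongrightarrow> p * inverse (((p * q) powr (1 / 2))\<^sup>2)) at_top"
    using assms by real_asymp
  moreover have "p * inverse (((p * q) powr (1 / 2))\<^sup>2) = 1 / q"
    using assms by (simp add: powr_half_sqrt field_simps)
  ultimately show ?thesis by simp
qed

context plane_domain
begin

lemma eigenvalue_le:
  assumes f: "f \<in> H1 M" "zero_qe_on M A f" and L: "0 < l" "l \<le> L2_inner M f f" and E: "dirichlet_form M f f \<le> e"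
  shows "dirichlet_eigenvalue M A \<le> e / l"
proof -
  let ?S = "{dirichlet_form M f f / (L2_norm M f)\<^sup>2 | f. f \<in> H1 M \<and> zero_qe_on M A f \<and> \<not> (AE y in nvol M. f y = 0)}"
  have "\<not> (AE y in nvol M. f y = 0)"
    using L2_inner_self_eq_0[OF H1_L2[OF f(1)]] L by auto
  then have "dirichlet_form M f f / (L2_norm M f)\<^sup>2 \<in> ?S" using f by blast
  moreover have "bdd_below ?S"
  proof (rule bdd_belowI[of _ 0])
    fix r assume "r \<in> ?S"
    then obtain g where "r = dirichlet_form M g g / (L2_norm M g)\<^sup>2" by blast
    then show "0 \<le> r" by (simp add: dirichlet_form_nonneg)
  qed
  ultimately have "dirichlet_eigenvalue M A \<le> dirichlet_form M f f / (L2_norm M f)\<^sup>2"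
    unfolding dirichlet_eigenvalue_def by (rule cInf_lower)
  also have "\<dots> \<le> e / l"
    unfolding L2_norm_square using L E dirichlet_form_nonneg[of f] by (intro frac_le) auto
  finally show ?thesis .
qed

lemma eigenvalue_ge:
  assumes ex: "g \<in> H1 M" "zero_qe_on M A g" "0 < L2_inner M g g"
    and b: "\<And>f. f \<in> H1 M \<Longrightarrow> zero_qe_on M A f \<Longrightarrow> sqrt (L2_inner M f f) \<le> sqrt (dirichlet_form M f f) * b"
      "0 < b"
  shows "1 / b\<^sup>2 \<le> dirichlet_eigenvalue M A"
  unfolding dirichlet_eigenvalue_def
proof (rule cInf_greatest)
  let ?S = "{dirichlet_form M f f / (L2_norm M f)\<^sup>2 | f. f \<in> H1 M \<and> zero_qe_on M A f \<and> \<not> (AE y in nvol M. f y = 0)}"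
  have "\<not> (AE y in nvol M. g y = 0)"
    using L2_inner_self_eq_0[OF H1_L2[OF ex(1)]] ex(3) by auto
  then have "dirichlet_form M g g / (L2_norm M g)\<^sup>2 \<in> ?S" using ex by blast
  then show "?S \<noteq> {}" by blast
  fix r assume "r \<in> ?S"
  then obtain f where r: "r = dirichlet_form M f f / (L2_norm M f)\<^sup>2"
    and f: "f \<in> H1 M" "zero_qe_on M A f" "\<not> (AE y in nvol M. f y = 0)" by blast
  have pos: "0 < L2_inner M f f"
    using L2_inner_self_eq_0[OF H1_L2[OF f(1)]] f(3) L2_inner_nonneg[of f] by fastforce
  have "(sqrt (L2_inner M f f))\<^sup>2 \<le> (sqrt (dirichlet_form M f f) * b)\<^sup>2"
    using b(1)[OF f(1,2)] pos by (intro power_mono) auto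
  then have "L2_inner M f f \<le> dirichlet_form M f f * b\<^sup>2"
    using pos dirichlet_form_nonneg[of f] by (simp add: power_mult_distrib)
  then show "1 / b\<^sup>2 \<le> r"
    unfolding r L2_norm_square using pos b(2) by (simp add: field_simps)
qed

lemma eventually_small: "0 < (e::real) \<Longrightarrow> \<forall>\<^sub>F \<epsilon> in at_right 0. 0 < \<epsilon> \<and> \<epsilon> < e"
  using eventually_at_right_real[of 0 e] by (auto elim!: eventually_mono)

lemma scale_at_top:
  assumes "\<And>\<epsilon>. 0 < \<epsilon> \<Longrightarrow> x \<epsilon> \<in> M"
  shows "filterlim (\<lambda>\<epsilon>. scale (x \<epsilon>) \<epsilon>) at_top (at_right 0)"
proof -
  obtain \<Delta> where \<Delta>: "1 \<le> \<Delta>" "\<And>x. x \<in> M \<Longrightarrow> infdist x (frontier M) \<le> \<Delta>"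
    by (rule infdist_frontier_bound) (rule that, assumption, blast)
  have "filterlim (\<lambda>\<epsilon>::real. - ln \<epsilon> - ln \<Delta>) at_top (at_right 0)"
    by real_asymp
  moreover have "\<forall>\<^sub>F \<epsilon> in at_right 0. - ln \<epsilon> - ln \<Delta> \<le> scale (x \<epsilon>) \<epsilon>"
    using eventually_small[OF zero_less_one]
  proof eventually_elim
    case (elim \<epsilon>)
    have "max \<epsilon> (infdist (x \<epsilon>) (frontier M)) \<le> \<Delta>" using \<Delta>(1) \<Delta>(2)[OF assms[of \<epsilon>]] elim by simp
    then have "ln (max \<epsilon> (infdist (x \<epsilon>) (frontier M))) \<le> ln \<Delta>" using elim by (subst ln_le_cancel_iff) auto
    then show ?case by (simp add: scale_def)
  qed
  ultimately show ?thesis by (rule filterlim_at_top_mono)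
qed

text \<open>The constants in the two bounds do not depend on the center, so for fixed \<open>\<eta>\<close> they disappear in
  the limit, because the scale tends to infinity; then \<open>\<eta>\<close> is arbitrary.\<close>

lemma eigenvalue_scale:
  assumes C11: "uniformly_C11_boundary M" and comparable: "intrinsic_euclidean_comparable M"
    and spectrum: "discrete_neumann_spectrum_with_gap M" and x: "\<And>\<epsilon>. 0 < \<epsilon> \<Longrightarrow> x \<epsilon> \<in> M"
  shows "((\<lambda>\<epsilon>. dirichlet_eigenvalue M (intrinsic_ball M (x \<epsilon>) \<epsilon>) * (vol / pi) * scale (x \<epsilon>) \<epsilon>) \<longlongrightarrow> 1) (at_right 0)"
proof (rule order_tendstoI)
  define T where "T \<epsilon> = scale (x \<epsilon>) \<epsilon>" for \<epsilon>
  define \<Lambda> where "\<Lambda> \<epsilon> = dirichlet_eigenvalue M (intrinsic_ball M (x \<epsilon>) \<epsilon>)" for \<epsilon>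
  have T: "filterlim T at_top (at_right 0)"
    unfolding T_def[abs_def] by (rule scale_at_top[OF x])
  have p: "0 < vol / pi" using vol_pos by simp
  have test: "\<exists>C. \<forall>\<^sub>F \<epsilon> in at_right 0. 0 \<le> C \<and> C < T \<epsilon> \<and> (\<exists>f\<in>H1 M. zero_qe_on M (intrinsic_ball M (x \<epsilon>) \<epsilon>) f \<and>
      (1 - \<eta>) * (T \<epsilon> - C)\<^sup>2 \<le> L2_inner M f f \<and> dirichlet_form M f f \<le> pi / vol * ((1 + \<eta>) * (T \<epsilon> + C)))"
    if \<eta>: "0 < \<eta>" for \<eta>
  proof -
    obtain C \<epsilon>0 where C: "0 < \<epsilon>0" "\<epsilon>0 \<le> 1" "0 \<le> C" and U:
    "\<And>x \<epsilon>. x \<in> M \<Longrightarrow> 0 < \<epsilon> \<Longrightarrow> \<epsilon> < \<epsilon>0 \<Longrightarrow> C < scale x \<epsilon> \<Longrightarrow>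
      \<exists>f\<in>H1 M. zero_qe_on M (intrinsic_ball M x \<epsilon>) f \<and> (1 - \<eta>) * (scale x \<epsilon> - C)\<^sup>2 \<le> L2_inner M f f \<and>
        dirichlet_form M f f \<le> pi / vol * ((1 + \<eta>) * (scale x \<epsilon> + C))"
      by (rule eigenvalue_upper_bound[OF C11 \<eta>]) (rule that, assumption, assumption, assumption, blast)
    have "\<forall>\<^sub>F \<epsilon> in at_right 0. C < T \<epsilon>" using T by (auto simp: filterlim_at_top_dense)
    with eventually_small[OF C(1)] show ?thesis
    proof (intro exI[of _ C], eventually_elim)
      case (elim \<epsilon>)
      then show ?case using C(3) U[OF x, of \<epsilon> \<epsilon>] by (auto simp: T_def)
    qed
  qed
  fix a :: real
  assume a: "a < 1"
  define \<eta> where "\<eta> = (1 - max a 0) / 2"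
  have \<eta>: "0 < \<eta>" "\<eta> \<le> 1 / 2" using a by (auto simp: \<eta>_def)
  have a_lt: "a < 1 / (1 + \<eta>)"
  proof -
    have "max a 0 * (1 + \<eta>) < 1"
    proof -
      have "max a 0 * (1 + \<eta>) \<le> max a 0 + \<eta>" using mult_right_mono[of "max a 0" 1 \<eta>] a \<eta> by (simp add: algebra_simps)
      also have "\<dots> < 1" using a by (simp add: \<eta>_def max_def field_simps)
      finally show ?thesis .
    qed
    moreover have "0 < 1 + \<eta>" using \<eta> by simp
    ultimately have "max a 0 < 1 / (1 + \<eta>)" by (simp only: pos_less_divide_eq)
    then show ?thesis by simp
  qed
  obtain C \<epsilon>0 where C: "0 < \<epsilon>0" "\<epsilon>0 \<le> 1" "0 \<le> C" and L:
    "\<And>x \<epsilon> f. x \<in> M \<Longrightarrow> 0 < \<epsilon> \<Longrightarrow> \<epsilon> < \<epsilon>0 \<Longrightarrow> f \<in> H1 M \<Longrightarrow> zero_qe_on M (intrinsic_ball M x \<epsilon>) f \<Longrightarrow>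
      sqrt (L2_inner M f f) \<le> sqrt (dirichlet_form M f f) *
        (sqrt (vol / pi * ((1 + \<eta>) * scale x \<epsilon> + C)) + C)"
    by (rule eigenvalue_lower_bound[OF C11 comparable spectrum \<eta>(1)]) (rule that, assumption, assumption, assumption, blast)
  \<comment> \<open>The function \<open>g\<close> shows that the infimum in the definition of the eigenvalue is not over the empty set.\<close>
  obtain C' where C': "\<forall>\<^sub>F \<epsilon> in at_right 0. 0 \<le> C' \<and> C' < T \<epsilon> \<and> (\<exists>f\<in>H1 M. zero_qe_on M (intrinsic_ball M (x \<epsilon>) \<epsilon>) f \<and>
      (1 - \<eta>) * (T \<epsilon> - C')\<^sup>2 \<le> L2_inner M f f \<and> dirichlet_form M f f \<le> pi / vol * ((1 + \<eta>) * (T \<epsilon> + C')))"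
    using test[OF \<eta>(1)] by blast
  have "((\<lambda>t. t * (vol / pi) / (sqrt (vol / pi * ((1 + \<eta>) * t + C)) + C)\<^sup>2) \<longlongrightarrow> 1 / (1 + \<eta>)) at_top"
    by (rule lower_rate[OF p]) (use \<eta> in simp)
  from order_tendstoD(1)[OF filterlim_compose[OF this T] a_lt] eventually_small[OF C(1)] C'
  show "\<forall>\<^sub>F \<epsilon> in at_right 0. a < dirichlet_eigenvalue M (intrinsic_ball M (x \<epsilon>) \<epsilon>) * (vol / pi) * scale (x \<epsilon>) \<epsilon>"
  proof eventually_elim
    case (elim \<epsilon>)
    define b where "b = sqrt (vol / pi * ((1 + \<eta>) * T \<epsilon> + C)) + C"
    have Tpos: "0 < T \<epsilon>" using elim by linarith
    have "0 < (1 + \<eta>) * T \<epsilon> + C" using Tpos \<eta> C by (intro add_pos_nonneg mult_pos_pos) auto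
    then have "0 < sqrt (vol / pi * ((1 + \<eta>) * T \<epsilon> + C))"
      by (simp only: real_sqrt_gt_0_iff mult_pos_pos[OF p])
    then have b: "0 < b" unfolding b_def using C(3) by (rule add_pos_nonneg)
    obtain g where g: "g \<in> H1 M" "zero_qe_on M (intrinsic_ball M (x \<epsilon>) \<epsilon>) g" "(1 - \<eta>) * (T \<epsilon> - C')\<^sup>2 \<le> L2_inner M g g"
      using elim by blast
    have "0 < (1 - \<eta>) * (T \<epsilon> - C')\<^sup>2" using elim \<eta> by (intro mult_pos_pos) auto
    then have g0: "0 < L2_inner M g g" using g(3) by linarith
    have "1 / b\<^sup>2 \<le> \<Lambda> \<epsilon>"
      unfolding \<Lambda>_def by (rule eigenvalue_ge[OF g(1,2) g0 _ b]) (use L[OF x] elim in \<open>auto simp: b_def T_def\<close>)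
    then have "1 / b\<^sup>2 * ((vol / pi) * T \<epsilon>) \<le> \<Lambda> \<epsilon> * ((vol / pi) * T \<epsilon>)"
      by (rule mult_right_mono) (rule less_imp_le[OF mult_pos_pos[OF p Tpos]])
    moreover have "1 / b\<^sup>2 * ((vol / pi) * T \<epsilon>) = T \<epsilon> * (vol / pi) / b\<^sup>2" by (simp add: mult.commute)
    ultimately show ?case using elim(1) by (simp add: b_def \<Lambda>_def T_def mult.assoc)
  qed
next
  define T where "T \<epsilon> = scale (x \<epsilon>) \<epsilon>" for \<epsilon>
  have T: "filterlim T at_top (at_right 0)"
    unfolding T_def[abs_def] by (rule scale_at_top[OF x])
  have p: "0 < vol / pi" using vol_pos by simp
  fix a :: real
  assume a: "1 < a"
  define \<eta> where "\<eta> = (a - 1) / (2 * (a + 1))"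
  have \<eta>: "0 < \<eta>" "\<eta> < 1" using a by (auto simp: \<eta>_def field_simps)
  have a_gt: "(1 + \<eta>) / (1 - \<eta>) * 1 < a"
  proof -
    have "1 + \<eta> < a * (1 - \<eta>)"
    proof -
      have "\<eta> * (a + 1) = (a - 1) / 2" using a by (simp add: \<eta>_def field_simps)
      then show ?thesis using a by (simp add: algebra_simps)
    qed
    then show ?thesis using \<eta> by (simp add: pos_divide_less_eq)
  qed
  obtain C \<epsilon>0 where C: "0 < \<epsilon>0" "\<epsilon>0 \<le> 1" "0 \<le> C" and U:
    "\<And>x \<epsilon>. x \<in> M \<Longrightarrow> 0 < \<epsilon> \<Longrightarrow> \<epsilon> < \<epsilon>0 \<Longrightarrow> C < scale x \<epsilon> \<Longrightarrow>
      \<exists>f\<in>H1 M. zero_qe_on M (intrinsic_ball M x \<epsilon>) f \<and> (1 - \<eta>) * (scale x \<epsilon> - C)\<^sup>2 \<le> L2_inner M f f \<and>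
        dirichlet_form M f f \<le> pi / vol * ((1 + \<eta>) * (scale x \<epsilon> + C))"
    by (rule eigenvalue_upper_bound[OF C11 \<eta>(1)]) (rule that, assumption, assumption, assumption, blast)
  have "((\<lambda>t. (1 + \<eta>) / (1 - \<eta>) * ((t + C) * t / (t - C)\<^sup>2)) \<longlongrightarrow> (1 + \<eta>) / (1 - \<eta>) * 1) at_top"
    by (intro tendsto_mult tendsto_const upper_rate)
  from order_tendstoD(2)[OF filterlim_compose[OF this T] a_gt] eventually_small[OF C(1)]
    filterlim_at_top_dense[THEN iffD1, OF T, rule_format, of C]
  show "\<forall>\<^sub>F \<epsilon> in at_right 0. dirichlet_eigenvalue M (intrinsic_ball M (x \<epsilon>) \<epsilon>) * (vol / pi) * scale (x \<epsilon>) \<epsilon> < a"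
  proof eventually_elim
    case (elim \<epsilon>)
    then obtain f where f: "f \<in> H1 M" "zero_qe_on M (intrinsic_ball M (x \<epsilon>) \<epsilon>) f"
      "(1 - \<eta>) * (T \<epsilon> - C)\<^sup>2 \<le> L2_inner M f f" "dirichlet_form M f f \<le> pi / vol * ((1 + \<eta>) * (T \<epsilon> + C))"
      using U[OF x, of \<epsilon> \<epsilon>] unfolding T_def by blast
    have Tpos: "0 < T \<epsilon>" using elim C by linarith
    have l: "0 < (1 - \<eta>) * (T \<epsilon> - C)\<^sup>2" using elim \<eta> by (intro mult_pos_pos) auto
    have "dirichlet_eigenvalue M (intrinsic_ball M (x \<epsilon>) \<epsilon>) \<le>
        (pi / vol * ((1 + \<eta>) * (T \<epsilon> + C))) / ((1 - \<eta>) * (T \<epsilon> - C)\<^sup>2)"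
      by (rule eigenvalue_le[OF f(1,2) l f(3,4)])
    then have "dirichlet_eigenvalue M (intrinsic_ball M (x \<epsilon>) \<epsilon>) * ((vol / pi) * T \<epsilon>) \<le>
        (pi / vol * ((1 + \<eta>) * (T \<epsilon> + C))) / ((1 - \<eta>) * (T \<epsilon> - C)\<^sup>2) * ((vol / pi) * T \<epsilon>)"
      by (rule mult_right_mono) (rule less_imp_le[OF mult_pos_pos[OF p Tpos]])
    also have "\<dots> = (1 + \<eta>) / (1 - \<eta>) * ((T \<epsilon> + C) * T \<epsilon> / (T \<epsilon> - C)\<^sup>2)"
    proof -
      have "p / v * y / z * (v / p * t) = y * t / z" if "0 < p" "0 < v" for p v y z t :: real
        using that by simp
      from this[OF pi_gt_zero vol_pos] show ?thesis by (simp only: times_divide_times_eq mult.assoc)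
    qed
    finally show ?case using elim(1) by (simp add: T_def mult.assoc)
  qed
qed

lemma eigenvalue_asymptotic:
  assumes C11: "uniformly_C11_boundary M" and comparable: "intrinsic_euclidean_comparable M"
    and spectrum: "discrete_neumann_spectrum_with_gap M" and x: "\<And>\<epsilon>. 0 < \<epsilon> \<Longrightarrow> x \<epsilon> \<in> M"
    and \<theta>: "0 \<le> \<theta>" and ratio: "((\<lambda>\<epsilon>. ln (1 / max \<epsilon> (infdist (x \<epsilon>) (frontier M))) / ln (1 / \<epsilon>)) \<longlongrightarrow> \<theta>) (at_right 0)"
  shows "(\<lambda>\<epsilon>. dirichlet_eigenvalue M (intrinsic_ball M (x \<epsilon>) \<epsilon>)) \<sim>[at_right 0]
    (\<lambda>\<epsilon>. boundary_factor \<theta> * (pi / (measure lebesgue M * ln (1 / \<epsilon>))))"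
proof (rule asymp_equivI')
  let ?\<Lambda> = "\<lambda>\<epsilon>. dirichlet_eigenvalue M (intrinsic_ball M (x \<epsilon>) \<epsilon>)"
  let ?r = "\<lambda>\<epsilon>. ln (1 / max \<epsilon> (infdist (x \<epsilon>) (frontier M))) / ln (1 / \<epsilon>)"
  have "((\<lambda>\<epsilon>. ?\<Lambda> \<epsilon> * (vol / pi) * scale (x \<epsilon>) \<epsilon> * ((1 + \<theta>) / (1 + ?r \<epsilon>))) \<longlongrightarrow> 1 * ((1 + \<theta>) / (1 + \<theta>))) (at_right 0)"
    using \<theta> by (intro tendsto_intros eigenvalue_scale[OF C11 comparable spectrum x] ratio) auto
  then have lim: "((\<lambda>\<epsilon>. ?\<Lambda> \<epsilon> * (vol / pi) * scale (x \<epsilon>) \<epsilon> * ((1 + \<theta>) / (1 + ?r \<epsilon>))) \<longlongrightarrow> 1) (at_right 0)"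
    using \<theta> by simp
  have T: "\<forall>\<^sub>F \<epsilon> in at_right 0. 0 < scale (x \<epsilon>) \<epsilon>"
    using scale_at_top[OF x] by (auto simp: filterlim_at_top_dense)
  have "\<forall>\<^sub>F \<epsilon> in at_right 0. ?\<Lambda> \<epsilon> * (vol / pi) * scale (x \<epsilon>) \<epsilon> * ((1 + \<theta>) / (1 + ?r \<epsilon>)) =
      ?\<Lambda> \<epsilon> / (boundary_factor \<theta> * (pi / (measure lebesgue M * ln (1 / \<epsilon>))))"
    using T eventually_small[OF zero_less_one]
  proof eventually_elim
    case (elim \<epsilon>)
    define l where "l = ln (1 / \<epsilon>)"
    have l: "0 < l" using elim by (simp add: l_def)
    have m: "0 < max \<epsilon> (infdist (x \<epsilon>) (frontier M))" using elim by (simp add: less_max_iff_disj)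
    have "scale (x \<epsilon>) \<epsilon> = l + ln (1 / max \<epsilon> (infdist (x \<epsilon>) (frontier M)))"
      using elim m by (simp add: scale_def l_def ln_div)
    then have "1 + ?r \<epsilon> = scale (x \<epsilon>) \<epsilon> / l" using l by (simp add: l_def[symmetric] field_simps)
    then have "scale (x \<epsilon>) \<epsilon> * ((1 + \<theta>) / (1 + ?r \<epsilon>)) = l * (1 + \<theta>)" using elim(1) l by simp
    then have "?\<Lambda> \<epsilon> * (vol / pi) * scale (x \<epsilon>) \<epsilon> * ((1 + \<theta>) / (1 + ?r \<epsilon>)) = ?\<Lambda> \<epsilon> * (vol / pi) * (l * (1 + \<theta>))"
      by (simp only: mult.assoc)
    also have "\<dots> = ?\<Lambda> \<epsilon> / (boundary_factor \<theta> * (pi / (measure lebesgue M * ln (1 / \<epsilon>))))"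
      using \<theta> by (simp add: boundary_factor_def vol_def l_def field_simps)
    finally show ?case .
  qed
  from Lim_transform_eventually[OF lim this]
  show "((\<lambda>\<epsilon>. ?\<Lambda> \<epsilon> / (boundary_factor \<theta> * (pi / (measure lebesgue M * ln (1 / \<epsilon>))))) \<longlongrightarrow> 1) (at_right 0)" .
qed

lemma ratio_boundary:
  assumes "(\<lambda>\<epsilon>. infdist (x \<epsilon>) (frontier M)) \<in> O[at_right 0](\<lambda>\<epsilon>. \<epsilon>)"
  shows "((\<lambda>\<epsilon>. ln (1 / max \<epsilon> (infdist (x \<epsilon>) (frontier M))) / ln (1 / \<epsilon>)) \<longlongrightarrow> 1) (at_right 0)"
proof -
  obtain c where c: "0 < c" "\<forall>\<^sub>F \<epsilon> in at_right 0. norm (infdist (x \<epsilon>) (frontier M)) \<le> c * norm \<epsilon>"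
    using assms by (elim landau_o.bigE)
  define K where "K = max 1 c"
  have lim: "((\<lambda>\<epsilon>::real. 1 - ln K / ln (1 / \<epsilon>)) \<longlongrightarrow> 1) (at_right 0)" by real_asymp
  have "\<forall>\<^sub>F \<epsilon> in at_right 0. 1 - ln K / ln (1 / \<epsilon>) \<le> ln (1 / max \<epsilon> (infdist (x \<epsilon>) (frontier M))) / ln (1 / \<epsilon>)
      \<and> ln (1 / max \<epsilon> (infdist (x \<epsilon>) (frontier M))) / ln (1 / \<epsilon>) \<le> 1"
    using c(2) eventually_small[OF zero_less_one]
  proof eventually_elim
    case (elim \<epsilon>)
    define m where "m = max \<epsilon> (infdist (x \<epsilon>) (frontier M))"
    have m: "0 < m" "\<epsilon> \<le> m" using elim by (auto simp: m_def)
    have "c * \<epsilon> \<le> K * \<epsilon>" "1 * \<epsilon> \<le> K * \<epsilon>" using elim by (auto intro!: mult_right_mono simp: K_def)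
    moreover have "infdist (x \<epsilon>) (frontier M) \<le> c * \<epsilon>" using elim by simp
    ultimately have "m \<le> K * \<epsilon>" unfolding m_def by (intro max.boundedI) linarith+
    then have "ln m \<le> ln (K * \<epsilon>)" using m by simp
    moreover have "ln (K * \<epsilon>) = ln K + ln \<epsilon>" using elim by (intro ln_mult_pos) (auto simp: K_def)
    moreover have "ln \<epsilon> \<le> ln m" using m elim by simp
    moreover have "ln (1 / m) = - ln m" "ln (1 / \<epsilon>) = - ln \<epsilon>" using m elim by (simp_all add: ln_div)
    ultimately have le: "ln (1 / \<epsilon>) - ln K \<le> ln (1 / m)" "ln (1 / m) \<le> ln (1 / \<epsilon>)" by linarith+
    have l: "0 < ln (1 / \<epsilon>)" using elim by simp
    have "1 - ln K / ln (1 / \<epsilon>) = (ln (1 / \<epsilon>) - ln K) / ln (1 / \<epsilon>)"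
      using l by (simp add: diff_divide_distrib)
    also have "\<dots> \<le> ln (1 / m) / ln (1 / \<epsilon>)" using le(1) l by (intro divide_right_mono) linarith+
    finally show ?case unfolding m_def[symmetric] using le(2) l by (simp only: divide_le_eq_1_pos simp_thms)
  qed
  then have "\<forall>\<^sub>F \<epsilon> in at_right 0. 1 - ln K / ln (1 / \<epsilon>) \<le> ln (1 / max \<epsilon> (infdist (x \<epsilon>) (frontier M))) / ln (1 / \<epsilon>)"
    "\<forall>\<^sub>F \<epsilon> in at_right 0. ln (1 / max \<epsilon> (infdist (x \<epsilon>) (frontier M))) / ln (1 / \<epsilon>) \<le> 1"
    by (auto elim: eventually_mono)
  then show ?thesis by (rule tendsto_sandwich) (rule lim tendsto_const)+
qed

lemma ratio_intermediate:
  assumes "(\<lambda>\<epsilon>. \<epsilon>) \<in> o[at_right 0](\<lambda>\<epsilon>. infdist (x \<epsilon>) (frontier M))"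
    and "((\<lambda>\<epsilon>. ln (1 / infdist (x \<epsilon>) (frontier M)) / ln (1 / \<epsilon>)) \<longlongrightarrow> \<theta>) (at_right 0)"
  shows "((\<lambda>\<epsilon>. ln (1 / max \<epsilon> (infdist (x \<epsilon>) (frontier M))) / ln (1 / \<epsilon>)) \<longlongrightarrow> \<theta>) (at_right 0)"
proof (rule Lim_transform_eventually[OF assms(2)])
  have "\<forall>\<^sub>F \<epsilon> in at_right 0. norm \<epsilon> \<le> 1 * norm (infdist (x \<epsilon>) (frontier M))"
    using assms(1) zero_less_one by (rule landau_o.smallD)
  with eventually_small[OF zero_less_one]
  show "\<forall>\<^sub>F \<epsilon> in at_right 0. ln (1 / infdist (x \<epsilon>) (frontier M)) / ln (1 / \<epsilon>) =
      ln (1 / max \<epsilon> (infdist (x \<epsilon>) (frontier M))) / ln (1 / \<epsilon>)"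
    by eventually_elim (simp add: infdist_nonneg max_def)
qed

lemma ratio_interior:
  assumes x: "\<And>\<epsilon>. 0 < \<epsilon> \<Longrightarrow> x \<epsilon> \<in> M" and c: "0 < c" "\<forall>\<^sub>F \<epsilon> in at_right 0. c \<le> infdist (x \<epsilon>) (frontier M)"
  shows "((\<lambda>\<epsilon>. ln (1 / max \<epsilon> (infdist (x \<epsilon>) (frontier M))) / ln (1 / \<epsilon>)) \<longlongrightarrow> 0) (at_right 0)"
proof -
  obtain \<Delta> where \<Delta>: "1 \<le> \<Delta>" "\<And>x. x \<in> M \<Longrightarrow> infdist x (frontier M) \<le> \<Delta>"
    by (rule infdist_frontier_bound) (rule that, assumption, blast)
  define K where "K = \<bar>ln c\<bar> + \<bar>ln \<Delta>\<bar>"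
  have "((\<lambda>\<epsilon>::real. K / ln (1 / \<epsilon>)) \<longlongrightarrow> 0) (at_right 0)" by real_asymp
  moreover have "\<forall>\<^sub>F \<epsilon> in at_right 0. norm (ln (1 / max \<epsilon> (infdist (x \<epsilon>) (frontier M))) / ln (1 / \<epsilon>)) \<le> K / ln (1 / \<epsilon>)"
    using c(2) eventually_small[OF zero_less_one]
  proof eventually_elim
    case (elim \<epsilon>)
    define m where "m = max \<epsilon> (infdist (x \<epsilon>) (frontier M))"
    have m: "c \<le> m" "m \<le> \<Delta>" using elim \<Delta>(1) \<Delta>(2)[OF x[of \<epsilon>]] by (auto simp: m_def)
    then have "ln c \<le> ln m" "ln m \<le> ln \<Delta>" using c(1) by simp_all
    moreover have "ln (1 / m) = - ln m" using m c(1) by (simp add: ln_div)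
    ultimately have "\<bar>ln (1 / m)\<bar> \<le> K" unfolding K_def by linarith
    moreover have "0 < ln (1 / \<epsilon>)" using elim by simp
    ultimately show ?case unfolding m_def[symmetric] real_norm_def abs_divide
      by (simp add: divide_right_mono)
  qed
  ultimately show ?thesis by (rule Lim_null_comparison[rotated])
qed

end

text \<open>The exponent of \<open>\<delta>\<close> as a power of \<open>\<epsilon>\<close> is the quotient of the logarithms. Since \<open>\<epsilon> = o(\<delta>)\<close>, the values of \<open>\<delta>\<close> are
  eventually positive.\<close>

lemma ratio_iff_power:
  fixes \<delta> :: "real \<Rightarrow> real"
  assumes small: "(\<lambda>\<epsilon>. \<epsilon>) \<in> o[at_right 0](\<delta>)" and nonneg: "\<And>\<epsilon>. 0 \<le> \<delta> \<epsilon>"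
  shows "((\<lambda>\<epsilon>. ln (1 / \<delta> \<epsilon>) / ln (1 / \<epsilon>)) \<longlongrightarrow> \<theta>) (at_right 0) \<longleftrightarrow>
    (\<exists>\<eta> :: real \<Rightarrow> real. (\<eta> \<longlongrightarrow> 0) (at_right 0) \<and> (\<forall>\<^sub>F \<epsilon> in at_right 0. \<delta> \<epsilon> = \<epsilon> powr (\<theta> + \<eta> \<epsilon>)))"
proof
  have ev: "\<forall>\<^sub>F \<epsilon> in at_right 0. \<epsilon> \<in> {0<..<1::real}"
    by (rule eventually_at_right_real) simp
  {
    assume lim: "((\<lambda>\<epsilon>. ln (1 / \<delta> \<epsilon>) / ln (1 / \<epsilon>)) \<longlongrightarrow> \<theta>) (at_right 0)"
    define \<eta> where "\<eta> \<epsilon> = ln (1 / \<delta> \<epsilon>) / ln (1 / \<epsilon>) - \<theta>" for \<epsilon>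
    have "(\<eta> \<longlongrightarrow> \<theta> - \<theta>) (at_right 0)"
      unfolding \<eta>_def[abs_def] by (intro tendsto_diff lim tendsto_const)
    moreover have "\<forall>\<^sub>F \<epsilon> in at_right 0. norm \<epsilon> \<le> 1 * norm (\<delta> \<epsilon>)"
      using small zero_less_one by (rule landau_o.smallD)
    then have "\<forall>\<^sub>F \<epsilon> in at_right 0. \<delta> \<epsilon> = \<epsilon> powr (\<theta> + \<eta> \<epsilon>)"
      using ev
    proof eventually_elim
      case (elim \<epsilon>)
      then have \<delta>: "0 < \<delta> \<epsilon>" using nonneg[of \<epsilon>] by auto
      have "ln (1 / \<delta> \<epsilon>) / ln (1 / \<epsilon>) * ln \<epsilon> = ln (\<delta> \<epsilon>)"
        using elim \<delta> by (simp add: ln_div)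
      then show ?case using elim \<delta> by (simp add: powr_def \<eta>_def)
    qed
    ultimately show "\<exists>\<eta> :: real \<Rightarrow> real. (\<eta> \<longlongrightarrow> 0) (at_right 0) \<and> (\<forall>\<^sub>F \<epsilon> in at_right 0. \<delta> \<epsilon> = \<epsilon> powr (\<theta> + \<eta> \<epsilon>))"
      by auto
  }
  assume "\<exists>\<eta> :: real \<Rightarrow> real. (\<eta> \<longlongrightarrow> 0) (at_right 0) \<and> (\<forall>\<^sub>F \<epsilon> in at_right 0. \<delta> \<epsilon> = \<epsilon> powr (\<theta> + \<eta> \<epsilon>))"
  then obtain \<eta> :: "real \<Rightarrow> real" where \<eta>: "(\<eta> \<longlongrightarrow> 0) (at_right 0)" "\<forall>\<^sub>F \<epsilon> in at_right 0. \<delta> \<epsilon> = \<epsilon> powr (\<theta> + \<eta> \<epsilon>)" by blast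
  have "((\<lambda>\<epsilon>. \<theta> + \<eta> \<epsilon>) \<longlongrightarrow> \<theta> + 0) (at_right 0)" by (intro tendsto_add tendsto_const \<eta>(1))
  then have "((\<lambda>\<epsilon>. \<theta> + \<eta> \<epsilon>) \<longlongrightarrow> \<theta>) (at_right 0)" by simp
  moreover have "\<forall>\<^sub>F \<epsilon> in at_right 0. \<theta> + \<eta> \<epsilon> = ln (1 / \<delta> \<epsilon>) / ln (1 / \<epsilon>)"
    using \<eta>(2) ev
  proof eventually_elim
    case (elim \<epsilon>)
    then show ?case by (simp add: ln_div ln_powr)
  qed
  ultimately show "((\<lambda>\<epsilon>. ln (1 / \<delta> \<epsilon>) / ln (1 / \<epsilon>)) \<longlongrightarrow> \<theta>) (at_right 0)"
    by (rule Lim_transform_eventually)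
qed

lemma plane_domainI: "bounded_domain_closure M \<Longrightarrow> plane_domain M"
  unfolding bounded_domain_closure_def
proof (elim exE conjE)
  fix U :: "(real^2) set" assume U: "open U" "bounded U" "U \<noteq> {}" "M = closure U"
  show "plane_domain M"
  proof
    show "compact M" using U by simp
    show "interior M \<noteq> {}" using U interior_maximal[OF closure_subset U(1)] by blast
  qed
qed

theorem theoremD8:
  fixes M :: "(real^2) set" and x :: "real \<Rightarrow> real^2" and \<delta> \<Lambda> \<Lambda>\<^sub>0 :: "real \<Rightarrow> real"
  assumes domain: "bounded_domain_closure M"
    and reach: "positive_reach M"
    and comparable: "intrinsic_euclidean_comparable M"
    and volume: "quadratic_volume_growth M"
    and admissible: "admissible_reflecting_domain M"
    and C11: "uniformly_C11_boundary M"
    and centers: "\<And>\<epsilon>. 0 < \<epsilon> \<Longrightarrow> x \<epsilon> \<in> M"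
  defines "\<delta> \<equiv> \<lambda>\<epsilon>. infdist (x \<epsilon>) (frontier M)"
    and "\<Lambda> \<equiv> \<lambda>\<epsilon>. dirichlet_eigenvalue M (intrinsic_ball M (x \<epsilon>) \<epsilon>)"
    and "\<Lambda>\<^sub>0 \<equiv> \<lambda>\<epsilon>. pi / (measure lebesgue M * ln (1 / \<epsilon>))"
  shows
    \<comment> \<open>boundary-scale centers\<close>
    "(\<delta> \<in> O[at_right 0](\<lambda>\<epsilon>. \<epsilon>) \<longrightarrow> \<Lambda> \<sim>[at_right 0] (\<lambda>\<epsilon>. 1/2 * \<Lambda>\<^sub>0 \<epsilon>)) \<and>
    \<comment> \<open>intermediate centers\<close>
     (\<forall>\<theta>. (\<lambda>\<epsilon>. \<epsilon>) \<in> o[at_right 0](\<delta>) \<and> (\<delta> \<longlongrightarrow> 0) (at_right 0) \<and> 0 < \<theta> \<and> \<theta> < 1 \<longrightarrow>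
        (((\<lambda>\<epsilon>. ln (1 / \<delta> \<epsilon>) / ln (1 / \<epsilon>)) \<longlongrightarrow> \<theta>) (at_right 0) \<longleftrightarrow>
          (\<exists>\<eta> :: real \<Rightarrow> real. (\<eta> \<longlongrightarrow> 0) (at_right 0) \<and>
             (\<forall>\<^sub>F \<epsilon> in at_right 0. \<delta> \<epsilon> = \<epsilon> powr (\<theta> + \<eta> \<epsilon>)))) \<and>
        (((\<lambda>\<epsilon>. ln (1 / \<delta> \<epsilon>) / ln (1 / \<epsilon>)) \<longlongrightarrow> \<theta>) (at_right 0) \<longrightarrow>
          \<Lambda> \<sim>[at_right 0] (\<lambda>\<epsilon>. boundary_factor \<theta> * \<Lambda>\<^sub>0 \<epsilon>))) \<and>
    \<comment> \<open>macroscopically interior centers\<close>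
     ((\<exists>c>0. \<forall>\<^sub>F \<epsilon> in at_right 0. c \<le> \<delta> \<epsilon>) \<longrightarrow> \<Lambda> \<sim>[at_right 0] \<Lambda>\<^sub>0) \<and>
    \<comment> \<open>the three regimes as a single asymptotic\<close>
     (\<forall>\<theta>. (\<theta> = 1 \<and> \<delta> \<in> O[at_right 0](\<lambda>\<epsilon>. \<epsilon>)) \<or>
          (0 < \<theta> \<and> \<theta> < 1 \<and> (\<lambda>\<epsilon>. \<epsilon>) \<in> o[at_right 0](\<delta>) \<and> (\<delta> \<longlongrightarrow> 0) (at_right 0) \<and>
             ((\<lambda>\<epsilon>. ln (1 / \<delta> \<epsilon>) / ln (1 / \<epsilon>)) \<longlongrightarrow> \<theta>) (at_right 0)) \<or>
          (\<theta> = 0 \<and> (\<exists>c>0. \<forall>\<^sub>F \<epsilon> in at_right 0. c \<le> \<delta> \<epsilon>)) \<longrightarrow>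
        \<Lambda> \<sim>[at_right 0] (\<lambda>\<epsilon>. boundary_factor \<theta> * \<Lambda>\<^sub>0 \<epsilon>))"
proof -
  interpret plane_domain M by (rule plane_domainI[OF domain])
  have spectrum: "discrete_neumann_spectrum_with_gap M"
    using admissible by (simp add: admissible_reflecting_domain_def)
  have main: "\<Lambda> \<sim>[at_right 0] (\<lambda>\<epsilon>. boundary_factor \<theta> * \<Lambda>\<^sub>0 \<epsilon>)"
    if "0 \<le> \<theta>" "((\<lambda>\<epsilon>. ln (1 / max \<epsilon> (\<delta> \<epsilon>)) / ln (1 / \<epsilon>)) \<longlongrightarrow> \<theta>) (at_right 0)" for \<theta>
    unfolding \<Lambda>_def \<Lambda>\<^sub>0_def
    by (rule eigenvalue_asymptotic[OF C11 comparable spectrum centers that[unfolded \<delta>_def]])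
  have boundary: "\<Lambda> \<sim>[at_right 0] (\<lambda>\<epsilon>. boundary_factor 1 * \<Lambda>\<^sub>0 \<epsilon>)"
    if "\<delta> \<in> O[at_right 0](\<lambda>\<epsilon>. \<epsilon>)"
    by (rule main[OF zero_le_one], unfold \<delta>_def) (rule ratio_boundary[OF that[unfolded \<delta>_def]])
  have intermediate: "\<Lambda> \<sim>[at_right 0] (\<lambda>\<epsilon>. boundary_factor \<theta> * \<Lambda>\<^sub>0 \<epsilon>)"
    if "(\<lambda>\<epsilon>. \<epsilon>) \<in> o[at_right 0](\<delta>)" "0 < \<theta>"
      "((\<lambda>\<epsilon>. ln (1 / \<delta> \<epsilon>) / ln (1 / \<epsilon>)) \<longlongrightarrow> \<theta>) (at_right 0)" for \<theta>
    by (rule main[OF less_imp_le[OF that(2)]], unfold \<delta>_def)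
      (rule ratio_intermediate[OF that(1,3)[unfolded \<delta>_def]])
  have interior: "\<Lambda> \<sim>[at_right 0] (\<lambda>\<epsilon>. boundary_factor 0 * \<Lambda>\<^sub>0 \<epsilon>)"
    if c: "\<exists>c>0. \<forall>\<^sub>F \<epsilon> in at_right 0. c \<le> \<delta> \<epsilon>"
  proof -
    from c obtain c where c: "0 < c" "\<forall>\<^sub>F \<epsilon> in at_right 0. c \<le> \<delta> \<epsilon>" by (elim exE conjE)
    have "((\<lambda>\<epsilon>. ln (1 / max \<epsilon> (\<delta> \<epsilon>)) / ln (1 / \<epsilon>)) \<longlongrightarrow> 0) (at_right 0)"
      unfolding \<delta>_def by (rule ratio_interior[OF centers c[unfolded \<delta>_def]])
    then show ?thesis by (rule main[OF order_refl])
  qed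
  have powers: "((\<lambda>\<epsilon>. ln (1 / \<delta> \<epsilon>) / ln (1 / \<epsilon>)) \<longlongrightarrow> \<theta>) (at_right 0) \<longleftrightarrow>
      (\<exists>\<eta> :: real \<Rightarrow> real. (\<eta> \<longlongrightarrow> 0) (at_right 0) \<and> (\<forall>\<^sub>F \<epsilon> in at_right 0. \<delta> \<epsilon> = \<epsilon> powr (\<theta> + \<eta> \<epsilon>)))"
    if "(\<lambda>\<epsilon>. \<epsilon>) \<in> o[at_right 0](\<delta>)" for \<theta>
    by (rule ratio_iff_power[OF that]) (simp add: \<delta>_def infdist_nonneg)
  have half: "boundary_factor 1 = 1/2" and one: "boundary_factor 0 = 1"
    by (simp_all add: boundary_factor_def)
  have halved: "\<Lambda> \<sim>[at_right 0] (\<lambda>\<epsilon>. 1/2 * \<Lambda>\<^sub>0 \<epsilon>)" if "\<delta> \<in> O[at_right 0](\<lambda>\<epsilon>. \<epsilon>)"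
    using boundary[OF that] by (simp only: half)
  have full: "\<Lambda> \<sim>[at_right 0] \<Lambda>\<^sub>0" if "\<exists>c>0. \<forall>\<^sub>F \<epsilon> in at_right 0. c \<le> \<delta> \<epsilon>"
    using interior[OF that] by (simp only: one mult_1_left)
  show ?thesis
  proof (intro conjI allI impI)
    show "\<Lambda> \<sim>[at_right 0] (\<lambda>\<epsilon>. 1/2 * \<Lambda>\<^sub>0 \<epsilon>)" if "\<delta> \<in> O[at_right 0](\<lambda>\<epsilon>. \<epsilon>)"
      by (rule halved[OF that])
  next
    fix \<theta> :: real assume "(\<lambda>\<epsilon>. \<epsilon>) \<in> o[at_right 0](\<delta>) \<and> (\<delta> \<longlongrightarrow> 0) (at_right 0) \<and> 0 < \<theta> \<and> \<theta> < 1"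
    then show "((\<lambda>\<epsilon>. ln (1 / \<delta> \<epsilon>) / ln (1 / \<epsilon>)) \<longlongrightarrow> \<theta>) (at_right 0) \<longleftrightarrow>
        (\<exists>\<eta> :: real \<Rightarrow> real. (\<eta> \<longlongrightarrow> 0) (at_right 0) \<and> (\<forall>\<^sub>F \<epsilon> in at_right 0. \<delta> \<epsilon> = \<epsilon> powr (\<theta> + \<eta> \<epsilon>)))"
      by (intro powers) (elim conjE)
  next
    fix \<theta> :: real assume "(\<lambda>\<epsilon>. \<epsilon>) \<in> o[at_right 0](\<delta>) \<and> (\<delta> \<longlongrightarrow> 0) (at_right 0) \<and> 0 < \<theta> \<and> \<theta> < 1"
      "((\<lambda>\<epsilon>. ln (1 / \<delta> \<epsilon>) / ln (1 / \<epsilon>)) \<longlongrightarrow> \<theta>) (at_right 0)"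
    then show "\<Lambda> \<sim>[at_right 0] (\<lambda>\<epsilon>. boundary_factor \<theta> * \<Lambda>\<^sub>0 \<epsilon>)"
      by (elim conjE) (rule intermediate)
  next
    show "\<Lambda> \<sim>[at_right 0] \<Lambda>\<^sub>0" if "\<exists>c>0. \<forall>\<^sub>F \<epsilon> in at_right 0. c \<le> \<delta> \<epsilon>"
      by (rule full[OF that])
  next
    fix \<theta> :: real
    assume "(\<theta> = 1 \<and> \<delta> \<in> O[at_right 0](\<lambda>\<epsilon>. \<epsilon>)) \<or>
      (0 < \<theta> \<and> \<theta> < 1 \<and> (\<lambda>\<epsilon>. \<epsilon>) \<in> o[at_right 0](\<delta>) \<and> (\<delta> \<longlongrightarrow> 0) (at_right 0) \<and>
        ((\<lambda>\<epsilon>. ln (1 / \<delta> \<epsilon>) / ln (1 / \<epsilon>)) \<longlongrightarrow> \<theta>) (at_right 0)) \<or>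
      (\<theta> = 0 \<and> (\<exists>c>0. \<forall>\<^sub>F \<epsilon> in at_right 0. c \<le> \<delta> \<epsilon>))"
    then show "\<Lambda> \<sim>[at_right 0] (\<lambda>\<epsilon>. boundary_factor \<theta> * \<Lambda>\<^sub>0 \<epsilon>)"
      by (elim disjE conjE) (simp only: boundary, rule intermediate, assumption+, simp only: interior)
  qed
qed

end
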